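(* Let $f:\mathbb{R}^n\times\mathbb{R}\to\mathbb{R}^n$ be smooth and assume that the dynamical system $\dot x(t)=f(x(t),u(t))$ with $u=0$ has a (non-constant) periodic orbit $x_*(t)$ of period $T>0$. Let $P_0\in\mathbb{R}^{n\times n}$ be the monodromy matrix of $x_*$ from time $0$ to $T$, that is, $P_0=Y(T)$ where $\dot Y(t)=\partial_xf(x_*(t),0)Y(t)$, $Y(0)=I$. Let $b_0=\partial_uf(x_*(0),0)\in\mathbb{R}^n$, and assume that $(P_0,b_0)$ is controllable, that is, $\det[b_0,P_0b_0,\ldots,P_0^{n-1}b_0]\neq0$. For $\delta\in(0,T)$ let $\Delta_\delta:\mathbb{R}\to\mathbb{R}$ be the $T$-periodic function with $\Delta_\delta(t)=1/\delta$ for $t\in[0,\delta]$ and $\Delta_\delta(t)=0$ for $t\in(\delta,T)$. Then there exists a vector of gains $K_0\in\mathbb{R}^n$ such that, for all sufficiently small $\epsilon>0$ and $\delta>0$ (that is, there are $\epsilon_0,\delta_0>0$ such that this holds for all $\epsilon\in(0,\epsilon_0)$ and $\delta\in(0,\delta_0)$), the periodic orbit $x(t)=\tilde x(t)=x_*(t)$ of the feedback controlled system $$\dot x(t)=f(x(t),u(t)),\qquad u(t)=\Delta_\delta(t)K_0^T[\tilde x(t)-x(t)],\qquad \tilde x(t)=(1-\epsilon)\tilde x(t-T)+\epsilon x(t-T)$$ has one simple Floquet multiplier at $1$ and all its other Floquet multipliers are inside the open unit circle.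
   Context: Floquet multipliers of the periodic orbit $x=\tilde x=x_*$ of the controlled system: linearise the system in $(x,\tilde x)=(x_*,x_* )$, which gives, with $A(t)=\partial_xf(x_*(t),0)$ and $b(t)=\partial_uf(x_*(t),0)$, $$\dot x(t)=A(t)x(t)+b(t)\Delta_\delta(t)K_0^T[\tilde x(t)-x(t)],\qquad \tilde x(t)=(1-\epsilon)\tilde x(t-T)+\epsilon x(t-T).$$ This linear $T$-periodic system has the phase space $$\{(x,\tilde x)\in C([-T,0];\mathbb{R}^n\times\mathbb{R}^n):\tilde x(0)=(1-\epsilon)\tilde x(-T)+\epsilon x(-T)\}$$ (the initial value is a history segment for both $x$ and $\tilde x$). Its time-$T$ map sends the history on $[-T,0]$ to the solution on $[0,T]$, shifted back to $[-T,0]$. The Floquet multipliers are the nonzero eigenvalues (point spectrum) of this bounded linear time-$T$ map on the complexified phase space. A Floquet multiplier is simple if it has algebraic multiplicity one. Since $\Delta_\delta$ is piecewise constant, the differential equations are understood in the Carathéodory sense (absolutely continuous $x$, equation satisfied for almost every $t$). *)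

theory Defs
  imports
    "HOL-Analysis.Analysis"
    "HOL-Library.Function_Algebras"
    "HOL-Library.Real_Mod"
begin

section \<open>Smoothness, controllability and absolute continuity\<close>

text \<open>On a Euclidean space, all directional derivatives of a differentiable map being
  \<open>C\<^sup>k\<close> means that the map is \<open>C\<close>-(\<open>k + 1\<close>).\<close>

primrec C_k :: "nat \<Rightarrow> ('a::euclidean_space \<Rightarrow> 'b::euclidean_space) \<Rightarrow> bool" where
  "C_k 0 f \<longleftrightarrow> continuous_on UNIV f"
| "C_k (Suc k) f \<longleftrightarrow>
     (\<forall>x. f differentiable (at x)) \<and> (\<forall>v. C_k k (\<lambda>x. frechet_derivative f (at x) v))"

definition smooth :: "('a::euclidean_space \<Rightarrow> 'b::euclidean_space) \<Rightarrow> bool" where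
  "smooth f \<longleftrightarrow> (\<forall>k. C_k k f)"

text \<open>The columns are \<open>b, P b, \<dots>, P\<^sup>n\<^sup>-\<^sup>1 b\<close>. As \<open>'n\<close> is an unordered index type, they are
  placed along the bijection \<open>to_nat_on UNIV\<close> from \<open>'n\<close> onto \<open>{..<CARD('n)}\<close>; another
  bijection changes the determinant at most by its sign.\<close>

definition controllability_matrix :: "real^'n^'n \<Rightarrow> real^'n \<Rightarrow> real^'n^'n" where
  "controllability_matrix P b = (\<chi> i j. (((*v) P ^^ to_nat_on (UNIV :: 'n set) j) b) $ i)"

definition controllable :: "real^'n^'n \<Rightarrow> real^'n \<Rightarrow> bool" where
  "controllable P b \<longleftrightarrow> det (controllability_matrix P b) \<noteq> 0"

definition abs_continuous_on :: "real \<Rightarrow> real \<Rightarrow> (real \<Rightarrow> 'a::real_normed_vector) \<Rightarrow> bool" where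
  "abs_continuous_on l u x \<longleftrightarrow>
     (\<forall>\<eta>>0. \<exists>\<rho>>0. \<forall>(m::nat) a b.
        (\<forall>i<m. l \<le> a i \<and> a i \<le> b i \<and> b i \<le> u) \<and>
        (\<forall>i<m. \<forall>j<m. i \<noteq> j \<longrightarrow> {a i<..<b i} \<inter> {a j<..<b j} = {}) \<and>
        (\<Sum>i<m. b i - a i) < \<rho>
        \<longrightarrow> (\<Sum>i<m. norm (x (b i) - x (a i))) < \<eta>)"


section \<open>The feedback controlled system\<close>

definition pulse :: "real \<Rightarrow> real \<Rightarrow> real \<Rightarrow> real" where
  "pulse T \<delta> t = (if t rmod T \<le> \<delta> then 1 / \<delta> else 0)"

definition controlled_solution ::
  "((real^'n) \<times> real \<Rightarrow> real^'n) \<Rightarrow> real \<Rightarrow> real \<Rightarrow> real \<Rightarrow> real^'n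
     \<Rightarrow> (real \<Rightarrow> real^'n) \<Rightarrow> (real \<Rightarrow> real^'n) \<Rightarrow> bool" where
  "controlled_solution f T \<epsilon> \<delta> K x xt \<longleftrightarrow>
     (\<forall>l u. abs_continuous_on l u x) \<and>
     (AE t in lborel.
        (x has_vector_derivative f (x t, pulse T \<delta> t * (K \<bullet> (xt t - x t)))) (at t)) \<and>
     (\<forall>t. xt t = (1 - \<epsilon>) *\<^sub>R xt (t - T) + \<epsilon> *\<^sub>R x (t - T))"

definition orbit_A :: "((real^'n) \<times> real \<Rightarrow> real^'n) \<Rightarrow> (real \<Rightarrow> real^'n) \<Rightarrow> real \<Rightarrow> real^'n^'n" where
  "orbit_A f xs t = jacobian (\<lambda>x. f (x, 0)) (at (xs t))"

definition orbit_b :: "((real^'n) \<times> real \<Rightarrow> real^'n) \<Rightarrow> (real \<Rightarrow> real^'n) \<Rightarrow> real \<Rightarrow> real^'n" where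
  "orbit_b f xs t = vector_derivative (\<lambda>u. f (xs t, u)) (at 0)"


section \<open>Linearisation and time-\<open>T\<close> map on the complexified phase space\<close>

text \<open>A history segment pairs the histories of \<open>x\<close> and of \<open>xt\<close> (the delayed variable).
  It is a function on \<open>{-T..0}\<close>, extended by \<open>0\<close> outside this interval: the extension makes
  the representation unique and compatible with pointwise addition and scaling.\<close>

type_synonym 'n history = "real \<Rightarrow> (complex^'n) \<times> (complex^'n)"

definition hscale :: "complex \<Rightarrow> 'n history \<Rightarrow> 'n::finite history" where
  "hscale c \<phi> = (\<lambda>t. (c *s fst (\<phi> t), c *s snd (\<phi> t)))"

lemma vector_space_hscale: "vector_space (hscale :: complex \<Rightarrow> 'n history \<Rightarrow> 'n::finite history)"
  by unfold_locales
    (auto simp: hscale_def fun_eq_iff vec_eq_iff algebra_simps)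

definition phase_space :: "real \<Rightarrow> real \<Rightarrow> 'n::finite history set" where
  "phase_space T \<epsilon> =
     {\<phi>. continuous_on {-T..0} \<phi> \<and> (\<forall>t. t \<notin> {-T..0} \<longrightarrow> \<phi> t = 0) \<and>
         snd (\<phi> 0) = (1 - \<epsilon>) *\<^sub>R snd (\<phi> (-T)) + \<epsilon> *\<^sub>R fst (\<phi> (-T))}"

definition cvec :: "real^'n \<Rightarrow> complex^'n" where
  "cvec v = (\<chi> i. complex_of_real (v $ i))"

definition linearised_solution ::
  "((real^'n) \<times> real \<Rightarrow> real^'n) \<Rightarrow> (real \<Rightarrow> real^'n) \<Rightarrow> real \<Rightarrow> real \<Rightarrow> real \<Rightarrow> real^'n
     \<Rightarrow> 'n history \<Rightarrow> (real \<Rightarrow> complex^'n) \<Rightarrow> (real \<Rightarrow> complex^'n) \<Rightarrow> bool" where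
  "linearised_solution f xs T \<epsilon> \<delta> K \<phi> x xt \<longleftrightarrow>
     (\<forall>t\<in>{-T..0}. (x t, xt t) = \<phi> t) \<and>
     abs_continuous_on 0 T x \<and>
     (AE t in lborel. t \<in> {0..T} \<longrightarrow>
        (x has_vector_derivative
           (map_matrix complex_of_real (orbit_A f xs t) *v x t
            + (complex_of_real (pulse T \<delta> t) * scalar_product (cvec K) (xt t - x t))
                *s cvec (orbit_b f xs t))) (at t)) \<and>
     (\<forall>t\<in>{0..T}. xt t = (1 - \<epsilon>) *\<^sub>R xt (t - T) + \<epsilon> *\<^sub>R x (t - T))"

definition time_T_map ::
  "((real^'n) \<times> real \<Rightarrow> real^'n) \<Rightarrow> (real \<Rightarrow> real^'n) \<Rightarrow> real \<Rightarrow> real \<Rightarrow> real \<Rightarrow> real^'n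
     \<Rightarrow> 'n history \<Rightarrow> 'n history" where
  "time_T_map f xs T \<epsilon> \<delta> K \<phi> =
     (THE \<psi>. \<exists>x xt. linearised_solution f xs T \<epsilon> \<delta> K \<phi> x xt \<and>
        \<psi> = (\<lambda>t. if t \<in> {-T..0} then (x (t + T), xt (t + T)) else 0))"


section \<open>Floquet multipliers\<close>

definition floquet_multipliers ::
  "((real^'n) \<times> real \<Rightarrow> real^'n) \<Rightarrow> (real \<Rightarrow> real^'n) \<Rightarrow> real \<Rightarrow> real \<Rightarrow> real \<Rightarrow> real^'n
     \<Rightarrow> complex set" where
  "floquet_multipliers f xs T \<epsilon> \<delta> K =
     {\<mu>. \<mu> \<noteq> 0 \<and> (\<exists>\<phi>\<in>phase_space T \<epsilon>. \<phi> \<noteq> 0 \<and> time_T_map f xs T \<epsilon> \<delta> K \<phi> = hscale \<mu> \<phi>)}"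

definition generalized_eigenspace ::
  "((real^'n) \<times> real \<Rightarrow> real^'n) \<Rightarrow> (real \<Rightarrow> real^'n) \<Rightarrow> real \<Rightarrow> real \<Rightarrow> real \<Rightarrow> real^'n
     \<Rightarrow> complex \<Rightarrow> 'n history set" where
  "generalized_eigenspace f xs T \<epsilon> \<delta> K \<mu> =
     {\<phi>\<in>phase_space T \<epsilon>.
        \<exists>k. ((\<lambda>\<psi>. time_T_map f xs T \<epsilon> \<delta> K \<psi> - hscale \<mu> \<psi>) ^^ k) \<phi> = 0}"

text \<open>The dimension over \<open>\<complex>\<close>; for an infinite-dimensional space \<open>vector_space.dim\<close> is \<open>0\<close>.\<close>

definition algebraic_multiplicity ::
  "((real^'n) \<times> real \<Rightarrow> real^'n) \<Rightarrow> (real \<Rightarrow> real^'n) \<Rightarrow> real \<Rightarrow> real \<Rightarrow> real \<Rightarrow> real^'n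
     \<Rightarrow> complex \<Rightarrow> nat" where
  "algebraic_multiplicity f xs T \<epsilon> \<delta> K \<mu> =
     vector_space.dim hscale (generalized_eigenspace f xs T \<epsilon> \<delta> K \<mu>)"

definition simple_floquet_multiplier ::
  "((real^'n) \<times> real \<Rightarrow> real^'n) \<Rightarrow> (real \<Rightarrow> real^'n) \<Rightarrow> real \<Rightarrow> real \<Rightarrow> real \<Rightarrow> real^'n
     \<Rightarrow> complex \<Rightarrow> bool" where
  "simple_floquet_multiplier f xs T \<epsilon> \<delta> K \<mu> \<longleftrightarrow>
     \<mu> \<in> floquet_multipliers f xs T \<epsilon> \<delta> K \<and> algebraic_multiplicity f xs T \<epsilon> \<delta> K \<mu> = 1"

end

theory Submission
  imports Defs
begin

text \<open>On an eigenfunction for a multiplier \<open>\<mu>\<close> the recursion for the delayed variable gives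
  \<open>xt - x = - \<kappa> x\<close> with \<open>\<kappa> = (\<mu> - 1) / (\<mu> - 1 + \<epsilon>)\<close>, and \<open>\<bar>\<mu>\<bar> \<ge> 1\<close> forces \<open>\<bar>\<kappa> - 1\<bar> \<le> 1\<close>. So
  \<open>x\<close> solves an ordinary differential equation whose period map tends to
  \<open>P\<^sub>0 exp (- \<kappa> b\<^sub>0 K\<^sup>T)\<close>, uniformly in \<open>\<kappa>\<close>, as \<open>\<delta>\<close> tends to \<open>0\<close>. The gain \<open>K\<close> is chosen by pole
  placement such that this matrix has spectral radius below \<open>1\<close> for \<open>\<kappa> = 1\<close>. If unstable multipliers
  \<open>\<mu> \<noteq> 1\<close> persisted for \<open>\<epsilon>, \<delta> \<rightarrow> 0\<close>, a limit \<open>(v, \<kappa>, \<mu>)\<close> would have \<open>\<kappa> = 1\<close>, which contradicts the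
  choice of \<open>K\<close>, or \<open>\<mu> = 1\<close>. In the latter case pairing with the left eigenvector of \<open>P\<^sub>0\<close> for the
  trivial multiplier, divided by \<open>\<kappa>\<close> before the limit is taken, yields \<open>K\<^sup>T v = 0\<close>; then the feedback does
  not act on \<open>v\<close>, and \<open>1\<close> would be an eigenvalue for \<open>\<kappa> = 1\<close> too. The same pairing excludes
  generalised eigenvectors for \<open>\<mu> = 1\<close>.\<close>

section \<open>Differential equations and absolute continuity\<close>

text \<open>The quotient defining \<kappa> has the form 0/0 when \<mu> tends to 1 and \<epsilon> to
  0 together. The conclusion \<open>K^T v = 0\<close> also needs that (1 - exp (- z)) / z has no
  zero on real multiples of that disc: its zeros are imaginary and nonzero, and the disc meets the
  imaginary axis only at 0. No sequences are formed. The residuals of the limit relations are added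
  up to one continuous function, positive on a compact set and hence bounded below, but arbitrarily
  small along unstable multipliers. Pole placement meets an obstruction of sign: a real pulse
  multiplies \<open>P\<^sub>0\<close> by an exponential, whose determinant is positive, so the
  product of the placed poles must have the sign of \<open>det P\<^sub>0\<close>. This sign is
  positive, since the invertible matrices \<open>Y t\<close> join \<open>P\<^sub>0\<close> to the
  identity. The poles are the roots of an equation \<open>s^n = \<sigma>\<close> with |\<sigma>| =
  1/2, the sign of \<sigma> excluding real roots that are not positive.\<close>

lemma gronwall_norm:
  fixes u u' :: "real \<Rightarrow> 'a::real_inner"
  assumes "a \<le> b"
    and deriv: "\<And>t. t \<in> {a..b} \<Longrightarrow> (u has_vector_derivative u' t) (at t within {a..b})"
    and bound: "\<And>t. t \<in> {a..b} \<Longrightarrow> norm (u' t) \<le> L * norm (u t) + m"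
    and "0 \<le> L" "0 \<le> m" and t: "t \<in> {a..b}"
  shows "norm (u t) \<le> (norm (u a) + m * (t - a)) * exp (L * (t - a))"
proof -
  have approx: "norm (u t) \<le> (norm (u a) + \<eta> + m * (t - a)) * exp (L * (t - a))" if "\<eta> > 0" for \<eta>
  proof -
    \<comment> \<open>The norm is not differentiable at 0; this smooth majorant is, and
      \<open>\<eta>\<close> tends to 0 at the end. The function \<open>g\<close> is nonincreasing
      because the derivative of \<open>s\<close> is at most \<open>L * s + m\<close>.\<close>
    define s where "s r = sqrt (u r \<bullet> u r + \<eta>\<^sup>2)" for r
    define g where "g r = s r * exp (- L * (r - a)) - m * (r - a)" for r
    have pos: "u r \<bullet> u r + \<eta>\<^sup>2 > 0" for r
      using \<open>\<eta> > 0\<close> by (simp add: add_nonneg_pos)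
    have s_pos: "s r > 0" for r
      using pos by (simp add: s_def)
    have norm_le_s: "norm (u r) \<le> s r" for r
      unfolding s_def norm_eq_sqrt_inner by (rule real_sqrt_le_mono) simp
    have cont_u: "continuous_on {a..b} u"
      using deriv by (rule continuous_on_vector_derivative)
    have cont_g: "continuous_on {a..t} g"
      unfolding g_def s_def using t
      by (intro continuous_intros continuous_on_subset[OF cont_u]) auto
    have g_deriv: "\<exists>y. DERIV g r :> y \<and> y \<le> 0" if r: "a < r" "r < t" for r
    proof -
      have du: "(u has_vector_derivative u' r) (at r)"
        using deriv[of r] r t by (simp add: at_within_Icc_at)
      have "((\<lambda>r. u r \<bullet> u r) has_real_derivative 2 * (u r \<bullet> u' r)) (at r)"
        using bounded_bilinear.has_vector_derivative[OF bounded_bilinear_inner du du]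
        by (simp add: has_real_derivative_iff_has_vector_derivative inner_commute)
      then have ds: "DERIV s r :> (u r \<bullet> u' r) / s r"
        unfolding s_def using pos[of r]
        by (auto intro!: derivative_eq_intros simp: field_simps)
      let ?e = "exp (- L * (r - a))"
      have "DERIV g r :> (u r \<bullet> u' r) / s r * ?e - L * s r * ?e - m"
        unfolding g_def by (rule derivative_eq_intros ds refl | simp)+
      moreover have "(u r \<bullet> u' r) / s r * ?e - L * s r * ?e - m \<le> 0"
      proof -
        have "u r \<bullet> u' r \<le> norm (u r) * norm (u' r)"
          by (rule norm_cauchy_schwarz)
        also have "\<dots> \<le> s r * (L * s r + m)"
        proof (rule mult_mono)
          show "norm (u' r) \<le> L * s r + m"
            using bound[of r] mult_left_mono[OF norm_le_s[of r] \<open>0 \<le> L\<close>] r t by auto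
        qed (use norm_le_s[of r] s_pos[of r] in auto)
        finally have "(u r \<bullet> u' r) / s r \<le> L * s r + m"
          using s_pos[of r] by (simp add: divide_simps mult.commute)
        then have "(u r \<bullet> u' r) / s r * ?e \<le> (L * s r + m) * ?e"
          by (rule mult_right_mono) simp
        moreover have "m * ?e \<le> m"
          using \<open>0 \<le> m\<close> \<open>0 \<le> L\<close> r by (simp add: mult_left_le)
        ultimately show ?thesis
          by (simp add: algebra_simps)
      qed
      ultimately show ?thesis by blast
    qed
    have "g t \<le> g a"
      using DERIV_nonpos_imp_decreasing_open[of a t g] g_deriv cont_g t by auto
    then have "s t * exp (- L * (t - a)) \<le> s a + m * (t - a)"
      by (simp add: g_def)
    moreover have "s a \<le> norm (u a) + \<eta>"
      unfolding s_def power2_norm_eq_inner[symmetric]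
      using sqrt_sum_squares_le_sum[of "norm (u a)" \<eta>] \<open>\<eta> > 0\<close> by simp
    ultimately have "s t * exp (- L * (t - a)) \<le> norm (u a) + \<eta> + m * (t - a)" by linarith
    then have "s t * exp (- L * (t - a)) * exp (L * (t - a)) \<le> (norm (u a) + \<eta> + m * (t - a)) * exp (L * (t - a))"
      by (rule mult_right_mono) simp
    then have "s t \<le> (norm (u a) + \<eta> + m * (t - a)) * exp (L * (t - a))"
      by (simp add: mult.assoc exp_add[symmetric])
    with norm_le_s[of t] show ?thesis by linarith
  qed
  show ?thesis
  proof (rule field_le_epsilon)
    fix e :: real assume "e > 0"
    define E where "E = exp (L * (t - a))"
    have "E > 0" by (simp add: E_def)
    then show "norm (u t) \<le> (norm (u a) + m * (t - a)) * exp (L * (t - a)) + e"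
      using approx[of "e / E"] \<open>e > 0\<close> unfolding E_def[symmetric] by (simp add: distrib_right)
  qed
qed

corollary norm_increment_le:
  fixes u u' :: "real \<Rightarrow> 'a::real_inner"
  assumes "a \<le> b"
    and "\<And>t. t \<in> {a..b} \<Longrightarrow> (u has_vector_derivative u' t) (at t within {a..b})"
    and "\<And>t. t \<in> {a..b} \<Longrightarrow> norm (u' t) \<le> m"
  shows "norm (u b - u a) \<le> m * (b - a)"
proof -
  have "m \<ge> 0"
    using assms(1) assms(3)[of a] norm_ge_zero[of "u' a"] by (simp del: norm_ge_zero)
  moreover have "((\<lambda>t. u t - u a) has_vector_derivative u' t) (at t within {a..b})" if "t \<in> {a..b}" for t
    using has_vector_derivative_diff[OF assms(2)[OF that] has_vector_derivative_const[of "u a"]] by simp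
  ultimately show ?thesis
    using gronwall_norm[of a b "\<lambda>t. u t - u a" u' 0 m b] assms by simp
qed

lemma picard_lipschitz:
  fixes F :: "real \<Rightarrow> 'a::banach \<Rightarrow> 'a"
  assumes "a \<le> b" "0 \<le> L"
    and lip: "\<And>t x y. t \<in> {a..b} \<Longrightarrow> norm (F t x - F t y) \<le> L * norm (x - y)"
    and cont: "\<And>x. continuous_on {a..b} x \<Longrightarrow> continuous_on {a..b} (\<lambda>t. F t (x t))"
  obtains x where "x a = x0"
    and "\<And>t. t \<in> {a..b} \<Longrightarrow> (x has_vector_derivative F t (x t)) (at t within {a..b})"
proof -
  \<comment> \<open>The contraction factor is \<open>L / l\<close>, below 1/2 for this
    \<open>l\<close>; the summand 1 keeps \<open>l\<close> positive for
    \<open>L = 0\<close>.\<close>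
  define l where "l = 2 * L + 1"
  define J where "J z = (\<lambda>t. integral {a..t} (\<lambda>s. F s (exp (l * (s - a)) *\<^sub>R apply_bcontfun z s)))"
    for z :: "real \<Rightarrow>\<^sub>C 'a"
  define G where "G z t = exp (- l * (t - a)) *\<^sub>R (x0 + J z t)" for z t
  have contz: "continuous_on S (apply_bcontfun z)" for z :: "real \<Rightarrow>\<^sub>C 'a" and S
    using apply_bcontfun[of z] by (auto simp: bcontfun_def intro: continuous_on_subset)
  have contF: "continuous_on {a..b} (\<lambda>s. F s (exp (l * (s - a)) *\<^sub>R apply_bcontfun z s))" for z
    by (intro cont continuous_intros contz)
  have J_deriv: "(J z has_vector_derivative F t (exp (l * (t - a)) *\<^sub>R apply_bcontfun z t)) (at t within {a..b})"
    if "t \<in> {a..b}" for z t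
    unfolding J_def by (rule integral_has_vector_derivative[OF contF that])
  have J_cont: "continuous_on {a..b} (J z)" for z
    using J_deriv by (rule continuous_on_vector_derivative)
  have G_cont: "continuous_on (cbox a b) (G z)" for z
    unfolding G_def cbox_interval by (intro continuous_intros J_cont)
  \<comment> \<open>Elements of the complete space are functions on the whole real line, hence the
    extension of \<open>G z\<close> by clamping the argument to \<open>{a..b}\<close>.\<close>
  define \<Phi> where "\<Phi> z = Bcontfun (ext_cont (G z) a b)" for z
  have \<Phi>: "apply_bcontfun (\<Phi> z) = ext_cont (G z) a b" for z
    unfolding \<Phi>_def
  proof (rule Bcontfun_inverse)
    have "bounded (G z ` cbox a b)"
      by (intro compact_imp_bounded compact_continuous_image G_cont) auto
    moreover have "range (ext_cont (G z) a b) \<subseteq> G z ` cbox a b"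
      using clamp_in_interval[of a b] \<open>a \<le> b\<close> by (auto simp: ext_cont_def)
    ultimately show "ext_cont (G z) a b \<in> bcontfun"
      by (auto simp: bcontfun_def intro: continuous_on_ext_cont G_cont bounded_subset)
  qed
  have contraction: "dist (\<Phi> z) (\<Phi> z') \<le> 1/2 * dist z z'" for z z'
  proof (rule dist_bound)
    fix t
    let ?t = "clamp a b t"
    have t: "?t \<in> {a..b}"
      using clamp_in_interval[of a b t] \<open>a \<le> b\<close> by (simp add: cbox_interval)
    have int: "(\<lambda>s. F s (exp (l * (s - a)) *\<^sub>R apply_bcontfun z s)) integrable_on {a..?t}" for z
      using t by (intro integrable_continuous_real continuous_on_subset[OF contF]) auto
    have "norm (J z ?t - J z' ?t) \<le> L * dist z z' * exp (l * (?t - a)) / l"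
    proof -
      have "norm (J z ?t - J z' ?t) =
          norm (integral {a..?t} (\<lambda>s. F s (exp (l * (s - a)) *\<^sub>R apply_bcontfun z s)
            - F s (exp (l * (s - a)) *\<^sub>R apply_bcontfun z' s)))"
        unfolding J_def by (subst Henstock_Kurzweil_Integration.integral_diff[OF int int]) simp_all
      also have "\<dots> \<le> integral {a..?t} (\<lambda>s. L * dist z z' * exp (l * (s - a)))"
      proof (rule integral_norm_bound_integral)
        fix s assume s: "s \<in> {a..?t}"
        have "norm (F s (exp (l * (s - a)) *\<^sub>R apply_bcontfun z s) - F s (exp (l * (s - a)) *\<^sub>R apply_bcontfun z' s))
          \<le> L * norm (exp (l * (s - a)) *\<^sub>R apply_bcontfun z s - exp (l * (s - a)) *\<^sub>R apply_bcontfun z' s)"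
          using s t by (intro lip) auto
        also have "\<dots> = L * (exp (l * (s - a)) * dist (apply_bcontfun z s) (apply_bcontfun z' s))"
          by (simp add: scaleR_diff_right[symmetric] dist_norm del: scaleR_diff_right)
        also have "\<dots> \<le> L * (exp (l * (s - a)) * dist z z')"
          using \<open>0 \<le> L\<close> by (intro mult_left_mono dist_bounded) auto
        finally show "norm (F s (exp (l * (s - a)) *\<^sub>R apply_bcontfun z s) - F s (exp (l * (s - a)) *\<^sub>R apply_bcontfun z' s))
          \<le> L * dist z z' * exp (l * (s - a))" by (simp add: mult_ac)
      next
        show "(\<lambda>s. F s (exp (l * (s - a)) *\<^sub>R apply_bcontfun z s)
            - F s (exp (l * (s - a)) *\<^sub>R apply_bcontfun z' s)) integrable_on {a..?t}"
          by (rule Henstock_Kurzweil_Integration.integrable_diff[OF int int])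
      qed (auto intro!: integrable_continuous_real continuous_intros)
      also have "\<dots> = L * dist z z' * exp (l * (?t - a)) / l - L * dist z z' * exp (l * (a - a)) / l"
      proof (rule integral_unique[OF fundamental_theorem_of_calculus])
        have "l \<noteq> 0" using \<open>0 \<le> L\<close> by (simp add: l_def)
        then show "((\<lambda>s. L * dist z z' * exp (l * (s - a)) / l) has_vector_derivative L * dist z z' * exp (l * (s - a)))
             (at s within {a..?t})" for s
          unfolding has_real_derivative_iff_has_vector_derivative[symmetric]
          by (auto intro!: derivative_eq_intros)
      qed (use t in auto)
      also have "\<dots> \<le> L * dist z z' * exp (l * (?t - a)) / l"
        using \<open>0 \<le> L\<close> by (simp add: l_def)
      finally show ?thesis .
    qed
    then have "exp (- l * (?t - a)) * norm (J z ?t - J z' ?t)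
        \<le> exp (- l * (?t - a)) * (L * dist z z' * exp (l * (?t - a)) / l)"
      by (rule mult_left_mono) simp
    also have "\<dots> = (exp (- l * (?t - a)) * exp (l * (?t - a))) * (L / l * dist z z')"
      by simp
    also have "exp (- l * (?t - a)) * exp (l * (?t - a)) = 1"
      by (simp add: exp_add[symmetric])
    also have "1 * (L / l * dist z z') = L / l * dist z z'" by simp
    also have "\<dots> \<le> 1/2 * dist z z'"
      using \<open>0 \<le> L\<close> by (intro mult_right_mono) (auto simp: l_def field_simps)
    finally show "dist (apply_bcontfun (\<Phi> z) t) (apply_bcontfun (\<Phi> z') t) \<le> 1/2 * dist z z'"
      by (simp add: \<Phi> ext_cont_def G_def dist_norm scaleR_diff_right[symmetric] del: scaleR_diff_right)
  qed
  obtain z where z: "\<Phi> z = z"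
    using banach_fix_type[of "1/2" \<Phi>] contraction by auto
  define x where "x t = x0 + J z t" for t
  have xz: "exp (l * (t - a)) *\<^sub>R apply_bcontfun z t = x t" if "t \<in> {a..b}" for t
  proof -
    have "apply_bcontfun z t = G z t"
      using \<Phi>[of z] that by (simp add: z cbox_interval)
    then show ?thesis
      by (simp add: G_def x_def exp_minus)
  qed
  show thesis
  proof
    show "x a = x0" by (simp add: x_def J_def)
    show "(x has_vector_derivative F t (x t)) (at t within {a..b})" if "t \<in> {a..b}" for t
      using has_vector_derivative_add[OF has_vector_derivative_const J_deriv[OF that], of x0 z] xz[OF that]
      unfolding x_def[abs_def] by simp
  qed
qed

section \<open>Absolutely continuous functions and Caratheodory solutions\<close>

definition ac_modulus :: "real \<Rightarrow> real \<Rightarrow> (real \<Rightarrow> 'a::real_normed_vector) \<Rightarrow> real \<Rightarrow> real \<Rightarrow> bool" where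
  "ac_modulus l u x \<eta> \<rho> \<longleftrightarrow> (\<forall>(m::nat) a b.
        (\<forall>i<m. l \<le> a i \<and> a i \<le> b i \<and> b i \<le> u) \<and>
        (\<forall>i<m. \<forall>j<m. i \<noteq> j \<longrightarrow> {a i<..<b i} \<inter> {a j<..<b j} = {}) \<and>
        (\<Sum>i<m. b i - a i) < \<rho>
        \<longrightarrow> (\<Sum>i<m. norm (x (b i) - x (a i))) < \<eta>)"

lemma abs_continuous_on_iff_ac_modulus:
  "abs_continuous_on l u x \<longleftrightarrow> (\<forall>\<eta>>0. \<exists>\<rho>>0. ac_modulus l u x \<eta> \<rho>)"
  unfolding abs_continuous_on_def ac_modulus_def ..

lemma ac_modulusI:
  assumes "\<And>(m::nat) a b. \<lbrakk>\<And>i. i < m \<Longrightarrow> l \<le> a i \<and> a i \<le> b i \<and> b i \<le> u;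
           \<And>i j. \<lbrakk>i < m; j < m; i \<noteq> j\<rbrakk> \<Longrightarrow> {a i<..<b i} \<inter> {a j<..<b j} = {};
           (\<Sum>i<m. b i - a i) < \<rho>\<rbrakk> \<Longrightarrow> (\<Sum>i<m. norm (x (b i) - x (a i))) < \<eta>"
  shows "ac_modulus l u x \<eta> \<rho>"
  unfolding ac_modulus_def by (intro allI impI assms) simp_all

lemma ac_modulusD:
  fixes m :: nat
  assumes "ac_modulus l u x \<eta> \<rho>" and "\<And>i. i < m \<Longrightarrow> l \<le> a i \<and> a i \<le> b i \<and> b i \<le> u"
    and "\<And>i j. \<lbrakk>i < m; j < m; i \<noteq> j\<rbrakk> \<Longrightarrow> {a i<..<b i} \<inter> {a j<..<b j} = {}"
    and "(\<Sum>i<m. b i - a i) < \<rho>"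
  shows "(\<Sum>i<m. norm (x (b i) - x (a i))) < \<eta>"
  using assms(1)[unfolded ac_modulus_def, THEN spec[of _ m], THEN spec[of _ a], THEN spec[of _ b], THEN mp] assms(2-)
  by simp

lemma lipschitz_imp_abs_continuous_on:
  assumes "M-lipschitz_on {l..u} x"
  shows "abs_continuous_on l u x"
  unfolding abs_continuous_on_iff_ac_modulus
proof (intro allI impI)
  fix \<eta> :: real assume "\<eta> > 0"
  have "M \<ge> 0" using assms by (rule lipschitz_on_nonneg)
  show "\<exists>\<rho>>0. ac_modulus l u x \<eta> \<rho>"
  proof (intro exI[of _ "\<eta> / (M + 1)"] conjI ac_modulusI)
    show "\<eta> / (M + 1) > 0" using \<open>\<eta> > 0\<close> \<open>M \<ge> 0\<close> by simp
    fix m :: nat and a b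
    assume ab: "\<And>i. i < m \<Longrightarrow> l \<le> a i \<and> a i \<le> b i \<and> b i \<le> u" and less: "(\<Sum>i<m. b i - a i) < \<eta> / (M + 1)"
    have "(\<Sum>i<m. norm (x (b i) - x (a i))) \<le> (\<Sum>i<m. M * (b i - a i))"
    proof (rule sum_mono)
      fix i assume i: "i \<in> {..<m}"
      then have "l \<le> a i" "a i \<le> b i" "b i \<le> u" using ab by auto
      then show "norm (x (b i) - x (a i)) \<le> M * (b i - a i)"
        using lipschitz_onD[OF assms, of "b i" "a i"] by (simp add: dist_norm)
    qed
    also have "\<dots> = M * (\<Sum>i<m. b i - a i)" by (simp add: sum_distrib_left)
    also have "\<dots> \<le> (M + 1) * (\<Sum>i<m. b i - a i)"
      using ab by (intro mult_right_mono sum_nonneg) auto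
    also have "\<dots> < \<eta>"
      using less \<open>M \<ge> 0\<close> by (simp add: pos_less_divide_eq mult.commute)
    finally show "(\<Sum>i<m. norm (x (b i) - x (a i))) < \<eta>" .
  qed
qed

lemma abs_continuous_on_subset:
  assumes "abs_continuous_on l u x" "l \<le> l'" "u' \<le> u"
  shows "abs_continuous_on l' u' x"
  unfolding abs_continuous_on_iff_ac_modulus
proof (intro allI impI)
  fix \<eta> :: real assume "\<eta> > 0"
  obtain \<rho> where "\<rho> > 0" and \<rho>: "ac_modulus l u x \<eta> \<rho>"
    using assms(1) \<open>\<eta> > 0\<close> unfolding abs_continuous_on_iff_ac_modulus by blast
  show "\<exists>\<rho>>0. ac_modulus l' u' x \<eta> \<rho>"
  proof (intro exI[of _ \<rho>] conjI ac_modulusI ac_modulusD[OF \<rho>])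
    fix m :: nat and a b i
    assume "\<And>i. i < m \<Longrightarrow> l' \<le> a i \<and> a i \<le> b i \<and> b i \<le> u'" "i < m"
    then have "l' \<le> a i" "a i \<le> b i" "b i \<le> u'" by auto
    then show "l \<le> a i" "a i \<le> b i" "b i \<le> u" using assms(2,3) by linarith+
  qed (simp_all add: \<open>\<rho> > 0\<close>)
qed

lemma abs_continuous_on_diff:
  assumes "abs_continuous_on l u x" "abs_continuous_on l u y"
  shows "abs_continuous_on l u (\<lambda>t. x t - y t)"
  unfolding abs_continuous_on_iff_ac_modulus
proof (intro allI impI)
  fix \<eta> :: real assume "\<eta> > 0"
  then have "\<eta> / 2 > 0" by simp
  obtain \<rho>1 where "\<rho>1 > 0" and \<rho>1: "ac_modulus l u x (\<eta> / 2) \<rho>1"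
    using assms(1) \<open>\<eta> / 2 > 0\<close> unfolding abs_continuous_on_iff_ac_modulus by blast
  obtain \<rho>2 where "\<rho>2 > 0" and \<rho>2: "ac_modulus l u y (\<eta> / 2) \<rho>2"
    using assms(2) \<open>\<eta> / 2 > 0\<close> unfolding abs_continuous_on_iff_ac_modulus by blast
  show "\<exists>\<rho>>0. ac_modulus l u (\<lambda>t. x t - y t) \<eta> \<rho>"
  proof (intro exI[of _ "min \<rho>1 \<rho>2"] conjI ac_modulusI)
    show "min \<rho>1 \<rho>2 > 0" using \<open>\<rho>1 > 0\<close> \<open>\<rho>2 > 0\<close> by simp
    fix m :: nat and a b
    assume *: "\<And>i. i < m \<Longrightarrow> l \<le> a i \<and> a i \<le> b i \<and> b i \<le> u"
      "\<And>i j. \<lbrakk>i < m; j < m; i \<noteq> j\<rbrakk> \<Longrightarrow> {a i<..<b i} \<inter> {a j<..<b j} = {}" "(\<Sum>i<m. b i - a i) < min \<rho>1 \<rho>2"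
    have "(\<Sum>i<m. norm (x (b i) - y (b i) - (x (a i) - y (a i))))
        \<le> (\<Sum>i<m. norm (x (b i) - x (a i)) + norm (y (b i) - y (a i)))"
    proof (rule sum_mono)
      fix i
      have "x (b i) - y (b i) - (x (a i) - y (a i)) = (x (b i) - x (a i)) - (y (b i) - y (a i))" by simp
      then show "norm (x (b i) - y (b i) - (x (a i) - y (a i)))
          \<le> norm (x (b i) - x (a i)) + norm (y (b i) - y (a i))"
        by (metis norm_triangle_ineq4)
    qed
    also have "\<dots> < \<eta> / 2 + \<eta> / 2"
      unfolding sum.distrib
    proof (rule add_strict_mono)
      show "(\<Sum>i<m. norm (x (b i) - x (a i))) < \<eta> / 2" by (rule ac_modulusD[OF \<rho>1]) (use * in simp_all)
      show "(\<Sum>i<m. norm (y (b i) - y (a i))) < \<eta> / 2" by (rule ac_modulusD[OF \<rho>2]) (use * in simp_all)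
    qed
    finally show "(\<Sum>i<m. norm (x (b i) - y (b i) - (x (a i) - y (a i)))) < \<eta>" by simp
  qed
qed

text \<open>Absolute continuity is defined through families numbered by natural numbers, whereas a
  tagged division is a finite set of pairs; a bijection with an initial segment translates.\<close>

lemma ac_modulus_finiteD:
  fixes a b :: "'i \<Rightarrow> real"
  assumes \<rho>: "ac_modulus l u x \<eta> \<rho>" and "finite I"
    and I: "\<And>i. i \<in> I \<Longrightarrow> l \<le> a i \<and> a i \<le> b i \<and> b i \<le> u"
    and disj: "disjoint_family_on (\<lambda>i. {a i<..<b i}) I" and less: "(\<Sum>i\<in>I. b i - a i) < \<rho>"
  shows "(\<Sum>i\<in>I. norm (x (b i) - x (a i))) < \<eta>"
proof -
  obtain g where g: "bij_betw g {..<card I} I"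
    using ex_bij_betw_nat_finite[OF \<open>finite I\<close>] by (auto simp: atLeast0LessThan)
  then have gI: "g i \<in> I" if "i < card I" for i
    using that by (auto simp: bij_betw_def)
  have "(\<Sum>i<card I. norm (x (b (g i)) - x (a (g i)))) < \<eta>"
  proof (rule ac_modulusD[OF \<rho>])
    show "(\<Sum>i<card I. b (g i) - a (g i)) < \<rho>"
      using less sum.reindex_bij_betw[OF g, of "\<lambda>i. b i - a i"] by simp
    show "{a (g i)<..<b (g i)} \<inter> {a (g j)<..<b (g j)} = {}" if "i < card I" "j < card I" "i \<noteq> j" for i j
    proof -
      have "g i \<noteq> g j"
        using that bij_betw_imp_inj_on[OF g] by (auto simp: inj_on_def)
      then show ?thesis
        using disj gI[OF that(1)] gI[OF that(2)] unfolding disjoint_family_on_def by blast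
    qed
  qed (use I gI in auto)
  then show ?thesis
    using sum.reindex_bij_betw[OF g, of "\<lambda>i. norm (x (b i) - x (a i))"] by simp
qed

lemma null_set_outer_open:
  fixes N :: "real set"
  assumes "N \<in> null_sets lborel" and "\<rho> > 0"
  obtains U where "open U" "N \<subseteq> U" "emeasure lborel U < ennreal \<rho>"
proof -
  have "N \<in> sets borel" using assms(1) by auto
  then obtain U where U: "open U" "N \<subseteq> U" "emeasure lborel (U - N) < ennreal \<rho>"
    using outer_regular_lborel[OF _ \<open>\<rho> > 0\<close>] by blast
  have "emeasure lborel U = emeasure lborel (U - N)"
    using assms(1) U(1) by (intro emeasure_Diff_null_set[symmetric]) auto
  with U that show thesis by simp
qed

text \<open>On a tagged division that is fine enough, tags with derivative zero contribute little by the
  derivative, and the remaining tags contribute little by absolute continuity.\<close>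

lemma abs_continuous_zero_derivative:
  fixes h :: "real \<Rightarrow> 'a::real_normed_vector"
  assumes "a \<le> b" and ac: "abs_continuous_on a b h"
    and ae: "AE t in lborel. t \<in> {a..b} \<longrightarrow> (h has_vector_derivative 0) (at t)"
  shows "h b = h a"
proof -
  have bound: "norm (h b - h a) \<le> \<eta> * (b - a) + \<eta>" if "\<eta> > 0" for \<eta>
  proof -
    obtain \<rho> where "\<rho> > 0" and \<rho>: "ac_modulus a b h \<eta> \<rho>"
      using ac \<open>\<eta> > 0\<close> unfolding abs_continuous_on_iff_ac_modulus by blast
    obtain N where "\<And>t. t \<in> space lborel - N \<Longrightarrow> t \<in> {a..b} \<longrightarrow> (h has_vector_derivative 0) (at t)"
      and N: "N \<in> null_sets lborel"
      using AE_E3[OF ae] by blast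
    then have "\<forall>e>0. \<exists>r>0. \<forall>s. \<bar>s - t\<bar> < r \<longrightarrow> norm (h s - h t) \<le> e * \<bar>s - t\<bar>"
      if "t \<in> {a..b} - N" for t
      using that by (simp add: has_vector_derivative_def has_derivative_at_alt)
    then have "\<exists>r>0. \<forall>s. \<bar>s - t\<bar> < r \<longrightarrow> norm (h s - h t) \<le> \<eta> * \<bar>s - t\<bar>"
      if "t \<in> {a..b} - N" for t
      using that \<open>\<eta> > 0\<close> by simp
    then obtain r where r: "\<And>t. t \<in> {a..b} - N \<Longrightarrow> r t > 0"
      "\<And>t s. t \<in> {a..b} - N \<Longrightarrow> \<bar>s - t\<bar> < r t \<Longrightarrow> norm (h s - h t) \<le> \<eta> * \<bar>s - t\<bar>"
      by metis
    obtain U where U: "open U" "N \<subseteq> U" "emeasure lborel U < ennreal \<rho>"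
      using null_set_outer_open[OF N \<open>\<rho> > 0\<close>] .
    \<comment> \<open>Intervals tagged in the null set stay inside \<open>U\<close>, of measure
      below \<open>\<rho>\<close>. Those tagged elsewhere in \<open>{a..b}\<close> are so short that
      increments from the tag are at most \<open>\<eta>\<close> times the distance. The last case
      does not occur for a tag.\<close>
    define \<gamma> where "\<gamma> t = (if t \<in> N then U else if t \<in> {a..b} then ball t (r t) else UNIV)" for t
    have "gauge \<gamma>"
      using U r(1) by (auto simp: gauge_def \<gamma>_def)
    then obtain p where p: "p tagged_division_of {a..b}" "\<gamma> fine p"
      by (rule fine_division_exists_real)
    note pD = tagged_division_ofD[OF p(1)]
    have box: "snd z = {Inf (snd z)..Sup (snd z)}" "Inf (snd z) \<le> fst z" "fst z \<le> Sup (snd z)"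
      "a \<le> Inf (snd z)" "Sup (snd z) \<le> b" if zp: "z \<in> p" for z
    proof -
      obtain t K where z: "z = (t, K)" by fastforce
      then obtain c d where "K = {c..d}" using pD(4)[of t K] zp z by auto
      with pD(2)[of t K] pD(3)[of t K] zp z
      show "snd z = {Inf (snd z)..Sup (snd z)}" "Inf (snd z) \<le> fst z" "fst z \<le> Sup (snd z)"
        "a \<le> Inf (snd z)" "Sup (snd z) \<le> b" by auto
    qed
    have ord: "a \<le> Inf (snd z) \<and> Inf (snd z) \<le> Sup (snd z) \<and> Sup (snd z) \<le> b" if "z \<in> p" for z
      using box(2-5)[OF that] by auto
    have disj: "disjoint_family_on (\<lambda>z. {Inf (snd z)<..<Sup (snd z)}) p"
      unfolding disjoint_family_on_def
    proof (intro ballI impI)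
      fix z z' assume zz: "z \<in> p" "z' \<in> p" "z \<noteq> z'"
      then have "interior (snd z) \<inter> interior (snd z') = {}"
        using pD(5)[of "fst z" "snd z" "fst z'" "snd z'"] by simp
      then show "{Inf (snd z)<..<Sup (snd z)} \<inter> {Inf (snd z')<..<Sup (snd z')} = {}"
        by (subst (asm) box(1)[OF zz(1)], subst (asm) box(1)[OF zz(2)]) simp
    qed
    define B where "B = {z \<in> p. fst z \<in> N}"
    have "finite p" "finite B" "B \<subseteq> p" using pD(1) by (auto simp: B_def)
    have "(\<Sum>z\<in>B. norm (h (Sup (snd z)) - h (Inf (snd z)))) < \<eta>"
    proof (rule ac_modulus_finiteD[OF \<rho>])
      show "disjoint_family_on (\<lambda>z. {Inf (snd z)<..<Sup (snd z)}) B"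
        using disj \<open>B \<subseteq> p\<close> by (rule disjoint_family_on_mono[rotated])
      then have "emeasure lborel (\<Union>z\<in>B. {Inf (snd z)<..<Sup (snd z)})
          = (\<Sum>z\<in>B. emeasure lborel {Inf (snd z)<..<Sup (snd z)})"
        using \<open>finite B\<close> by (intro sum_emeasure[symmetric]) auto
      also have "\<dots> = (\<Sum>z\<in>B. ennreal (Sup (snd z) - Inf (snd z)))"
        using ord \<open>B \<subseteq> p\<close> by (intro sum.cong refl emeasure_lborel_Ioo) force
      also have "\<dots> = ennreal (\<Sum>z\<in>B. Sup (snd z) - Inf (snd z))"
        using ord \<open>B \<subseteq> p\<close> by (intro sum_ennreal) force
      finally have "ennreal (\<Sum>z\<in>B. Sup (snd z) - Inf (snd z))
          = emeasure lborel (\<Union>z\<in>B. {Inf (snd z)<..<Sup (snd z)})" ..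
      also have "\<dots> \<le> emeasure lborel U"
      proof (rule emeasure_mono)
        have "snd z \<subseteq> U" if "z \<in> B" for z
          using fineD[OF p(2), of "fst z" "snd z"] that by (auto simp: B_def \<gamma>_def)
        moreover have "{Inf (snd z)<..<Sup (snd z)} \<subseteq> snd z" if "z \<in> B" for z
        proof -
          have "z \<in> p" using that \<open>B \<subseteq> p\<close> by blast
          then have "{Inf (snd z)..Sup (snd z)} \<subseteq> snd z"
            by (rule equalityD2[OF box(1)])
          moreover have "{Inf (snd z)<..<Sup (snd z)} \<subseteq> {Inf (snd z)..Sup (snd z)}" by auto
          ultimately show ?thesis by (rule order_trans[rotated])
        qed
        ultimately show "(\<Union>z\<in>B. {Inf (snd z)<..<Sup (snd z)}) \<subseteq> U" by blast
      qed (use U in auto)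
      also have "\<dots> < ennreal \<rho>" by fact
      finally show "(\<Sum>z\<in>B. Sup (snd z) - Inf (snd z)) < \<rho>"
        by (rule ennreal_less_iff[THEN iffD1, rotated])
          (use ord \<open>B \<subseteq> p\<close> in \<open>force intro!: sum_nonneg\<close>)
    qed (use ord \<open>B \<subseteq> p\<close> \<open>finite B\<close> in force)+
    moreover have "(\<Sum>z\<in>p - B. norm (h (Sup (snd z)) - h (Inf (snd z)))) \<le> \<eta> * (b - a)"
    proof -
      have "(\<Sum>z\<in>p - B. norm (h (Sup (snd z)) - h (Inf (snd z)))) \<le> (\<Sum>z\<in>p - B. \<eta> * (Sup (snd z) - Inf (snd z)))"
      proof (rule sum_mono)
        fix z assume z: "z \<in> p - B"
        let ?t = "fst z" and ?c = "Inf (snd z)" and ?d = "Sup (snd z)"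
        have zp: "z \<in> p" and t: "?t \<in> {a..b} - N" using z box(2-5)[of z] by (auto simp: B_def)
        have "snd z \<subseteq> ball ?t (r ?t)"
          using fineD[OF p(2), of "fst z" "snd z"] t zp by (auto simp: \<gamma>_def)
        moreover have "{?c..?d} \<subseteq> snd z"
          by (rule equalityD2[OF box(1)[OF zp]])
        then have "?c \<in> snd z" "?d \<in> snd z"
          using ord[OF zp] by (simp_all only: subset_iff atLeastAtMost_iff) simp_all
        ultimately have "\<bar>?c - ?t\<bar> < r ?t" "\<bar>?d - ?t\<bar> < r ?t"
          by (auto simp: dist_real_def subset_iff abs_minus_commute)
        then have "norm (h ?c - h ?t) \<le> \<eta> * \<bar>?c - ?t\<bar>" "norm (h ?d - h ?t) \<le> \<eta> * \<bar>?d - ?t\<bar>"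
          using r(2)[OF t] by auto
        \<comment> \<open>The derivative controls increments from the tag only, so the increment
          over the interval is split there.\<close>
        moreover have "norm (h ?d - h ?c) \<le> norm (h ?d - h ?t) + norm (h ?c - h ?t)"
          by (metis dist_norm dist_triangle2)
        ultimately show "norm (h ?d - h ?c) \<le> \<eta> * (?d - ?c)"
          using box(2-5)[OF zp] by (simp add: algebra_simps)
      qed
      also have "\<dots> \<le> (\<Sum>z\<in>p. \<eta> * (Sup (snd z) - Inf (snd z)))"
        using ord \<open>\<eta> > 0\<close> \<open>finite p\<close> by (intro sum_mono2) force+
      also have "\<dots> = \<eta> * (b - a)"
        using additive_tagged_division_1[OF \<open>a \<le> b\<close> p(1), of "\<lambda>x. x"]
        by (simp add: sum_distrib_left[symmetric] case_prod_beta)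
      finally show ?thesis .
    qed
    moreover have "norm (h b - h a) \<le> (\<Sum>z\<in>p. norm (h (Sup (snd z)) - h (Inf (snd z))))"
      using additive_tagged_division_1[OF \<open>a \<le> b\<close> p(1), of h] norm_sum[of "\<lambda>z. h (Sup (snd z)) - h (Inf (snd z))" p]
      by (simp add: case_prod_beta)
    moreover have "(\<Sum>z\<in>p. norm (h (Sup (snd z)) - h (Inf (snd z))))
        = (\<Sum>z\<in>p - B. norm (h (Sup (snd z)) - h (Inf (snd z)))) + (\<Sum>z\<in>B. norm (h (Sup (snd z)) - h (Inf (snd z))))"
      using \<open>finite p\<close> \<open>B \<subseteq> p\<close> by (intro sum.subset_diff) auto
    ultimately show ?thesis by linarith
  qed
  have "norm (h b - h a) \<le> 0"
  proof (rule field_le_epsilon)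
    fix e :: real assume "e > 0"
    define c where "c = b - a + 1"
    have "c > 0" using \<open>a \<le> b\<close> by (simp add: c_def)
    have "e / c * (b - a) + e / c = e / c * c"
      unfolding c_def by (simp only: distrib_left mult_1_right)
    then show "norm (h b - h a) \<le> 0 + e"
      using bound[of "e / c"] \<open>c > 0\<close> \<open>e > 0\<close> by simp
  qed
  then show ?thesis by simp
qed

lemma has_vector_derivative_bounded_imp_lipschitz:
  fixes u :: "real \<Rightarrow> 'a::real_normed_vector"
  assumes deriv: "\<And>t. t \<in> {a..b} \<Longrightarrow> (u has_vector_derivative u' t) (at t within {a..b})"
    and cont: "continuous_on {a..b} u'"
  obtains M where "M-lipschitz_on {a..b} u"
proof -
  have "bounded (u' ` {a..b})"
    using cont by (intro compact_imp_bounded compact_continuous_image) auto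
  then obtain M where M: "M > 0" "\<And>t. t \<in> {a..b} \<Longrightarrow> norm (u' t) \<le> M"
    unfolding bounded_pos by auto
  have "M-lipschitz_on {a..b} u"
  proof (rule bounded_derivative_imp_lipschitz)
    show "(u has_derivative (\<lambda>h. h *\<^sub>R u' t)) (at t within {a..b})" if "t \<in> {a..b}" for t
      using deriv[OF that] by (simp add: has_vector_derivative_def)
    show "onorm (\<lambda>h. h *\<^sub>R u' t) \<le> M" if "t \<in> {a..b}" for t
      using M(2)[OF that] by (intro onorm_le) (simp add: mult.commute[of M] mult_left_mono)
  qed (use M in auto)
  then show thesis by (rule that)
qed

text \<open>Subtracting a primitive of \<open>g\<close> leaves an absolutely continuous function
  with derivative 0 almost everywhere, hence a constant. A Caratheodory solution is thereby a
  classical one wherever its right-hand side is continuous.\<close>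

lemma abs_continuous_continuous_derivative:
  fixes x :: "real \<Rightarrow> 'a::banach"
  assumes ac: "abs_continuous_on a b x"
    and ae: "AE t in lborel. t \<in> {a..b} \<longrightarrow> (x has_vector_derivative g t) (at t)"
    and cont: "continuous_on {a..b} g" and "t \<in> {a..b}"
  shows "(x has_vector_derivative g t) (at t within {a..b})"
proof -
  define G where "G = (\<lambda>t. integral {a..t} g)"
  have G: "(G has_vector_derivative g t) (at t within {a..b})" if "t \<in> {a..b}" for t
    unfolding G_def by (rule integral_has_vector_derivative[OF cont that])
  obtain M where "M-lipschitz_on {a..b} G"
    using has_vector_derivative_bounded_imp_lipschitz[OF G cont] .
  then have acd: "abs_continuous_on a b (\<lambda>t. x t - G t)"
    by (intro abs_continuous_on_diff ac lipschitz_imp_abs_continuous_on)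
  have eq: "x t = x a + G t" if t: "t \<in> {a..b}" for t
  proof -
    have "x t - G t = x a - G a"
    proof (rule abs_continuous_zero_derivative[where h="\<lambda>t. x t - G t"])
      show "abs_continuous_on a t (\<lambda>t. x t - G t)"
        using acd by (rule abs_continuous_on_subset) (use t in auto)
      \<comment> \<open>At the end points the primitive is known to have only a one-sided
        derivative; they are discarded as null sets.\<close>
      show "AE r in lborel. r \<in> {a..t} \<longrightarrow> ((\<lambda>t. x t - G t) has_vector_derivative 0) (at r)"
        using ae AE_lborel_singleton[of a] AE_lborel_singleton[of b]
      proof eventually_elim
        case (elim r)
        show ?case
        proof
          assume r: "r \<in> {a..t}"
          then have "(G has_vector_derivative g r) (at r)"
            using elim t G[of r] by (simp add: at_within_Icc_at)
          moreover have "(x has_vector_derivative g r) (at r)"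
            using elim t r by simp
          ultimately show "((\<lambda>t. x t - G t) has_vector_derivative 0) (at r)"
            using has_vector_derivative_diff by fastforce
        qed
      qed
    qed (use t in auto)
    then show ?thesis by (simp add: G_def algebra_simps)
  qed
  have *: "((\<lambda>t. x a + G t) has_vector_derivative g t) (at t within {a..b})"
    using has_vector_derivative_add[OF has_vector_derivative_const G[OF \<open>t \<in> {a..b}\<close>], of "x a"] by simp
  show ?thesis
    by (rule has_vector_derivative_transform[OF \<open>t \<in> {a..b}\<close> eq *])
qed

section \<open>Controllability and pole placement\<close>

abbreviation cmv :: "real^'n^'m \<Rightarrow> complex^'n \<Rightarrow> complex^'m" where
  "cmv A x \<equiv> map_matrix complex_of_real A *v x"

abbreviation cdot :: "real^'n \<Rightarrow> complex^'n \<Rightarrow> complex" where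
  "cdot r x \<equiv> scalar_product (cvec r) x"

lemma cdot_sum: "cdot r x = (\<Sum>i\<in>UNIV. of_real (r $ i) * x $ i)"
  by (simp add: scalar_product_def cvec_def)

lemma cmv_nth: "cmv A x $ i = (\<Sum>j\<in>UNIV. of_real (A $ i $ j) * x $ j)"
  by (simp add: matrix_vector_mult_def)

lemma cdot_add_right: "cdot r (x + y) = cdot r x + cdot r y"
  and cdot_scale_right: "cdot r (c *s x) = c * cdot r x"
  and cdot_diff_left: "cdot (r - r') x = cdot r x - cdot r' x"
  and cdot_scaleR_left: "cdot (a *\<^sub>R r) x = of_real a * cdot r x"
  by (simp_all add: cdot_sum algebra_simps sum.distrib sum_subtractf sum_distrib_left)

lemma cdot_cvec: "cdot r (cvec x) = of_real (r \<bullet> x)"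
  by (simp add: scalar_product_def inner_vec_def cvec_def)

lemma cdot_cmv: "cdot r (cmv A x) = cdot (transpose A *v r) x"
proof -
  have "cdot r (cmv A x) = (\<Sum>i\<in>UNIV. \<Sum>j\<in>UNIV. of_real (r $ i * A $ i $ j) * x $ j)"
    by (simp add: cdot_sum cmv_nth sum_distrib_left mult_ac)
  also have "\<dots> = (\<Sum>j\<in>UNIV. \<Sum>i\<in>UNIV. of_real (r $ i * A $ i $ j) * x $ j)"
    by (rule sum.swap)
  also have "\<dots> = cdot (transpose A *v r) x"
    by (simp add: cdot_sum matrix_vector_mult_def transpose_def sum_distrib_left sum_distrib_right mult_ac)
  finally show ?thesis .
qed

lemma Re_cdot: "Re (cdot r x) = r \<bullet> (\<chi> i. Re (x $ i))"
  and Im_cdot: "Im (cdot r x) = r \<bullet> (\<chi> i. Im (x $ i))"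
  by (simp_all add: cdot_sum inner_vec_def)

lemma inner_transpose_mult: "(transpose A *v r) \<bullet> x = r \<bullet> (A *v (x :: real^'n))"
  by (metis dot_lmul_matrix inner_commute transpose_matrix_vector vector_transpose_matrix)

lemma inner_transpose_funpow:
  fixes A :: "real^'n^'n"
  shows "((*v) (transpose A) ^^ i) r \<bullet> x = r \<bullet> ((*v) A ^^ i) x"
proof (induction i arbitrary: x)
  case (Suc i)
  show ?case
    using Suc[of "A *v x"] by (simp add: dot_lmul_matrix funpow_swap1)
qed simp

lemma funpow_mult_commute:
  fixes A :: "real^'n^'n"
  shows "((*v) A ^^ i) (A *v x) = A *v ((*v) A ^^ i) x"
  by (simp add: funpow_swap1)

lemma bij_betw_to_nat_on_UNIV:
  "bij_betw (to_nat_on (UNIV :: 'n::finite set)) UNIV {..<CARD('n)}"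
  by (rule to_nat_on_finite) simp

context
  fixes P :: "real^'n^'n" and b :: "real^'n"
  assumes ctrl: "controllable P b"
begin

private lemma invertible_ctrl: "invertible (controllability_matrix P b)"
  using ctrl by (simp add: controllable_def invertible_det_nz)

lemma controllable_orthogonal:
  assumes "\<And>i. i < CARD('n) \<Longrightarrow> u \<bullet> ((*v) P ^^ i) b = 0"
  shows "u = 0"
proof -
  let ?C = "controllability_matrix P b"
  have "transpose ?C *v u = 0"
    using assms bij_betw_to_nat_on_UNIV[where 'n='n]
    by (auto simp: vec_eq_iff matrix_vector_mult_def transpose_def controllability_matrix_def
        inner_vec_def bij_betw_def mult.commute)
  moreover have "invertible (transpose ?C)"
    using invertible_ctrl by (simp add: transpose_invertible)
  ultimately show ?thesis
    by (metis invertible_def matrix_left_invertible_ker)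
qed

text \<open>Functionals with prescribed values on the controllability basis. The one that picks the
  last coordinate is the seed of Ackermann's formula.\<close>

lemma controllable_dual:
  obtains q where "\<And>i. i < CARD('n) \<Longrightarrow> q \<bullet> ((*v) P ^^ i) b = g i"
proof -
  let ?C = "controllability_matrix P b"
  have "invertible (transpose ?C)"
    using invertible_ctrl by (simp add: transpose_invertible)
  then have "surj ((*v) (transpose ?C))"
    by (metis invertible_def matrix_right_invertible_surjective)
  then obtain q where q: "transpose ?C *v q = (\<chi> j. g (to_nat_on UNIV j))"
    by (metis surjD)
  have eq: "q \<bullet> ((*v) P ^^ to_nat_on UNIV j) b = g (to_nat_on UNIV j)" for j :: 'n
    using arg_cong[OF q, of "\<lambda>v. v $ j"]
    by (simp add: matrix_vector_mult_def transpose_def controllability_matrix_def inner_vec_def mult.commute)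
  show thesis
  proof
    fix i assume "i < CARD('n)"
    then obtain j :: 'n where "to_nat_on UNIV j = i"
      using bij_betw_to_nat_on_UNIV[where 'n='n] unfolding bij_betw_def by (metis imageE lessThan_iff)
    then show "q \<bullet> ((*v) P ^^ i) b = g i" using eq by blast
  qed
qed

lemma controllable_expand:
  obtains a where "u = (\<Sum>i<CARD('n). a i *\<^sub>R ((*v) P ^^ i) b)"
proof -
  let ?C = "controllability_matrix P b"
  have "surj ((*v) ?C)"
    using invertible_ctrl by (metis invertible_def matrix_right_invertible_surjective)
  then obtain v where v: "u = ?C *v v" by (metis surjD)
  define a where "a i = v $ (inv_into UNIV (to_nat_on (UNIV :: 'n set)) i)" for i
  have av: "a (to_nat_on UNIV j) = v $ j" for j
    using bij_betw_to_nat_on_UNIV[where 'n='n] by (simp add: a_def bij_betw_def)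
  have "u = (\<Sum>j\<in>UNIV. v $ j *\<^sub>R ((*v) P ^^ to_nat_on (UNIV :: 'n set) j) b)"
    unfolding v by (simp add: vec_eq_iff matrix_vector_mult_def controllability_matrix_def mult.commute)
  also have "\<dots> = (\<Sum>j\<in>UNIV. a (to_nat_on UNIV j) *\<^sub>R ((*v) P ^^ to_nat_on (UNIV :: 'n set) j) b)"
    by (simp add: av)
  also have "\<dots> = (\<Sum>i<CARD('n). a i *\<^sub>R ((*v) P ^^ i) b)"
    by (rule sum.reindex_bij_betw[OF bij_betw_to_nat_on_UNIV])
  finally show thesis by (rule that)
qed

end

text \<open>With \<open>S e_k = b\<close>, conjugation by \<open>S\<close> turns
  \<open>I + b L^T\<close> into \<open>I + e_k y^T\<close> for \<open>y = S^T L\<close>. The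
  transpose of the latter and \<open>S\<close> itself differ from the identity in column
  \<open>k\<close> only, so the Cramer lemma evaluates both determinants.\<close>

lemma det_one_plus_rank_one:
  fixes b L :: "real^'n"
  shows "det (\<chi> i j. (if i = j then 1 else 0) + b $ i * L $ j) = 1 + L \<bullet> b"
proof (cases "b = 0")
  case True
  then show ?thesis
    using det_I[where 'a=real and 'n='n] by (simp add: mat_def)
next
  case False
  then obtain k where k: "b $ k \<noteq> 0" by (auto simp: vec_eq_iff)
  define R where "R = (\<chi> i j. (if i = j then 1 else 0) + b $ i * L $ j)"
  define S where "S = (\<chi> i j. if j = k then (mat 1 *v b) $ i else (mat 1 :: real^'n^'n) $ i $ j)"
  define x where "x = axis k 1 + transpose S *v L"
  define E where "E = (\<chi> i j. if j = k then (mat 1 *v x) $ i else (mat 1 :: real^'n^'n) $ i $ j)"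
  have dS: "det S = b $ k" and dE: "det E = x $ k"
    unfolding S_def E_def by (simp_all only: cramer_lemma det_I mult_1_right)
  define y where "y = transpose S *v L"
  have S: "S $ i $ j = (if j = k then b $ i else if i = j then 1 else 0)" for i j
    unfolding S_def matrix_vector_mul_lid by (simp add: mat_def)
  have y: "y $ j = (\<Sum>l\<in>UNIV. L $ l * S $ l $ j)" for j
    by (simp add: y_def matrix_vector_mult_def transpose_def mult.commute)
  have xk: "x $ k = 1 + L \<bullet> b"
    unfolding x_def y_def[symmetric] by (simp add: y S inner_vec_def axis_def)
  have E: "E $ j $ l = (if j = l then 1 else 0) + (if l = k then y $ j else 0)" for j l
    unfolding E_def x_def y_def[symmetric] matrix_vector_mul_lid by (simp add: mat_def axis_def)
  have "R ** S = S ** transpose E"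
  proof -
    have "(R ** S) $ i $ j = S $ i $ j + b $ i * y $ j" for i j
      unfolding y by (simp add: R_def matrix_matrix_mult_def distrib_left distrib_right sum.distrib sum_distrib_left mult_ac
          if_distrib[of "\<lambda>x. x * c" for c] if_distrib[of "(*) c" for c] cong: if_cong)
    moreover have "(S ** transpose E) $ i $ j = S $ i $ j + b $ i * y $ j" for i j
      by (simp add: matrix_matrix_mult_def transpose_def E distrib_left sum.distrib if_distrib[of "(*) c" for c] cong: if_cong) (simp add: S)
    ultimately show ?thesis by (simp add: vec_eq_iff)
  qed
  then have "det R * det S = det S * det E"
    by (metis det_mul det_transpose)
  then show ?thesis
    using k dS dE xk by (simp add: R_def)
qed

lemma continuous_on_det [continuous_intros]:
  fixes A :: "'a::topological_space \<Rightarrow> real^'n^'n"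
  assumes "continuous_on S A"
  shows "continuous_on S (\<lambda>t. det (A t))"
  unfolding det_def by (intro continuous_intros assms)

text \<open>Needed twice: along the fundamental matrix, from the identity to the monodromy matrix,
  and along the segment from the identity to the closed loop.\<close>

lemma det_pos_path:
  fixes A :: "real \<Rightarrow> real^'n^'n"
  assumes "a \<le> b" "continuous_on {a..b} A" and nz: "\<And>t. t \<in> {a..b} \<Longrightarrow> det (A t) \<noteq> 0"
    and "det (A a) > 0"
  shows "det (A b) > 0"
proof (rule ccontr)
  assume "\<not> det (A b) > 0"
  then obtain t where "a \<le> t" "t \<le> b" "det (A t) = 0"
    using IVT2'[of "\<lambda>t. det (A t)" b 0 a] assms by (force intro: continuous_on_det)
  with nz show False by auto
qed

lemma det_zero_imp_kernel:
  fixes A :: "real^'n^'n"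
  assumes "det A = 0"
  obtains v where "v \<noteq> 0" "A *v v = 0"
  using assms invertible_det_nz[of A] invertible_def[of A]
  by (metis matrix_left_invertible_ker matrix_left_right_inverse)

text \<open>For even positive \<open>n\<close> the value is -1/2 and
  \<open>s ^ n = pole_target n\<close> has no real root; for odd \<open>n\<close> it is 1/2 and the
  only real root is positive. All complex roots have modulus below 1.\<close>

definition pole_target :: "nat \<Rightarrow> real" where
  "pole_target n = - ((- 1) ^ n) / 2"

lemma power_eq_pole_target_pos:
  fixes s :: real
  assumes "s ^ n = pole_target n" shows "s > 0"
proof (rule ccontr)
  assume "\<not> s > 0"
  then have "s \<le> 0" by simp
  show False
  proof (cases "even n")
    case True
    then show False
      using assms zero_le_even_power[OF True, of s] by (simp add: pole_target_def)
  next
    case False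
    then have "s ^ n \<le> 0" using \<open>s \<le> 0\<close> by (simp add: power_le_zero_eq odd_pos)
    then show False using assms False by (simp add: pole_target_def)
  qed
qed

lemma power_eq_pole_target_norm:
  fixes z :: complex
  assumes "z ^ n = of_real (pole_target n)" "n > 0" shows "cmod z < 1"
proof (rule ccontr)
  assume "\<not> cmod z < 1"
  then have "cmod (z ^ n) \<ge> 1" by (simp add: norm_power)
  moreover have "cmod (of_real (pole_target n)) = 1 / 2"
    by (simp add: pole_target_def norm_power power_abs)
  ultimately show False using assms by simp
qed

text \<open>Ackermann's formula: the row vector \<open>q\<close> that is dual to the controllability basis becomes cyclic
  for the closed loop, which annihilates \<open>s\<^sup>n - pole_target n\<close> on it.  The sign of the target makes
  the real eigenvalues of the closed loop positive.\<close>

lemma ackermann: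
  fixes P :: "real^'n^'n" and b :: "real^'n"
  assumes ctrl: "controllable P b" and inv: "invertible P"
  obtains L where "\<And>\<mu> v. v \<noteq> 0 \<Longrightarrow> cmv P (v + cdot L v *s cvec b) = \<mu> *s v
      \<Longrightarrow> \<mu> ^ CARD('n) = of_real (pole_target CARD('n))"
proof -
  let ?n = "CARD('n)"
  let ?\<sigma> = "pole_target ?n"
  have n_pos: "?n > 0" by simp
  obtain q0 where q0: "\<And>i. i < ?n \<Longrightarrow> q0 \<bullet> ((*v) P ^^ i) b = (if i = ?n - 1 then 1 else 0)"
    using controllable_dual[OF ctrl, of "\<lambda>i. if i = ?n - 1 then 1 else 0"] by auto
  \<comment> \<open>The gain acts before \<open>P\<close>, so the effective input vector of the
    closed loop is \<open>P b\<close>. Pulling \<open>q0\<close> back through \<open>P\<close> makes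
    \<open>q\<close> dual to the correspondingly shifted basis.\<close>
  have "surj ((*v) (transpose P))"
    using transpose_invertible[OF inv] by (metis invertible_def matrix_right_invertible_surjective)
  then obtain q where "transpose P *v q = q0" by (metis surjD)
  then have q: "q \<bullet> ((*v) P ^^ i) (P *v b) = (if i = ?n - 1 then 1 else 0)" if "i < ?n" for i
    using q0[OF that] by (metis funpow_mult_commute inner_transpose_mult)
  define r where "r i = ((*v) (transpose P) ^^ i) q" for i
  have r_0: "r 0 = q" and r_Suc: "transpose P *v r i = r (Suc i)" for i
    by (simp_all add: r_def)
  have rb: "r (Suc i) \<bullet> b = (if i = ?n - 1 then 1 else 0)" if "i < ?n" for i
    unfolding r_def inner_transpose_funpow using q[OF that] by (simp add: funpow_swap1)
  \<comment> \<open>In the basis \<open>P^i (P b)\<close> the values \<open>r i \<bullet> u\<close>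
    form a triangular system for the coefficients: if \<open>l\<close> is the largest index with
    \<open>a l\<close> nonzero, then testing with \<open>r (n - 1 - l)\<close> isolates
    \<open>a l\<close>.\<close>
  have observable: "u = 0" if u: "\<And>i. i < ?n \<Longrightarrow> r i \<bullet> u = 0" for u
  proof -
    obtain u' where u': "u = P *v u'"
      using inv by (metis invertible_def matrix_right_invertible_surjective surjD)
    obtain a where a: "u' = (\<Sum>i<?n. a i *\<^sub>R ((*v) P ^^ i) b)"
      using controllable_expand[OF ctrl] by blast
    have u_eq: "u = (\<Sum>j<?n. a j *\<^sub>R ((*v) P ^^ j) (P *v b))"
      unfolding u' a by (simp add: funpow_mult_commute
          matrix_vector_mult_scaleR linear_sum[OF matrix_vector_mul_linear])
    have ri: "r i \<bullet> u = (\<Sum>j<?n. a j * (q \<bullet> ((*v) P ^^ (i + j)) (P *v b)))" for i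
      unfolding u_eq r_def
      by (simp add: inner_sum_right inner_transpose_funpow funpow_add)
    have "a j = 0" if "j < ?n" for j
    proof (rule ccontr)
      assume "a j \<noteq> 0"
      define J where "J = {j. j < ?n \<and> a j \<noteq> 0}"
      have "finite J" "j \<in> J" using \<open>a j \<noteq> 0\<close> that by (auto simp: J_def)
      then have l: "Max J \<in> J" "\<And>i. i \<in> J \<Longrightarrow> i \<le> Max J"
        using Max_in by auto
      define l where "l = Max J"
      have "0 = r (?n - 1 - l) \<bullet> u" using u by simp
      also have "\<dots> = (\<Sum>j<?n. if j = l then a l else 0)"
        unfolding ri
      proof (rule sum.cong[OF refl])
        fix j assume j: "j \<in> {..<?n}"
        have "l < ?n" using l(1) by (simp add: l_def J_def)
        consider "j > l" | "j \<le> l" by linarith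
        then show "a j * (q \<bullet> ((*v) P ^^ (?n - 1 - l + j)) (P *v b)) = (if j = l then a l else 0)"
        proof cases
          case 1
          then have "j \<notin> J" using l(2)[of j] by (auto simp: l_def)
          then show ?thesis using j 1 by (simp add: J_def)
        next
          case 2
          then have "?n - 1 - l + j < ?n" "?n - 1 - l + j = ?n - 1 \<longleftrightarrow> j = l"
            using \<open>l < ?n\<close> by linarith+
          then show ?thesis using q by simp
        qed
      qed
      also have "\<dots> = a l" using l(1) by (simp add: l_def J_def)
      finally show False using l(1) by (simp add: l_def J_def)
    qed
    then show ?thesis by (simp add: u_eq)
  qed
  \<comment> \<open>With \<open>M = P (I + b L^T)\<close> the rows satisfy
    \<open>r i M = r (i + 1)\<close> for \<open>i < n - 1\<close> and
    \<open>r (n - 1) M = r n + L\<close>. This \<open>L\<close> closes the chain to a multiple of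
    \<open>q\<close>.\<close>
  define L where "L = ?\<sigma> *\<^sub>R q - r ?n"
  show thesis
  proof
    fix \<mu> and v :: "complex^'n"
    assume "v \<noteq> 0" and eig: "cmv P (v + cdot L v *s cvec b) = \<mu> *s v"
    have step: "\<mu> * cdot (r i) v = cdot (r (Suc i)) v + cdot L v * (if i = ?n - 1 then 1 else 0)" if "i < ?n" for i
    proof -
      have "\<mu> * cdot (r i) v = cdot (r i) (cmv P (v + cdot L v *s cvec b))"
        by (simp add: eig cdot_scale_right)
      also have "\<dots> = cdot (r (Suc i)) v + cdot L v * of_real (r (Suc i) \<bullet> b)"
        unfolding cdot_cmv r_Suc by (simp add: cdot_add_right cdot_scale_right cdot_cvec)
      finally show ?thesis using rb[OF that] by simp
    qed
    have pow: "cdot (r i) v = \<mu> ^ i * cdot q v" if "i < ?n" for i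
      using that
    proof (induction i)
      case (Suc i)
      then have "i \<noteq> ?n - 1" "i < ?n" by simp_all
      then show ?case using step[of i] Suc by (simp add: mult.assoc)
    qed (simp add: r_0)
    \<comment> \<open>Otherwise the whole chain vanishes on \<open>v\<close>. Observability is a
      statement on real vectors and is applied to the real and imaginary parts separately.\<close>
    have "cdot q v \<noteq> 0"
    proof
      assume "cdot q v = 0"
      then have "cdot (r i) v = 0" if "i < ?n" for i using pow[OF that] by simp
      then have "(\<chi> i. Re (v $ i)) = 0" "(\<chi> i. Im (v $ i)) = 0"
        by (auto intro!: observable simp: Re_cdot[symmetric] Im_cdot[symmetric])
      then have "v = 0" by (simp add: vec_eq_iff complex_eq_iff)
      with \<open>v \<noteq> 0\<close> show False ..
    qed
    moreover have "\<mu> * (\<mu> ^ (?n - 1) * cdot q v) = of_real ?\<sigma> * cdot q v"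
      using step[of "?n - 1"] pow[of "?n - 1"] n_pos
      by (simp add: L_def cdot_diff_left cdot_scaleR_left)
    ultimately show "\<mu> ^ ?n = of_real ?\<sigma>"
      using power_eq_if[of \<mu> ?n] by simp
  qed
qed

section \<open>Gains realised by a pulse\<close>

text \<open>This is the integral of \<open>exp (- z s)\<close> over \<open>s\<close> from 0 to 1,
  with the removable singularity filled in. It enters through
  \<open>exp (- b K^T) = I - expm1_quot (K \<bullet> b) b K^T\<close>.\<close>

definition expm1_quot :: "complex \<Rightarrow> complex" where
  "expm1_quot z = (if z = 0 then 1 else (1 - exp (- z)) / z)"

text \<open>The condition is that \<open>P exp (- b K^T)\<close> has spectral radius below 1, with
  the exponential of the rank-one matrix written out.\<close>

definition stabilising_gain :: "real^'n^'n \<Rightarrow> real^'n \<Rightarrow> real^'n \<Rightarrow> bool" where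
  "stabilising_gain P b K \<longleftrightarrow> (\<forall>\<mu> v. v \<noteq> 0 \<longrightarrow>
      cmv P (v - (expm1_quot (of_real (K \<bullet> b)) * cdot K v) *s cvec b) = \<mu> *s v \<longrightarrow> cmod \<mu> < 1)"

lemma stabilising_gainD:
  assumes "stabilising_gain P b K" "v \<noteq> 0"
    "cmv P (v - (expm1_quot (of_real (K \<bullet> b)) * cdot K v) *s cvec b) = \<mu> *s v"
  shows "cmod \<mu> < 1"
  using assms unfolding stabilising_gain_def by blast

text \<open>A feedback gain \<open>K\<close> acting through a short pulse yields the rank-one factor
  \<open>exp (- b K\<^sup>T) = I + b L\<^sup>T\<close>, which is possible only for \<open>1 + L \<bullet> b > 0\<close>.\<close>

lemma stabilising_gain_exists:
  fixes P :: "real^'n^'n" and b :: "real^'n"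
  assumes ctrl: "controllable P b" and det_pos: "det P > 0"
  obtains K where "stabilising_gain P b K"
proof -
  have inv: "invertible P" using det_pos by (simp add: invertible_det_nz)
  obtain L where L: "\<And>\<mu> v. v \<noteq> 0 \<Longrightarrow> cmv P (v + cdot L v *s cvec b) = \<mu> *s v
      \<Longrightarrow> \<mu> ^ CARD('n) = of_real (pole_target CARD('n))"
    using ackermann[OF ctrl inv] by blast
  define R where "R = (\<chi> i j. (if i = j then 1 else 0) + b $ i * L $ j)"
  define M where "M = P ** R"
  have Rv: "R *v v = v + (L \<bullet> v) *\<^sub>R b" for v
    by (simp add: R_def vec_eq_iff matrix_vector_mult_def inner_vec_def distrib_left distrib_right sum.distrib
        sum_distrib_left mult_ac if_distrib[of "\<lambda>x. x * c" for c] if_distrib[of "(*) c" for c] cong: if_cong)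
  have real_eig: "s > 0" if "v \<noteq> 0" "M *v v = s *\<^sub>R v" for s v
  proof -
    have cmv_cvec: "cmv P (cvec x) = cvec (P *v x)" for x
      by (simp add: vec_eq_iff cmv_nth cvec_def matrix_vector_mult_def)
    have "cvec v + cdot L (cvec v) *s cvec b = cvec (R *v v)"
      unfolding Rv cdot_cvec by (simp add: vec_eq_iff cvec_def)
    then have "cmv P (cvec v + cdot L (cvec v) *s cvec b) = cvec (M *v v)"
      by (simp add: cmv_cvec M_def matrix_vector_mul_assoc)
    also have "\<dots> = of_real s *s cvec v"
      by (simp add: that vec_eq_iff cvec_def)
    finally have "of_real s ^ CARD('n) = (of_real (pole_target CARD('n)) :: complex)"
      using \<open>v \<noteq> 0\<close> by (intro L[of "cvec v"]) (auto simp: vec_eq_iff cvec_def)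
    then have "s ^ CARD('n) = pole_target CARD('n)"
      by (metis of_real_eq_iff of_real_power)
    then show ?thesis by (rule power_eq_pole_target_pos)
  qed
  have "det M > 0"
  proof -
    \<comment> \<open>A singular matrix on this segment would give \<open>M\<close> the real
      eigenvalue \<open>- (1 - s) / s\<close>, which is not positive. So the determinant keeps the
      sign it has at the identity.\<close>
    define A where "A s = (1 - s) *\<^sub>R mat 1 + s *\<^sub>R M" for s
    have "det (A 1) > 0"
    proof (rule det_pos_path)
      show "continuous_on {0..1} A"
        unfolding A_def by (intro continuous_intros)
      show "det (A s) \<noteq> 0" if s: "s \<in> {0..1}" for s
      proof
        assume "det (A s) = 0"
        then obtain v where v: "v \<noteq> 0" "A s *v v = 0" using det_zero_imp_kernel by blast
        have "A s *v v = (1 - s) *\<^sub>R v + s *\<^sub>R (M *v v)"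
          by (simp add: A_def matrix_vector_mult_add_rdistrib scaleR_matrix_vector_assoc[symmetric])
        with v have eq: "s *\<^sub>R (M *v v) = - ((1 - s) *\<^sub>R v)"
          by (metis add.commute eq_neg_iff_add_eq_0)
        then have "s \<noteq> 0" using v(1) by auto
        have "M *v v = (1 / s) *\<^sub>R (s *\<^sub>R (M *v v))" using \<open>s \<noteq> 0\<close> by simp
        also have "\<dots> = (- ((1 - s) / s)) *\<^sub>R v" unfolding eq by simp
        finally have "- ((1 - s) / s) > 0" by (rule real_eig[OF v(1)])
        then show False using s \<open>s \<noteq> 0\<close> by (simp add: zero_less_divide_iff divide_less_0_iff)
      qed
      show "det (A 0) > 0" by (simp add: A_def)
    qed simp
    then show ?thesis by (simp add: A_def)
  qed
  then have "det R > 0"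
    using det_pos by (simp add: M_def det_mul zero_less_mult_iff)
  then have pos: "1 + L \<bullet> b > 0"
    unfolding R_def det_one_plus_rank_one .
  \<comment> \<open>The number \<open>k\<close> is fixed by
    \<open>exp (- k) = 1 + L \<bullet> b\<close>, and \<open>\<theta>\<close> is the real form of
    \<open>expm1_quot k\<close>. Then \<open>K \<bullet> b = k\<close>, and the scaling by
    \<open>- 1 / \<theta>\<close> makes \<open>exp (- b K^T)\<close> equal to
    \<open>I + b L^T\<close>.\<close>
  define k where "k = - ln (1 + L \<bullet> b)"
  define \<theta> where "\<theta> = (if k = 0 then 1 else (1 - exp (- k)) / k)"
  define K where "K = (- 1 / \<theta>) *\<^sub>R L"
  have ek: "1 - exp (- k) = - (L \<bullet> b)" using pos by (simp add: k_def)
  have "\<theta> \<noteq> 0" by (simp add: \<theta>_def)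
  have Kb: "K \<bullet> b = k"
  proof -
    have "- (L \<bullet> b) = \<theta> * k" unfolding ek[symmetric] by (simp add: \<theta>_def)
    moreover have "K \<bullet> b = - (L \<bullet> b) / \<theta>" by (simp add: K_def)
    ultimately show ?thesis using \<open>\<theta> \<noteq> 0\<close> by simp
  qed
  have q: "expm1_quot (of_real k) = of_real \<theta>"
    by (simp add: expm1_quot_def \<theta>_def flip: exp_of_real of_real_minus)
  have "stabilising_gain P b K"
    unfolding stabilising_gain_def
  proof (intro allI impI)
    fix \<mu> and v :: "complex^'n"
    assume "v \<noteq> 0" and "cmv P (v - (expm1_quot (of_real (K \<bullet> b)) * cdot K v) *s cvec b) = \<mu> *s v"
    moreover have "expm1_quot (of_real (K \<bullet> b)) * cdot K v = - cdot L v"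
    proof -
      have "cdot K v = of_real (- 1 / \<theta>) * cdot L v"
        unfolding K_def by (rule cdot_scaleR_left)
      then show ?thesis unfolding Kb q using \<open>\<theta> \<noteq> 0\<close> by simp
    qed
    ultimately have "\<mu> ^ CARD('n) = of_real (pole_target CARD('n))"
      by (intro L[of v]) (simp_all add: vec_eq_iff)
    then show "cmod \<mu> < 1" by (rule power_eq_pole_target_norm) simp
  qed
  then show thesis by (rule that)
qed

lemma left_eigenvector:
  fixes P :: "real^'n^'n"
  assumes "P *v y = y" "y \<noteq> 0"
  obtains w where "w \<noteq> 0" "transpose P *v w = w"
proof -
  have "(P - mat 1) *v y = 0"
    using assms by (simp add: matrix_vector_mult_diff_rdistrib)
  then have "\<not> invertible (P - mat 1)"
    using assms(2) by (metis invertible_def matrix_left_invertible_ker)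
  then have "det (transpose (P - mat 1)) = 0"
    by (simp add: invertible_det_nz)
  then obtain w where "w \<noteq> 0" "transpose (P - mat 1) *v w = 0"
    using det_zero_imp_kernel by blast
  moreover have "transpose (P - mat 1) = transpose P - mat 1"
    by (simp add: transpose_def mat_def vec_eq_iff)
  ultimately show thesis
    using that by (simp add: matrix_vector_mult_diff_rdistrib)
qed

text \<open>Hautus test at the eigenvalue 1: a left eigenvector orthogonal to \<open>b\<close> is
  orthogonal to every \<open>P^i b\<close>, which controllability forbids.\<close>

lemma controllable_left_eigenvector:
  fixes P :: "real^'n^'n"
  assumes "controllable P b" "transpose P *v w = w" "w \<noteq> 0"
  shows "w \<bullet> b \<noteq> 0"
proof
  assume "w \<bullet> b = 0"
  have "((*v) (transpose P) ^^ i) w = w" for i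
    by (induction i) (use assms(2) in auto)
  then have "w \<bullet> ((*v) P ^^ i) b = 0" for i
    using \<open>w \<bullet> b = 0\<close> inner_transpose_funpow[of i P w b] by simp
  then show False using controllable_orthogonal[OF assms(1)] assms(3) by blast
qed

section \<open>The linearised system\<close>

lemma
  assumes "smooth f"
  shows smooth_has_derivative: "(f has_derivative frechet_derivative f (at x)) (at x)"
    and continuous_on_frechet_derivative: "continuous_on UNIV (\<lambda>x. frechet_derivative f (at x) v)"
  using assms[unfolded smooth_def, THEN spec[of _ "Suc 0"]] by (auto simp: frechet_derivative_works)

context
  fixes f :: "(real^'n) \<times> real \<Rightarrow> real^'n" and xs :: "real \<Rightarrow> real^'n"
  assumes smooth: "smooth f"
begin

lemma orbit_A_mult: "orbit_A f xs t *v h = frechet_derivative f (at (xs t, 0)) (h, 0)"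
proof -
  have "((\<lambda>x. f (x, 0)) has_derivative (\<lambda>h. frechet_derivative f (at (xs t, 0)) (h, 0))) (at (xs t))"
    by (rule has_derivative_compose[of "\<lambda>x. (x, 0)", OF _ smooth_has_derivative[OF smooth]])
      (auto intro!: derivative_eq_intros)
  then have fd: "frechet_derivative (\<lambda>x. f (x, 0)) (at (xs t)) = (\<lambda>h. frechet_derivative f (at (xs t, 0)) (h, 0))"
    and lin: "linear (\<lambda>h. frechet_derivative f (at (xs t, 0)) (h, 0))"
    by (auto simp: frechet_derivative_at[symmetric] has_derivative_linear)
  show ?thesis
    unfolding orbit_A_def jacobian_def fd by (rule matrix_vector_mul(2)[OF lin, THEN fun_cong])
qed

lemma orbit_b_eq: "orbit_b f xs t = frechet_derivative f (at (xs t, 0)) (0, 1)"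
proof -
  have "((\<lambda>u. f (xs t, u)) has_derivative (\<lambda>h. frechet_derivative f (at (xs t, 0)) (0, h))) (at 0)"
    by (rule has_derivative_compose[of "\<lambda>u. (xs t, u)", OF _ smooth_has_derivative[OF smooth]])
      (auto intro!: derivative_eq_intros)
  moreover have "(\<lambda>h. frechet_derivative f (at (xs t, 0)) (0, h)) = (\<lambda>h. h *\<^sub>R frechet_derivative f (at (xs t, 0)) (0, 1))"
  proof
    fix h :: real
    have "linear (frechet_derivative f (at (xs t, 0)))"
      using smooth_has_derivative[OF smooth] by (rule has_derivative_linear)
    from linear_cmul[OF this, of h "(0, 1)"]
    show "frechet_derivative f (at (xs t, 0)) (0, h) = h *\<^sub>R frechet_derivative f (at (xs t, 0)) (0, 1)" by simp
  qed
  ultimately have "((\<lambda>u. f (xs t, u)) has_vector_derivative frechet_derivative f (at (xs t, 0)) (0, 1)) (at 0)"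
    unfolding has_vector_derivative_def by metis
  then show ?thesis unfolding orbit_b_def by (rule vector_derivative_at)
qed

context
  assumes cont: "continuous_on UNIV xs"
begin

lemma continuous_on_frechet_orbit: "continuous_on S (\<lambda>t. frechet_derivative f (at (xs t, 0)) v)"
  by (rule continuous_on_compose2[OF continuous_on_frechet_derivative[OF smooth]])
    (auto intro!: continuous_intros continuous_on_subset[OF cont])

lemma continuous_on_orbit_A: "continuous_on S (orbit_A f xs)"
proof -
  have "orbit_A f xs t = (\<chi> i j. frechet_derivative f (at (xs t, 0)) (axis j 1, 0) $ i)" for t
    by (simp add: vec_eq_iff matrix_vector_mul_component orbit_A_mult[symmetric] cart_eq_inner_axis[symmetric] flip: matrix_vector_mult_basis column_def)
  then have "orbit_A f xs = (\<lambda>t. \<chi> i j. frechet_derivative f (at (xs t, 0)) (axis j 1, 0) $ i)" by blast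
  then show ?thesis
    by (simp add: continuous_on_vec_lambda continuous_intros continuous_on_frechet_orbit)
qed

lemma continuous_on_orbit_b: "continuous_on S (orbit_b f xs)"
  unfolding orbit_b_eq[abs_def] by (rule continuous_on_frechet_orbit)

end

text \<open>Differentiating the orbit equation by the chain rule shows that the velocity solves the
  variational equation; this is the origin of the multiplier 1.\<close>

lemma orbit_velocity_derivative:
  assumes "\<And>t. (xs has_vector_derivative f (xs t, 0)) (at t)"
  shows "((\<lambda>t. f (xs t, 0)) has_vector_derivative orbit_A f xs t *v f (xs t, 0)) (at t)"
proof -
  have "((\<lambda>t. (xs t, 0)) has_derivative (\<lambda>h. (h *\<^sub>R f (xs t, 0), 0))) (at t)"
    using assms[of t] by (auto simp: has_vector_derivative_def intro!: derivative_eq_intros)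
  from has_derivative_compose[OF this smooth_has_derivative[OF smooth]]
  have "((\<lambda>t. f (xs t, 0)) has_derivative (\<lambda>h. orbit_A f xs t *v (h *\<^sub>R f (xs t, 0)))) (at t)"
    by (simp add: orbit_A_mult)
  then show ?thesis
    by (simp add: has_vector_derivative_def matrix_vector_mult_scaleR)
qed

end

text \<open>As real-bilinear maps between finite-dimensional spaces the mixed real-complex products
  are bounded, which supplies their product rule, their continuity and uniform estimates.\<close>

lemma bounded_bilinear_cmv: "bounded_bilinear (cmv :: real^'n^'m \<Rightarrow> complex^'n \<Rightarrow> complex^'m)"
  unfolding bilinear_conv_bounded_bilinear[symmetric] bilinear_def linear_iff
  by (simp add: vec_eq_iff cmv_nth algebra_simps sum.distrib scaleR_sum_right scaleR_conv_of_real[where 'a=complex] sum_distrib_left)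

lemma bounded_bilinear_cdot: "bounded_bilinear (cdot :: real^'n \<Rightarrow> complex^'n \<Rightarrow> complex)"
  unfolding bilinear_conv_bounded_bilinear[symmetric] bilinear_def linear_iff
  by (simp add: cdot_sum algebra_simps sum.distrib scaleR_sum_right scaleR_conv_of_real[where 'a=complex] sum_distrib_left)

lemma bounded_bilinear_scale_cvec: "bounded_bilinear (\<lambda>c (b :: real^'n). c *s cvec b)"
  unfolding bilinear_conv_bounded_bilinear[symmetric] bilinear_def linear_iff
  by (simp add: vec_eq_iff cvec_def algebra_simps scaleR_conv_of_real[where 'a=complex])

lemma norm_scale_vec: "norm (c *s (v :: complex^'n)) = cmod c * norm v"
  by (simp add: norm_vec_def norm_mult L2_set_right_distrib)

lemma norm_cvec: "norm (cvec v) = norm v"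
  by (simp add: norm_vec_def cvec_def)

lemma bounded_bilinear_uniform_bound:
  fixes h :: "'a::real_normed_vector \<Rightarrow> 'b::real_normed_vector \<Rightarrow> 'c::real_normed_vector"
    and A :: "'d::topological_space \<Rightarrow> 'a"
  assumes "bounded_bilinear h" "compact S" "continuous_on S A"
  obtains C where "C > 0" "\<And>t x. t \<in> S \<Longrightarrow> norm (h (A t) x) \<le> C * norm x"
proof -
  obtain B where B: "B > 0" "\<And>a x. norm (h a x) \<le> norm a * norm x * B"
    using bounded_bilinear.pos_bounded[OF assms(1)] by blast
  obtain M where M: "M > 0" "\<And>t. t \<in> S \<Longrightarrow> norm (A t) \<le> M"
    using compact_imp_bounded[OF compact_continuous_image[OF assms(3,2)]] by (auto simp: bounded_pos)
  show thesis
  proof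
    show "M * B > 0" using M B by simp
    fix t and x :: 'b assume "t \<in> S"
    then have "norm (A t) * norm x * B \<le> M * norm x * B"
      using M(2) B(1) by (intro mult_right_mono) auto
    then show "norm (h (A t) x) \<le> M * B * norm x"
      using B(2)[of "A t" x] by (simp add: mult_ac)
  qed
qed

lemma abs_continuous_on_imp_continuous_on:
  assumes "abs_continuous_on a b x" shows "continuous_on {a..b} x"
  unfolding continuous_on_iff
proof (intro ballI allI impI)
  fix t \<eta> :: real assume t: "t \<in> {a..b}" and "\<eta> > 0"
  then obtain \<rho> where "\<rho> > 0" and \<rho>: "ac_modulus a b x \<eta> \<rho>"
    using assms unfolding abs_continuous_on_iff_ac_modulus by blast
  have *: "norm (x s - x r) < \<eta>" if "a \<le> r" "r \<le> s" "s \<le> b" "s - r < \<rho>" for r s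
    using ac_modulusD[OF \<rho>, of 1 "\<lambda>_. r" "\<lambda>_. s"] that by simp
  have "dist (x s) (x t) < \<eta>" if "s \<in> {a..b}" "dist s t < \<rho>" for s
    using *[of s t] *[of t s] that t
    by (cases "s \<le> t") (auto simp: dist_norm dist_real_def norm_minus_commute)
  with \<open>\<rho> > 0\<close> show "\<exists>d>0. \<forall>s\<in>{a..b}. dist s t < d \<longrightarrow> dist (x s) (x t) < \<eta>" by blast
qed

lemma cdot_bound:
  fixes K :: "real^'n"
  obtains C where "C \<ge> 0" "\<And>x. cmod (cdot K x) \<le> C * norm x"
proof -
  obtain B where B: "B \<ge> 0" "\<And>r x. cmod (cdot r x) \<le> norm (r :: real^'n) * norm x * B"
    using bounded_bilinear.nonneg_bounded[OF bounded_bilinear_cdot] by blast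
  show thesis
  proof
    show "norm K * B \<ge> 0" using B by simp
    show "cmod (cdot K x) \<le> norm K * B * norm x" for x using B(2)[of K x] by (simp add: mult_ac)
  qed
qed

lemma lipschitz_ode_unique:
  fixes x y :: "real \<Rightarrow> 'a::real_inner"
  assumes "a \<le> b" "0 \<le> L"
    and lip: "\<And>t x y. t \<in> {a..b} \<Longrightarrow> norm (F t x - F t y) \<le> L * norm (x - y)"
    and x: "\<And>t. t \<in> {a..b} \<Longrightarrow> (x has_vector_derivative F t (x t)) (at t within {a..b})"
    and y: "\<And>t. t \<in> {a..b} \<Longrightarrow> (y has_vector_derivative F t (y t)) (at t within {a..b})"
    and "x a = y a" and t: "t \<in> {a..b}"
  shows "x t = y t"
proof -
  have "norm (x t - y t) \<le> (norm (x a - y a) + 0 * (t - a)) * exp (L * (t - a))"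
    by (rule gronwall_norm[OF \<open>a \<le> b\<close> has_vector_derivative_diff[OF x y]]) (use assms in auto)
  then show ?thesis using \<open>x a = y a\<close> by simp
qed

text \<open>The pulse still has the value \<open>1 / \<delta>\<close> at \<open>\<delta>\<close>,
  and again at \<open>T\<close>, where the next one begins. Both times are therefore excluded from
  the second statement and later discarded as null sets.\<close>

lemma pulse_on: "0 < \<delta> \<Longrightarrow> \<delta> < T \<Longrightarrow> t \<in> {0..\<delta>} \<Longrightarrow> pulse T \<delta> t = 1 / \<delta>"
  and pulse_off: "0 < \<delta> \<Longrightarrow> \<delta> < t \<Longrightarrow> t < T \<Longrightarrow> pulse T \<delta> t = 0"
  by (simp_all add: pulse_def)

lemma lipschitz_on_join:
  fixes x :: "real \<Rightarrow> 'a::real_normed_vector"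
  assumes "M-lipschitz_on {a..c} x" "N-lipschitz_on {c..b} x"
  shows "(max M N)-lipschitz_on {a..b} x"
proof (rule lipschitz_on_leI)
  have M: "(max M N)-lipschitz_on {a..c} x" and N: "(max M N)-lipschitz_on {c..b} x"
    using assms by (auto intro: lipschitz_on_le)
  show "0 \<le> max M N" using M by (rule lipschitz_on_nonneg)
  fix s t assume st: "s \<in> {a..b}" "t \<in> {a..b}" "s \<le> t"
  consider "t \<le> c" | "c \<le> s" | "s \<le> c" "c \<le> t" by linarith
  then show "dist (x s) (x t) \<le> max M N * dist s t"
  proof cases
    case 1 then show ?thesis using st by (intro lipschitz_onD[OF M]) auto
  next
    case 2 then show ?thesis using st by (intro lipschitz_onD[OF N]) auto
  next
    case 3
    have "dist (x s) (x t) \<le> dist (x s) (x c) + dist (x c) (x t)" by (rule dist_triangle)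
    also have "\<dots> \<le> max M N * dist s c + max M N * dist c t"
      using 3 st by (intro add_mono lipschitz_onD[OF M] lipschitz_onD[OF N]) auto
    also have "\<dots> = max M N * dist s t"
      using 3 by (simp add: dist_real_def algebra_simps)
    finally show ?thesis .
  qed
qed

definition shift_back :: "real \<Rightarrow> (real \<Rightarrow> complex^'n) \<Rightarrow> (real \<Rightarrow> complex^'n) \<Rightarrow> 'n history" where
  "shift_back T x xt = (\<lambda>t. if t \<in> {-T..0} then (x (t + T), xt (t + T)) else 0)"

section \<open>Existence and uniqueness for the linearised system\<close>

locale controlled_orbit =
  fixes f :: "(real^'n) \<times> real \<Rightarrow> real^'n"
    and xs :: "real \<Rightarrow> real^'n"
    and Y :: "real \<Rightarrow> real^'n^'n"
    and P\<^sub>0 :: "real^'n^'n"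
    and b\<^sub>0 :: "real^'n"
    and T :: real
  assumes smooth: "smooth f"
    and T_pos: "T > 0"
    and orbit: "\<And>t. (xs has_vector_derivative f (xs t, 0)) (at t)"
    and periodic: "\<And>t. xs (t + T) = xs t"
    and nonconst: "\<not> (\<exists>c. \<forall>t. xs t = c)"
    and Y_0: "Y 0 = mat 1"
    and Y_deriv: "\<And>t. t \<in> {0..T} \<Longrightarrow>
           (Y has_vector_derivative (orbit_A f xs t ** Y t)) (at t within {0..T})"
    and P\<^sub>0_def: "P\<^sub>0 = Y T"
    and b\<^sub>0_def: "b\<^sub>0 = orbit_b f xs 0"
    and ctrl: "controllable P\<^sub>0 b\<^sub>0"
begin

abbreviation "A \<equiv> orbit_A f xs"
abbreviation "b \<equiv> orbit_b f xs"

lemma cont_xs: "continuous_on S xs"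
  using orbit by (intro continuous_on_vector_derivative[of _ xs "\<lambda>t. f (xs t, 0)"]) (auto intro: has_vector_derivative_at_within)

lemma cont_A: "continuous_on S A" and cont_b: "continuous_on S b"
  using continuous_on_orbit_A[OF smooth cont_xs] continuous_on_orbit_b[OF smooth cont_xs] by auto

text \<open>One affine equation covers all cases: \<open>c\<close> is \<open>- 1 / \<delta>\<close>
  with the delayed term as forcing during the pulse, \<open>- \<kappa> / \<delta>\<close> without
  forcing for the reduced feedback, and 0 on the free piece.\<close>

definition rhs :: "real^'n \<Rightarrow> complex \<Rightarrow> (real \<Rightarrow> complex^'n) \<Rightarrow> real \<Rightarrow> complex^'n \<Rightarrow> complex^'n" where
  "rhs K c g t x = cmv (A t) x + (c * cdot K x) *s cvec (b t) + g t"

lemma rhs_lipschitz: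
  obtains L where "L \<ge> 0" "\<And>t x y. t \<in> {l..u} \<Longrightarrow> norm (rhs K c g t x - rhs K c g t y) \<le> L * norm (x - y)"
proof -
  obtain CA where CA: "CA > 0" "\<And>t x :: complex^'n. t \<in> {l..u} \<Longrightarrow> norm (cmv (A t) x) \<le> CA * norm x"
    using bounded_bilinear_uniform_bound[OF bounded_bilinear_cmv compact_Icc cont_A] by metis
  obtain CB where CB: "CB > 0" "\<And>t. t \<in> {l..u} \<Longrightarrow> norm (b t) \<le> CB"
    using compact_imp_bounded[OF compact_continuous_image[OF cont_b compact_Icc[of l u]]]
    unfolding bounded_pos by blast
  obtain CK where CK: "CK \<ge> 0" "\<And>x. cmod (cdot K x) \<le> CK * norm x"
    using cdot_bound[of K] by blast
  show thesis
  proof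
    show "CA + cmod c * CK * CB \<ge> 0" using CA CB CK by simp
    fix t x y assume t: "t \<in> {l..u}"
    have eq: "rhs K c g t x - rhs K c g t y = cmv (A t) (x - y) + (c * cdot K (x - y)) *s cvec (b t)"
      unfolding rhs_def bounded_bilinear.diff_right[OF bounded_bilinear_cmv] bounded_bilinear.diff_right[OF bounded_bilinear_cdot]
      by (simp add: vec_eq_iff algebra_simps)
    have "norm ((c * cdot K (x - y)) *s cvec (b t)) = cmod c * cmod (cdot K (x - y)) * norm (b t)"
      by (simp add: norm_scale_vec norm_cvec norm_mult)
    also have "\<dots> \<le> cmod c * (CK * norm (x - y)) * CB"
      using CK CB(2)[OF t] by (intro mult_mono mult_left_mono) auto
    finally show "norm (rhs K c g t x - rhs K c g t y) \<le> (CA + cmod c * CK * CB) * norm (x - y)"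
      unfolding eq using CA(2)[OF t, of "x - y"] norm_triangle_ineq[of "cmv (A t) (x - y)" "(c * cdot K (x - y)) *s cvec (b t)"]
      by (simp add: algebra_simps)
  qed
qed

lemma continuous_on_rhs:
  assumes "continuous_on S g" "continuous_on S x"
  shows "continuous_on S (\<lambda>t. rhs K c g t (x t))"
  unfolding rhs_def
  by (intro continuous_intros assms bounded_bilinear.continuous_on[OF bounded_bilinear_cmv]
      bounded_bilinear.continuous_on[OF bounded_bilinear_scale_cvec]
      bounded_bilinear.continuous_on[OF bounded_bilinear_cdot] cont_A cont_b)

lemma rhs_solution:
  assumes "l \<le> u" "continuous_on {l..u} g"
  obtains x where "x l = x0"
    and "\<And>t. t \<in> {l..u} \<Longrightarrow> (x has_vector_derivative rhs K c g t (x t)) (at t within {l..u})"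
proof -
  obtain L where "L \<ge> 0" "\<And>t x y. t \<in> {l..u} \<Longrightarrow> norm (rhs K c g t x - rhs K c g t y) \<le> L * norm (x - y)"
    using rhs_lipschitz[of l u K c g] by blast
  then show thesis
    using picard_lipschitz[OF \<open>l \<le> u\<close>, of L "rhs K c g" x0] continuous_on_rhs[OF assms(2)] that by blast
qed

lemma rhs_unique:
  assumes "l \<le> u"
    and "\<And>t. t \<in> {l..u} \<Longrightarrow> (x has_vector_derivative rhs K c g t (x t)) (at t within {l..u})"
    and "\<And>t. t \<in> {l..u} \<Longrightarrow> (y has_vector_derivative rhs K c g t (y t)) (at t within {l..u})"
    and "x l = y l" "t \<in> {l..u}"
  shows "x t = y t"
proof -
  obtain L where "L \<ge> 0" "\<And>t x y. t \<in> {l..u} \<Longrightarrow> norm (rhs K c g t x - rhs K c g t y) \<le> L * norm (x - y)"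
    using rhs_lipschitz[of l u K c g] by blast
  then show ?thesis
    using lipschitz_ode_unique[of l u L "rhs K c g" x y t] assms by blast
qed

text \<open>The Caratheodory equation as two classical ones sharing the switching time
  \<open>\<delta>\<close>, where derivatives are one-sided.\<close>

definition is_solution :: "real \<Rightarrow> real \<Rightarrow> real^'n \<Rightarrow> (real \<Rightarrow> complex^'n) \<Rightarrow> (real \<Rightarrow> complex^'n) \<Rightarrow> bool" where
  "is_solution \<epsilon> \<delta> K x xt \<longleftrightarrow>
     (\<forall>t\<in>{0..\<delta>}. (x has_vector_derivative
         cmv (A t) (x t) + (of_real (1 / \<delta>) * cdot K (xt t - x t)) *s cvec (b t)) (at t within {0..\<delta>})) \<and>
     (\<forall>t\<in>{\<delta>..T}. (x has_vector_derivative cmv (A t) (x t)) (at t within {\<delta>..T}))"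

lemma cdot_diff_right: "cdot K (x - y) = cdot K x - cdot K y"
  by (rule bounded_bilinear.diff_right[OF bounded_bilinear_cdot])

lemma rhs_pulse:
  "cmv (A t) x + (of_real (1 / \<delta>) * cdot K (z - x)) *s cvec (b t)
    = rhs K (- of_real (1 / \<delta>)) (\<lambda>t. (of_real (1 / \<delta>) * cdot K z) *s cvec (b t)) t x"
  by (simp add: rhs_def vec_eq_iff cdot_diff_right algebra_simps)

context
  fixes \<epsilon> \<delta> :: real and K :: "real^'n" and \<phi> :: "'n history"
  assumes \<delta>: "0 < \<delta>" "\<delta> < T" and \<phi>: "\<phi> \<in> phase_space T \<epsilon>"
begin

lemma continuous_on_phase: "continuous_on {-T..0} \<phi>"
  and phase_compat: "snd (\<phi> 0) = (1 - \<epsilon>) *\<^sub>R snd (\<phi> (-T)) + \<epsilon> *\<^sub>R fst (\<phi> (-T))"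
  using \<phi> by (auto simp: phase_space_def)

text \<open>Method of steps: over one period the delayed variable is known from the history, so
  \<open>x\<close> solves an ordinary differential equation with given forcing.\<close>

definition delayed :: "real \<Rightarrow> complex^'n" where
  "delayed t = (1 - \<epsilon>) *\<^sub>R snd (\<phi> (t - T)) + \<epsilon> *\<^sub>R fst (\<phi> (t - T))"

lemma continuous_on_delayed: "continuous_on {0..T} delayed"
proof -
  have "continuous_on {0..T} (\<lambda>t. \<phi> (t - T))"
    by (rule continuous_on_compose2[OF continuous_on_phase]) (auto intro!: continuous_intros)
  then show ?thesis unfolding delayed_def[abs_def] by (intro continuous_intros)
qed

lemma linearised_solution_delayed:
  assumes "linearised_solution f xs T \<epsilon> \<delta> K \<phi> x xt" "t \<in> {0..T}"
  shows "xt t = delayed t"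
proof -
  have "(x (t - T), xt (t - T)) = \<phi> (t - T)"
    using assms by (auto simp: linearised_solution_def)
  then have "x (t - T) = fst (\<phi> (t - T))" "xt (t - T) = snd (\<phi> (t - T))"
    by (metis fst_conv, metis snd_conv)
  then show ?thesis
    using assms by (simp add: linearised_solution_def delayed_def)
qed

lemma linearised_solution_initial:
  assumes "linearised_solution f xs T \<epsilon> \<delta> K \<phi> x xt"
  shows "x 0 = fst (\<phi> 0)"
  using assms T_pos unfolding linearised_solution_def
  by (metis atLeastAtMost_iff fst_conv less_eq_real_def neg_le_0_iff_le order_refl)

lemma linearised_solution_is_solution:
  assumes sol: "linearised_solution f xs T \<epsilon> \<delta> K \<phi> x xt"
  shows "is_solution \<epsilon> \<delta> K x xt"
proof -
  have ac: "abs_continuous_on 0 T x"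
    and ae: "AE t in lborel. t \<in> {0..T} \<longrightarrow> (x has_vector_derivative
        cmv (A t) (x t) + (of_real (pulse T \<delta> t) * cdot K (xt t - x t)) *s cvec (b t)) (at t)"
    using sol by (auto simp: linearised_solution_def)
  have cont_x: "continuous_on {0..T} x" by (rule abs_continuous_on_imp_continuous_on[OF ac])
  have "continuous_on {0..T} xt"
    using linearised_solution_delayed[OF sol] by (intro continuous_on_eq[OF continuous_on_delayed]) simp
  then have "continuous_on {0..\<delta>} xt" "continuous_on {0..\<delta>} x" "continuous_on {\<delta>..T} x"
    using cont_x \<delta> by (auto intro: continuous_on_subset)
  with \<delta> have cont1: "continuous_on {0..\<delta>} (\<lambda>t. cmv (A t) (x t) + (of_real (1 / \<delta>) * cdot K (xt t - x t)) *s cvec (b t))"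
    and cont2: "continuous_on {\<delta>..T} (\<lambda>t. cmv (A t) (x t))"
    by (auto intro!: continuous_intros bounded_bilinear.continuous_on[OF bounded_bilinear_cmv]
      bounded_bilinear.continuous_on[OF bounded_bilinear_scale_cvec]
      bounded_bilinear.continuous_on[OF bounded_bilinear_cdot] cont_A cont_b)
  show ?thesis
    unfolding is_solution_def
  proof (intro conjI ballI)
    fix t assume t: "t \<in> {0..\<delta>}"
    have "AE t in lborel. t \<in> {0..\<delta>} \<longrightarrow> (x has_vector_derivative
        cmv (A t) (x t) + (of_real (1 / \<delta>) * cdot K (xt t - x t)) *s cvec (b t)) (at t)"
      using ae
    proof eventually_elim
      case (elim t)
      then show ?case using pulse_on[OF \<delta>, of t] \<delta> by auto
    qed
    then show "(x has_vector_derivative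
        cmv (A t) (x t) + (of_real (1 / \<delta>) * cdot K (xt t - x t)) *s cvec (b t)) (at t within {0..\<delta>})"
      by (rule abs_continuous_continuous_derivative[OF abs_continuous_on_subset[OF ac] _ cont1 t, rotated 2])
        (use \<delta> in auto)
  next
    fix t assume t: "t \<in> {\<delta>..T}"
    have "AE t in lborel. t \<in> {\<delta>..T} \<longrightarrow> (x has_vector_derivative cmv (A t) (x t)) (at t)"
      using ae AE_lborel_singleton[of \<delta>] AE_lborel_singleton[of T]
    proof eventually_elim
      case (elim t)
      then show ?case using pulse_off[OF \<delta>(1), of t T] \<delta> by auto
    qed
    then show "(x has_vector_derivative cmv (A t) (x t)) (at t within {\<delta>..T})"
      by (rule abs_continuous_continuous_derivative[OF abs_continuous_on_subset[OF ac] _ cont2 t, rotated 2])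
        (use \<delta> in auto)
  qed
qed

text \<open>A classical solution has a continuous derivative on each closed piece and is Lipschitz
  there, hence absolutely continuous after joining. The times 0, \<open>\<delta>\<close> and
  \<open>T\<close> are a null set.\<close>

lemma linearised_solutionI:
  assumes sol: "is_solution \<epsilon> \<delta> K x xt"
    and init: "\<And>t. t \<in> {-T..0} \<Longrightarrow> (x t, xt t) = \<phi> t"
    and xt: "\<And>t. t \<in> {0..T} \<Longrightarrow> xt t = delayed t"
  shows "linearised_solution f xs T \<epsilon> \<delta> K \<phi> x xt"
  unfolding linearised_solution_def
proof (intro conjI ballI)
  have d1: "(x has_vector_derivative cmv (A t) (x t) + (of_real (1 / \<delta>) * cdot K (xt t - x t)) *s cvec (b t)) (at t within {0..\<delta>})"
    if "t \<in> {0..\<delta>}" for t using sol that by (auto simp: is_solution_def)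
  have d2: "(x has_vector_derivative cmv (A t) (x t)) (at t within {\<delta>..T})"
    if "t \<in> {\<delta>..T}" for t using sol that by (auto simp: is_solution_def)
  have cx: "continuous_on {0..\<delta>} x" "continuous_on {\<delta>..T} x"
    using continuous_on_vector_derivative[OF d1] continuous_on_vector_derivative[OF d2] by auto
  have "continuous_on {0..\<delta>} xt"
    using xt \<delta> by (intro continuous_on_eq[OF continuous_on_subset[OF continuous_on_delayed]]) auto
  with cx \<delta> have cont1: "continuous_on {0..\<delta>} (\<lambda>t. cmv (A t) (x t) + (of_real (1 / \<delta>) * cdot K (xt t - x t)) *s cvec (b t))"
    and cont2: "continuous_on {\<delta>..T} (\<lambda>t. cmv (A t) (x t))"
    by (auto intro!: continuous_intros bounded_bilinear.continuous_on[OF bounded_bilinear_cmv]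
      bounded_bilinear.continuous_on[OF bounded_bilinear_scale_cvec]
      bounded_bilinear.continuous_on[OF bounded_bilinear_cdot] cont_A cont_b)
  obtain M N where "M-lipschitz_on {0..\<delta>} x" "N-lipschitz_on {\<delta>..T} x"
    using has_vector_derivative_bounded_imp_lipschitz[OF d1 cont1] has_vector_derivative_bounded_imp_lipschitz[OF d2 cont2]
    by metis
  then show "abs_continuous_on 0 T x"
    by (rule lipschitz_imp_abs_continuous_on[OF lipschitz_on_join])
  show "AE t in lborel. t \<in> {0..T} \<longrightarrow> (x has_vector_derivative
        cmv (A t) (x t) + (of_real (pulse T \<delta> t) * cdot K (xt t - x t)) *s cvec (b t)) (at t)"
    using AE_lborel_singleton[of 0] AE_lborel_singleton[of \<delta>] AE_lborel_singleton[of T]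
  proof eventually_elim
    case (elim t)
    show ?case
    proof
      assume t: "t \<in> {0..T}"
      consider "0 < t" "t < \<delta>" | "\<delta> < t" "t < T" using elim t by fastforce
      then show "(x has_vector_derivative
        cmv (A t) (x t) + (of_real (pulse T \<delta> t) * cdot K (xt t - x t)) *s cvec (b t)) (at t)"
      proof cases
        case 1
        then show ?thesis using d1[of t] pulse_on[OF \<delta>, of t] by (simp add: at_within_Icc_at)
      next
        case 2
        then show ?thesis using d2[of t] pulse_off[OF \<delta>(1), of t T] by (simp add: at_within_Icc_at)
      qed
    qed
  qed
  show "xt t = (1 - \<epsilon>) *\<^sub>R xt (t - T) + \<epsilon> *\<^sub>R x (t - T)" if "t \<in> {0..T}" for t
  proof -
    have "(x (t - T), xt (t - T)) = \<phi> (t - T)" using init[of "t - T"] that by auto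
    then have "x (t - T) = fst (\<phi> (t - T))" "xt (t - T) = snd (\<phi> (t - T))"
      by (metis fst_conv, metis snd_conv)
    then show ?thesis using xt[OF that] by (simp add: delayed_def)
  qed
qed (rule init)

lemma linearised_solution_exists:
  obtains x xt where "linearised_solution f xs T \<epsilon> \<delta> K \<phi> x xt"
proof -
  have "continuous_on {0..\<delta>} delayed"
    by (rule continuous_on_subset[OF continuous_on_delayed]) (use \<delta> in auto)
  then have cg: "continuous_on {0..\<delta>} (\<lambda>t. (of_real (1 / \<delta>) * cdot K (delayed t)) *s cvec (b t))"
    by (intro continuous_intros bounded_bilinear.continuous_on[OF bounded_bilinear_scale_cvec]
      bounded_bilinear.continuous_on[OF bounded_bilinear_cdot] cont_b)
  obtain x1 where x1: "x1 0 = fst (\<phi> 0)" and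
    d1: "\<And>t. t \<in> {0..\<delta>} \<Longrightarrow> (x1 has_vector_derivative
      rhs K (- of_real (1 / \<delta>)) (\<lambda>t. (of_real (1 / \<delta>) * cdot K (delayed t)) *s cvec (b t)) t (x1 t)) (at t within {0..\<delta>})"
    using rhs_solution[OF less_imp_le[OF \<delta>(1)] cg, where ?x0.0="fst (\<phi> 0)" and K=K and c="- of_real (1 / \<delta>)"] by blast
  obtain x2 where x2: "x2 \<delta> = x1 \<delta>" and
    d2: "\<And>t. t \<in> {\<delta>..T} \<Longrightarrow> (x2 has_vector_derivative rhs 0 0 (\<lambda>_. 0) t (x2 t)) (at t within {\<delta>..T})"
    using rhs_solution[OF less_imp_le[OF \<delta>(2)] continuous_on_const] by blast
  define x where "x t = (if t \<le> 0 then fst (\<phi> t) else if t \<le> \<delta> then x1 t else x2 t)" for t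
  define xt where "xt t = (if t \<le> 0 then snd (\<phi> t) else delayed t)" for t
  have xx1: "x t = x1 t" if "t \<in> {0..\<delta>}" for t using that x1 by (auto simp: x_def)
  have xx2: "x t = x2 t" if "t \<in> {\<delta>..T}" for t using that x2 \<delta> by (auto simp: x_def)
  \<comment> \<open>At time 0 both the history and the recursion prescribe \<open>xt\<close>; they
    agree by the compatibility condition of the phase space.\<close>
  have xxt: "xt t = delayed t" if "t \<in> {0..T}" for t
    using that phase_compat by (cases "t = 0") (auto simp: xt_def delayed_def)
  have "is_solution \<epsilon> \<delta> K x xt"
    unfolding is_solution_def
  proof (intro conjI ballI)
    fix t assume t: "t \<in> {0..\<delta>}"
    have "(x has_vector_derivative rhs K (- of_real (1 / \<delta>)) (\<lambda>t. (of_real (1 / \<delta>) * cdot K (delayed t)) *s cvec (b t)) t (x1 t)) (at t within {0..\<delta>})"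
      by (rule has_vector_derivative_transform[OF t xx1 d1[OF t]])
    moreover have "xt t = delayed t" using t \<delta> by (intro xxt) auto
    ultimately show "(x has_vector_derivative
        cmv (A t) (x t) + (of_real (1 / \<delta>) * cdot K (xt t - x t)) *s cvec (b t)) (at t within {0..\<delta>})"
      using xx1[OF t] unfolding rhs_pulse rhs_def by simp
  next
    fix t assume t: "t \<in> {\<delta>..T}"
    show "(x has_vector_derivative cmv (A t) (x t)) (at t within {\<delta>..T})"
      using has_vector_derivative_transform[OF t xx2 d2[OF t]] xx2[OF t] by (simp add: rhs_def)
  qed
  then have "linearised_solution f xs T \<epsilon> \<delta> K \<phi> x xt"
    by (rule linearised_solutionI[OF _ _ xxt]) (simp_all add: x_def xt_def)
  then show thesis by (rule that)
qed

lemma linearised_solution_unique: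
  assumes sol: "linearised_solution f xs T \<epsilon> \<delta> K \<phi> x xt" and sol': "linearised_solution f xs T \<epsilon> \<delta> K \<phi> x' xt'"
    and t: "t \<in> {0..T}"
  shows "x t = x' t" "xt t = xt' t"
proof -
  have xt: "xt t = delayed t" "xt' t = delayed t" if "t \<in> {0..T}" for t
    using linearised_solution_delayed[OF sol that] linearised_solution_delayed[OF sol' that] by auto
  then show "xt t = xt' t" using t by simp
  let ?g = "\<lambda>t. (of_real (1 / \<delta>) * cdot K (delayed t)) *s cvec (b t)"
  have d1: "(x has_vector_derivative rhs K (- of_real (1 / \<delta>)) ?g t (x t)) (at t within {0..\<delta>})"
    if s: "linearised_solution f xs T \<epsilon> \<delta> K \<phi> x xt" and t: "t \<in> {0..\<delta>}" for x xt t
  proof -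
    have "xt t = delayed t" using linearised_solution_delayed[OF s, of t] t \<delta> by auto
    moreover have "(x has_vector_derivative
        cmv (A t) (x t) + (of_real (1 / \<delta>) * cdot K (xt t - x t)) *s cvec (b t)) (at t within {0..\<delta>})"
      using linearised_solution_is_solution[OF s] t unfolding is_solution_def by blast
    ultimately show ?thesis
      unfolding rhs_pulse rhs_def by simp
  qed
  have d2: "(x has_vector_derivative rhs 0 0 (\<lambda>_. 0) t (x t)) (at t within {\<delta>..T})"
    if "linearised_solution f xs T \<epsilon> \<delta> K \<phi> x xt" "t \<in> {\<delta>..T}" for x xt t
    using linearised_solution_is_solution[OF that(1)] that(2) by (simp add: is_solution_def rhs_def)
  have eq1: "x t = x' t" if "t \<in> {0..\<delta>}" for t
    by (rule rhs_unique[OF less_imp_le[OF \<delta>(1)] d1[OF sol] d1[OF sol'] _ that])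
      (simp_all add: linearised_solution_initial[OF sol] linearised_solution_initial[OF sol'])
  have eq2: "x t = x' t" if "t \<in> {\<delta>..T}" for t
    by (rule rhs_unique[OF less_imp_le[OF \<delta>(2)] d2[OF sol] d2[OF sol'] _ that])
      (use eq1[of \<delta>] \<delta> in simp_all)
  show "x t = x' t" using eq1[of t] eq2[of t] t by (cases "t \<le> \<delta>") auto
qed

text \<open>Uniqueness on \<open>{0..T}\<close> suffices for the definite description, since
  shifting back forgets the solution elsewhere.\<close>

lemma time_T_map_eq:
  assumes sol: "linearised_solution f xs T \<epsilon> \<delta> K \<phi> x xt"
  shows "time_T_map f xs T \<epsilon> \<delta> K \<phi> = shift_back T x xt"
  unfolding time_T_map_def shift_back_def[symmetric]
proof (rule the_equality)
  show "\<exists>x' xt'. linearised_solution f xs T \<epsilon> \<delta> K \<phi> x' xt' \<and> shift_back T x xt = shift_back T x' xt'"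
    using sol by blast
next
  fix \<psi> assume "\<exists>x xt. linearised_solution f xs T \<epsilon> \<delta> K \<phi> x xt \<and> \<psi> = shift_back T x xt"
  then obtain x' xt' where "linearised_solution f xs T \<epsilon> \<delta> K \<phi> x' xt'" "\<psi> = shift_back T x' xt'" by blast
  moreover have "shift_back T x' xt' t = shift_back T x xt t" for t
    using linearised_solution_unique[OF sol calculation(1), of "t + T"] by (simp add: shift_back_def)
  ultimately show "\<psi> = shift_back T x xt" by (simp add: fun_eq_iff)
qed

lemma time_T_map_obtain:
  obtains x xt where "linearised_solution f xs T \<epsilon> \<delta> K \<phi> x xt"
    "time_T_map f xs T \<epsilon> \<delta> K \<phi> = shift_back T x xt"
proof -
  obtain x xt where sol: "linearised_solution f xs T \<epsilon> \<delta> K \<phi> x xt"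
    by (rule linearised_solution_exists)
  show thesis by (rule that[OF sol time_T_map_eq[OF sol]])
qed

text \<open>The compatibility condition for the new segment is the recursion at time
  \<open>T\<close>. Invariance is needed to iterate the map on generalised eigenvectors.\<close>

lemma time_T_map_phase_space: "time_T_map f xs T \<epsilon> \<delta> K \<phi> \<in> phase_space T \<epsilon>"
proof -
  obtain x xt where sol: "linearised_solution f xs T \<epsilon> \<delta> K \<phi> x xt"
    and U: "time_T_map f xs T \<epsilon> \<delta> K \<phi> = shift_back T x xt" by (rule time_T_map_obtain)
  have "continuous_on {0..T} x"
    using sol by (auto simp: linearised_solution_def intro: abs_continuous_on_imp_continuous_on)
  moreover have "continuous_on {0..T} xt"
    using linearised_solution_delayed[OF sol] by (intro continuous_on_eq[OF continuous_on_delayed]) simp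
  ultimately have "continuous_on {0..T} (\<lambda>t. (x t, xt t))" by (intro continuous_intros)
  then have "continuous_on {-T..0} (\<lambda>t. (x (t + T), xt (t + T)))"
    by (rule continuous_on_compose2[of _ _ _ "\<lambda>t. t + T"]) (auto intro!: continuous_intros)
  then have "continuous_on {-T..0} (shift_back T x xt)"
    by (rule continuous_on_eq) (simp add: shift_back_def)
  moreover have "xt T = (1 - \<epsilon>) *\<^sub>R xt 0 + \<epsilon> *\<^sub>R x 0"
    using sol T_pos by (simp add: linearised_solution_def)
  ultimately show ?thesis
    using T_pos unfolding U shift_back_def phase_space_def
    by (auto cong: continuous_on_cong)
qed

end

end

lemma bounded_bilinear_transpose_mult:
  "bounded_bilinear (\<lambda>(A :: real^'n^'m) x. transpose A *v x)"
  unfolding bilinear_conv_bounded_bilinear[symmetric] bilinear_def linear_iff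
  by (simp add: vec_eq_iff matrix_vector_mult_def transpose_def algebra_simps sum.distrib sum_distrib_left
      del: transpose_matrix_vector)

lemma bounded_bilinear_mult: "bounded_bilinear (\<lambda>(A :: real^'n^'m) x. A *v x)"
  unfolding bilinear_conv_bounded_bilinear[symmetric] bilinear_def linear_iff
  by (simp add: vec_eq_iff matrix_vector_mult_def algebra_simps sum.distrib sum_distrib_left)

lemma cmv_cvec: "cmv A (cvec x) = cvec (A *v x)"
  by (simp add: vec_eq_iff cmv_nth cvec_def matrix_vector_mult_def)

lemma cdot_minus_left: "cdot (- r) x = - cdot r x"
  by (simp add: cdot_sum sum_negf)

lemma eq_if_inner_eq: "(\<And>v. u \<bullet> v = w \<bullet> v) \<Longrightarrow> u = (w :: 'a::real_inner)"
  using inner_eq_zero_iff[of "u - w"] by (simp add: inner_diff_left)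

section \<open>The orbit velocity and the adjoint equation\<close>

context controlled_orbit
begin

definition velocity :: "real \<Rightarrow> real^'n" where
  "velocity t = f (xs t, 0)"

lemma velocity_deriv: "(velocity has_vector_derivative A t *v velocity t) (at t within S)"
  unfolding velocity_def[abs_def]
  by (rule has_vector_derivative_at_within[OF orbit_velocity_derivative[OF smooth orbit]])

lemma velocity_periodic: "velocity (t + real n * T) = velocity t"
proof (induction n)
  case (Suc n)
  have "t + real (Suc n) * T = (t + real n * T) + T" by (simp add: algebra_simps)
  then have "velocity (t + real (Suc n) * T) = velocity (t + real n * T)"
    unfolding velocity_def by (simp only: periodic)
  with Suc show ?case by simp
qed simp

lemma variational_lipschitz:
  obtains L where "L \<ge> 0" "\<And>t x y. t \<in> {l..u} \<Longrightarrow> norm (A t *v x - A t *v y) \<le> L * norm (x - y)"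
proof -
  obtain L where L: "L > 0" "\<And>t x. t \<in> {l..u} \<Longrightarrow> norm (A t *v x) \<le> L * norm x"
    using bounded_bilinear_uniform_bound[OF bounded_bilinear_mult compact_Icc cont_A] by metis
  show thesis
    by (rule that[of L]) (use L in \<open>simp_all flip: matrix_vector_mult_diff_distrib\<close>)
qed

lemma variational_unique:
  assumes "l \<le> u"
    and "\<And>t. t \<in> {l..u} \<Longrightarrow> (x has_vector_derivative A t *v x t) (at t within {l..u})"
    and "\<And>t. t \<in> {l..u} \<Longrightarrow> (y has_vector_derivative A t *v y t) (at t within {l..u})"
    and "x l = y l" "t \<in> {l..u}"
  shows "x t = y t"
proof -
  obtain L where "L \<ge> 0" "\<And>t x y. t \<in> {l..u} \<Longrightarrow> norm (A t *v x - A t *v y) \<le> L * norm (x - y)"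
    using variational_lipschitz[of l u] by blast
  then show ?thesis
    using lipschitz_ode_unique[of l u L "\<lambda>t x. A t *v x" x y t] assms by blast
qed

lemma Y_mult_deriv:
  assumes "t \<in> {0..T}"
  shows "((\<lambda>t. Y t *v c) has_vector_derivative A t *v (Y t *v c)) (at t within {0..T})"
  using bounded_bilinear.has_vector_derivative[OF bounded_bilinear_mult Y_deriv[OF assms] has_vector_derivative_const[of c]]
  by (simp add: matrix_vector_mul_assoc)

lemma Y_velocity: "t \<in> {0..T} \<Longrightarrow> Y t *v velocity 0 = velocity t"
  by (rule variational_unique[OF less_imp_le[OF T_pos] Y_mult_deriv velocity_deriv]) (simp_all add: Y_0)

lemma P\<^sub>0_velocity: "P\<^sub>0 *v velocity 0 = velocity 0"
  using Y_velocity[of T] velocity_periodic[of 0 1] T_pos by (simp add: P\<^sub>0_def)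

text \<open>A zero of the velocity propagates forwards by uniqueness and to all times by
  periodicity, which would make the orbit constant.\<close>

lemma velocity_nonzero: "velocity 0 \<noteq> 0"
proof
  assume v0: "velocity 0 = 0"
  have pos: "velocity t = 0" if "t \<ge> 0" for t
    by (rule variational_unique[of 0 t velocity "\<lambda>_. 0", OF that velocity_deriv]) (simp_all add: v0 that)
  have "velocity t = 0" for t
  proof -
    obtain n :: nat where "- t < real n * T" using reals_Archimedean3[OF T_pos] by blast
    then show ?thesis using pos[of "t + real n * T"] velocity_periodic[of t n] by simp
  qed
  then have "(xs has_vector_derivative 0) (at t within UNIV)" for t
    using orbit[of t] by (simp add: velocity_def)
  then obtain c where "\<And>t. xs t = c"
    using has_vector_derivative_zero_constant[of UNIV xs] by auto
  with nonconst show False by blast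
qed

definition adjoint_solution :: "(real \<Rightarrow> real^'n) \<Rightarrow> bool" where
  "adjoint_solution w \<longleftrightarrow>
     (\<forall>t\<in>{0..T}. (w has_vector_derivative - (transpose (A t) *v w t)) (at t within {0..T}))"

lemma adjoint_solution_exists:
  obtains w where "adjoint_solution w" "w 0 = w\<^sub>0"
proof -
  obtain L where L: "L > 0" "\<And>t x. t \<in> {0..T} \<Longrightarrow> norm (transpose (A t) *v x) \<le> L * norm x"
    using bounded_bilinear_uniform_bound[OF bounded_bilinear_transpose_mult compact_Icc cont_A] by metis
  have "norm (- (transpose (A t) *v x) - - (transpose (A t) *v y)) \<le> L * norm (x - y)" if "t \<in> {0..T}" for t x y
  proof -
    have "- (transpose (A t) *v x) - - (transpose (A t) *v y) = - (transpose (A t) *v (x - y))"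
      by (simp add: matrix_vector_mult_diff_distrib del: transpose_matrix_vector)
    then show ?thesis using L(2)[OF that, of "x - y"] by (metis norm_minus_cancel)
  qed
  moreover have "continuous_on {0..T} (\<lambda>t. - (transpose (A t) *v x t))" if "continuous_on {0..T} x" for x
    by (intro continuous_intros bounded_bilinear.continuous_on[OF bounded_bilinear_transpose_mult] cont_A that)
  ultimately show thesis
    using picard_lipschitz[of 0 T L "\<lambda>t x. - (transpose (A t) *v x)" w\<^sub>0] T_pos L(1) that
    unfolding adjoint_solution_def by (smt (verit, best))
qed

text \<open>Pairing with a solution of the adjoint equation eliminates the uncontrolled dynamics.\<close>

lemma adjoint_pairing:
  assumes w: "(w has_vector_derivative - (transpose (A t) *v w t)) (at t within S)"
    and x: "(x has_vector_derivative cmv (A t) (x t) + d *s cvec (b t)) (at t within S)"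
  shows "((\<lambda>t. cdot (w t) (x t)) has_vector_derivative d * of_real (w t \<bullet> b t)) (at t within S)"
proof -
  have "cdot (w t) (cmv (A t) (x t) + d *s cvec (b t)) + cdot (- (transpose (A t) *v w t)) (x t) = d * of_real (w t \<bullet> b t)"
    unfolding cdot_add_right cdot_scale_right cdot_cvec cdot_cmv cdot_minus_left by simp
  then show ?thesis
    using bounded_bilinear.has_vector_derivative[OF bounded_bilinear_cdot w x] by simp
qed

lemma adjoint_pairing_free:
  assumes \<delta>: "0 < \<delta>" "\<delta> < T" and w: "adjoint_solution w" and x: "\<And>t. t \<in> {\<delta>..T} \<Longrightarrow> (z has_vector_derivative cmv (A t) (z t)) (at t within {\<delta>..T})"
  shows "cdot (w T) (z T) = cdot (w \<delta>) (z \<delta>)"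
proof -
  have "norm (cdot (w T) (z T) - cdot (w \<delta>) (z \<delta>)) \<le> 0 * (T - \<delta>)"
  proof (rule norm_increment_le[OF _ adjoint_pairing[of w _ _ z 0]])
    fix t assume t: "t \<in> {\<delta>..T}"
    show "(w has_vector_derivative - (transpose (A t) *v w t)) (at t within {\<delta>..T})"
      by (rule has_vector_derivative_within_subset[of _ _ _ "{0..T}"])
        (use w t \<delta> in \<open>auto simp: adjoint_solution_def simp del: transpose_matrix_vector\<close>)
  qed (use x \<delta> in auto)
  then show ?thesis by simp
qed

lemma adjoint_Y_inner:
  assumes "adjoint_solution w" "t \<in> {0..T}"
  shows "w t \<bullet> (Y t *v v) = w 0 \<bullet> v"
proof -
  let ?h = "\<lambda>t. w t \<bullet> (Y t *v v)"
  have "(?h has_vector_derivative 0) (at t within {0..T})" if t: "t \<in> {0..T}" for t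
  proof -
    have "(?h has_vector_derivative w t \<bullet> (A t *v (Y t *v v)) + - (transpose (A t) *v w t) \<bullet> (Y t *v v)) (at t within {0..T})"
      by (rule bounded_bilinear.has_vector_derivative[OF bounded_bilinear_inner _ Y_mult_deriv[OF t]])
        (use assms t in \<open>simp add: adjoint_solution_def del: transpose_matrix_vector\<close>)
    then show ?thesis by (simp add: inner_transpose_mult del: transpose_matrix_vector)
  qed
  then obtain c where "\<And>t. t \<in> {0..T} \<Longrightarrow> ?h t = c"
    using has_vector_derivative_zero_constant[of "{0..T}" ?h] by auto
  then show ?thesis using assms(2) T_pos Y_0 by (metis atLeastAtMost_iff less_eq_real_def matrix_vector_mul_lid order_refl)
qed

text \<open>Adjoint solutions take the place of Liouville's formula: their pairing with
  \<open>Y t *v v\<close> is constant, so a kernel vector \<open>v\<close> of \<open>Y t\<close>,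
  used as the initial value of the adjoint solution, would satisfy
  \<open>v \<bullet> v = 0\<close>.\<close>

lemma det_Y_nonzero:
  assumes "t \<in> {0..T}" shows "det (Y t) \<noteq> 0"
proof
  assume "det (Y t) = 0"
  then obtain v where v: "v \<noteq> 0" "Y t *v v = 0" by (rule det_zero_imp_kernel)
  obtain w where "adjoint_solution w" "w 0 = v" by (rule adjoint_solution_exists)
  then have "v \<bullet> v = 0" using adjoint_Y_inner[of w t v] assms v(2) by simp
  with v(1) show False by simp
qed

lemma det_P\<^sub>0_pos: "det P\<^sub>0 > 0"
  unfolding P\<^sub>0_def
  by (rule det_pos_path[OF less_imp_le[OF T_pos] continuous_on_vector_derivative[OF Y_deriv] det_Y_nonzero])
    (simp_all add: Y_0)

text \<open>Constancy of the pairing gives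
  \<open>w T \<bullet> (P\<^sub>0 *v v) = w 0 \<bullet> v\<close>. For a left fixed vector
  \<open>w 0\<close> of \<open>P\<^sub>0\<close> this equals
  \<open>w 0 \<bullet> (P\<^sub>0 *v v)\<close>, and \<open>P\<^sub>0\<close> is surjective.\<close>

lemma periodic_adjoint_solution:
  obtains w where "adjoint_solution w" "w T = w 0" "w 0 \<bullet> b\<^sub>0 \<noteq> 0"
proof -
  obtain w\<^sub>0 where w\<^sub>0: "w\<^sub>0 \<noteq> 0" "transpose P\<^sub>0 *v w\<^sub>0 = w\<^sub>0"
    using left_eigenvector[OF P\<^sub>0_velocity velocity_nonzero] by blast
  obtain w where w: "adjoint_solution w" "w 0 = w\<^sub>0" by (rule adjoint_solution_exists)
  have "surj ((*v) P\<^sub>0)"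
    using det_P\<^sub>0_pos by (metis invertible_det_nz invertible_def less_irrefl matrix_right_invertible_surjective)
  have "w T = w\<^sub>0"
  proof (rule eq_if_inner_eq)
    fix u
    obtain v where u: "u = P\<^sub>0 *v v" using \<open>surj ((*v) P\<^sub>0)\<close> by (metis surjD)
    have "w T \<bullet> u = w\<^sub>0 \<bullet> v"
      using adjoint_Y_inner[OF w(1), of T v] T_pos w(2) by (simp add: u P\<^sub>0_def)
    also have "\<dots> = w\<^sub>0 \<bullet> u" using inner_transpose_mult[of P\<^sub>0 w\<^sub>0 v] w\<^sub>0(2) by (simp add: u)
    finally show "w T \<bullet> u = w\<^sub>0 \<bullet> u" .
  qed
  then show thesis
    using that w controllable_left_eigenvector[OF ctrl w\<^sub>0(2,1)] by simp
qed

section \<open>Reduction to instantaneous feedback\<close>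

text \<open>Here \<open>\<kappa>\<close> is a free complex parameter, detached from \<mu> and
  \<epsilon>, so that estimates can be uniform over a disc.\<close>

definition feedback_solution :: "real^'n \<Rightarrow> complex \<Rightarrow> real \<Rightarrow> (real \<Rightarrow> complex^'n) \<Rightarrow> bool" where
  "feedback_solution K \<kappa> \<delta> x \<longleftrightarrow>
     (\<forall>t\<in>{0..\<delta>}. (x has_vector_derivative
         cmv (A t) (x t) + (- (\<kappa> / of_real \<delta>) * cdot K (x t)) *s cvec (b t)) (at t within {0..\<delta>})) \<and>
     (\<forall>t\<in>{\<delta>..T}. (x has_vector_derivative cmv (A t) (x t)) (at t within {\<delta>..T}))"

lemma feedback_solution_zero:
  assumes "feedback_solution K \<kappa> \<delta> x" "0 < \<delta>" "\<delta> < T" "x 0 = 0" "t \<in> {0..T}"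
  shows "x t = 0"
proof -
  have 1: "x t = 0" if "t \<in> {0..\<delta>}" for t
    by (rule rhs_unique[of 0 \<delta> x K "- (\<kappa> / of_real \<delta>)" "\<lambda>_. 0" "\<lambda>_. 0"])
      (use assms that in \<open>auto simp: feedback_solution_def rhs_def cdot_sum\<close>)
  have 2: "x t = 0" if "t \<in> {\<delta>..T}" for t
    by (rule rhs_unique[of \<delta> T x 0 0 "\<lambda>_. 0" "\<lambda>_. 0"])
      (use assms that 1[of \<delta>] in \<open>auto simp: feedback_solution_def rhs_def cdot_sum\<close>)
  show ?thesis using 1[of t] 2[of t] assms(5) by (cases "t \<le> \<delta>") auto
qed

text \<open>On an eigenfunction the delayed recursion is solved for \<open>xt\<close> in terms of \<open>x\<close>, which turns the
  delayed feedback into the instantaneous feedback \<open>- \<kappa> K\<^sup>T x\<close>.\<close>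

lemma floquet_multiplier_feedback_solution:
  assumes \<delta>: "0 < \<delta>" "\<delta> < T" and \<mu>: "\<mu> \<in> floquet_multipliers f xs T \<epsilon> \<delta> K"
    and ne: "\<mu> - 1 + of_real \<epsilon> \<noteq> 0"
  obtains x where "feedback_solution K ((\<mu> - 1) / (\<mu> - 1 + of_real \<epsilon>)) \<delta> x" "x 0 \<noteq> 0" "x T = \<mu> *s x 0"
proof -
  let ?\<kappa> = "(\<mu> - 1) / (\<mu> - 1 + of_real \<epsilon>)"
  obtain \<phi> where "\<mu> \<noteq> 0" and \<phi>: "\<phi> \<in> phase_space T \<epsilon>" "\<phi> \<noteq> 0"
    and eig: "time_T_map f xs T \<epsilon> \<delta> K \<phi> = hscale \<mu> \<phi>"
    using \<mu> by (auto simp: floquet_multipliers_def)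
  obtain x xt where sol: "linearised_solution f xs T \<epsilon> \<delta> K \<phi> x xt"
    and U: "time_T_map f xs T \<epsilon> \<delta> K \<phi> = shift_back T x xt"
    using time_T_map_obtain[OF \<delta> \<phi>(1)] by blast
  have shift: "x t = \<mu> *s fst (\<phi> (t - T))" "xt t = \<mu> *s snd (\<phi> (t - T))" if "t \<in> {0..T}" for t
    using fun_cong[OF trans[OF U[symmetric] eig], of "t - T"] that by (auto simp: shift_back_def hscale_def)
  have xt: "xt t = (of_real \<epsilon> / (\<mu> - 1 + of_real \<epsilon>)) *s x t" if t: "t \<in> {0..T}" for t
  proof -
    have "\<mu> *s snd (\<phi> (t - T)) = (1 - \<epsilon>) *\<^sub>R snd (\<phi> (t - T)) + \<epsilon> *\<^sub>R fst (\<phi> (t - T))"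
      using linearised_solution_delayed[OF \<delta> \<phi>(1) sol t] shift(2)[OF t] by (simp add: delayed_def[OF \<delta> \<phi>(1)])
    then have "(\<mu> - 1 + of_real \<epsilon>) *s snd (\<phi> (t - T)) = of_real \<epsilon> *s fst (\<phi> (t - T))"
      by (simp add: vec_eq_iff algebra_simps scaleR_conv_of_real[where 'a=complex])
    then have "snd (\<phi> (t - T)) = (of_real \<epsilon> / (\<mu> - 1 + of_real \<epsilon>)) *s fst (\<phi> (t - T))"
      using ne by (simp add: vec_eq_iff field_simps)
    then show ?thesis using shift[OF t] by (simp add: vec_eq_iff)
  qed
  have diff: "xt t - x t = - ?\<kappa> *s x t" if "t \<in> {0..T}" for t
    unfolding xt[OF that] using ne by (simp add: vec_eq_iff field_simps)
  have cdot_diff: "of_real (1 / \<delta>) * cdot K (xt t - x t) = - (?\<kappa> / of_real \<delta>) * cdot K (x t)" if "t \<in> {0..\<delta>}" for t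
  proof -
    have "t \<in> {0..T}" using that \<delta> by auto
    show ?thesis unfolding diff[OF \<open>t \<in> {0..T}\<close>] cdot_scale_right by simp
  qed
  have fb: "feedback_solution K ?\<kappa> \<delta> x"
    unfolding feedback_solution_def
  proof (intro conjI ballI)
    note sol' = linearised_solution_is_solution[OF \<delta> \<phi>(1) sol, unfolded is_solution_def]
    show "(x has_vector_derivative cmv (A t) (x t) + (- (?\<kappa> / of_real \<delta>) * cdot K (x t)) *s cvec (b t)) (at t within {0..\<delta>})"
      if t: "t \<in> {0..\<delta>}" for t
      using sol'[THEN conjunct1, rule_format, OF t] unfolding cdot_diff[OF t] .
    show "(x has_vector_derivative cmv (A t) (x t)) (at t within {\<delta>..T})" if t: "t \<in> {\<delta>..T}" for t
      using sol'[THEN conjunct2, rule_format, OF t] .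
  qed
  have "x 0 = fst (\<phi> 0)"
    by (rule linearised_solution_initial[OF \<delta> \<phi>(1) sol])
  then have xT: "x T = \<mu> *s x 0" using shift(1)[of T] T_pos by simp
  \<comment> \<open>If \<open>x 0\<close> vanished, so would \<open>x\<close> and then
    \<open>xt\<close> on the whole period; as \<mu> is nonzero, the history itself would be
    0.\<close>
  have "x 0 \<noteq> 0"
  proof
    assume "x 0 = 0"
    then have zero: "x t = 0" if "t \<in> {0..T}" for t
      by (rule feedback_solution_zero[OF fb \<delta> _ that])
    have "\<phi> t = 0" for t
    proof (cases "t \<in> {-T..0}")
      case True
      then have t: "t + T \<in> {0..T}" by auto
      have "xt (t + T) = 0" using xt[OF t] zero[OF t] by simp
      then show ?thesis
        using shift[OF t] zero[OF t] \<open>\<mu> \<noteq> 0\<close> by (simp add: vec_eq_iff prod_eq_iff)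
    next
      case False
      then show ?thesis using \<phi>(1) by (auto simp: phase_space_def)
    qed
    with \<phi>(2) show False by (simp add: fun_eq_iff)
  qed
  show thesis by (rule that[OF fb \<open>x 0 \<noteq> 0\<close> xT])
qed

end

section \<open>The limit of short pulses\<close>

lemma expm1_quot_mult: "z * expm1_quot z = 1 - exp (- z)"
  by (simp add: expm1_quot_def)

text \<open>The differentiated function is the integral of \<open>exp (- z r)\<close> over
  \<open>r\<close> from 0 to \<open>s\<close>; it describes how far a pulse has acted after the
  fraction \<open>s\<close> of its length.\<close>

lemma expm1_quot_has_vector_derivative:
  "((\<lambda>s. of_real s * expm1_quot (z * of_real s)) has_vector_derivative exp (- (z * of_real s))) (at s within S)"
proof (cases "z = 0")
  case True
  then show ?thesis
    by (auto simp: expm1_quot_def intro!: derivative_eq_intros)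
next
  case False
  then have eq: "of_real s * expm1_quot (z * of_real s) = (1 - exp (- (z * of_real s))) / z" for s
    using expm1_quot_mult[of "z * of_real s"] by (simp add: field_simps)
  have "((\<lambda>u. (1 - exp (- (z * u))) / z) has_field_derivative exp (- (z * of_real s))) (at (of_real s))"
    using False by (auto intro!: derivative_eq_intros)
  then have "((\<lambda>s. (1 - exp (- (z * of_real s))) / z) has_vector_derivative exp (- (z * of_real s))) (at s within S)"
    by (rule has_vector_derivative_real_field)
  then show ?thesis unfolding eq .
qed

lemma cmv_matrix_mult: "cmv (A ** B) x = cmv A (cmv B x)"
proof -
  have "map_matrix complex_of_real (A ** B) = map_matrix complex_of_real A ** map_matrix complex_of_real B"
    by (simp add: vec_eq_iff matrix_matrix_mult_def)
  then show ?thesis by (simp add: matrix_vector_mul_assoc)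
qed

lemma cmv_mat_1: "cmv (mat 1) x = x"
  by (simp add: vec_eq_iff cmv_nth mat_def if_distrib[of "\<lambda>x. x * c" for c] if_distrib[of complex_of_real] cong: if_cong)

lemma cvec_0: "cvec 0 = 0"
  by (simp add: cvec_def vec_eq_iff)

lemma diff_scale_cvec:
  "z + c *s cvec p - c' *s cvec q = z + (c *s cvec (p - q) + (c - c') *s cvec q)"
  by (simp add: vec_eq_iff cvec_def algebra_simps)

lemma norm_scale_cvec_le:
  fixes c :: complex and v :: "real^'n"
  assumes "cmod c \<le> c'" "norm v \<le> v'" "0 \<le> c'"
  shows "norm (c *s cvec v) \<le> c' * v'"
  unfolding norm_scale_vec norm_cvec using assms by (intro mult_mono) auto

context controlled_orbit
begin

context
  fixes K :: "real^'n" and CA CB CK :: real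
  assumes CA: "0 \<le> CA" "\<And>t x :: complex^'n. t \<in> {0..T} \<Longrightarrow> norm (cmv (A t) x) \<le> CA * norm x"
    and CB: "0 \<le> CB" "\<And>t. t \<in> {0..T} \<Longrightarrow> norm (b t) \<le> CB"
    and CK: "0 \<le> CK" "\<And>x. cmod (cdot K x) \<le> CK * norm x"
begin

text \<open>The gain has modulus at most \<open>2 / \<delta>\<close> and acts for time
  \<open>\<delta>\<close>, so the pulse adds \<open>2 * CK * CB\<close> to the exponent whatever
  \<delta> is. Each of the two pieces adds a crude \<open>CA * T\<close>.\<close>

definition growth :: real where
  "growth = exp (CA * T + 2 * CK * CB) * exp (CA * T)"

definition closeness :: real where
  "closeness = (CA * growth + 2 * CK * growth) * exp (2 * CK * CB)"

lemma growth_pos: "growth > 0" and closeness_nonneg: "closeness \<ge> 0"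
  using CA(1) CK(1) by (simp_all add: growth_def closeness_def)

context
  fixes \<kappa> :: complex and \<delta> \<tau> :: real and x :: "real \<Rightarrow> complex^'n"
  assumes fb: "feedback_solution K \<kappa> \<delta> x" and \<delta>: "0 < \<delta>" "\<delta> < T" and \<kappa>: "cmod \<kappa> \<le> 2"
begin

lemma fb1: "t \<in> {0..\<delta>} \<Longrightarrow> (x has_vector_derivative
      cmv (A t) (x t) + (- (\<kappa> / of_real \<delta>) * cdot K (x t)) *s cvec (b t)) (at t within {0..\<delta>})"
  and fb2: "t \<in> {\<delta>..T} \<Longrightarrow> (x has_vector_derivative cmv (A t) (x t)) (at t within {\<delta>..T})"
  using fb by (auto simp: feedback_solution_def)

lemma norm_gain_le: "cmod (- (\<kappa> / of_real \<delta>) * cdot K z) \<le> 2 / \<delta> * (CK * norm z)"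
  using \<kappa> \<delta> CK(2)[of z] by (auto simp: norm_mult norm_divide intro!: mult_mono divide_right_mono)

lemma feedback_solution_bound:
  assumes t: "t \<in> {0..T}"
  shows "norm (x t) \<le> growth * norm (x 0)"
proof -
  have 1: "norm (x t) \<le> exp (CA * T + 2 * CK * CB) * norm (x 0)" if t: "t \<in> {0..\<delta>}" for t
  proof -
    have "norm (x t) \<le> (norm (x 0) + 0 * (t - 0)) * exp ((CA + 2 * CK * CB / \<delta>) * (t - 0))"
    proof (rule gronwall_norm[OF _ fb1])
      fix t assume "t \<in> {0..\<delta>}"
      then have t: "t \<in> {0..T}" using \<delta> by auto
      have "norm ((- (\<kappa> / of_real \<delta>) * cdot K (x t)) *s cvec (b t)) \<le> (2 / \<delta> * (CK * norm (x t))) * CB"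
        using norm_gain_le[of "x t"] CB(2)[OF t] CK(1) \<delta> by (intro norm_scale_cvec_le) auto
      then show "norm (cmv (A t) (x t) + (- (\<kappa> / of_real \<delta>) * cdot K (x t)) *s cvec (b t)) \<le> (CA + 2 * CK * CB / \<delta>) * norm (x t) + 0"
        using CA(2)[OF t, of "x t"] by (intro norm_triangle_le) (simp add: algebra_simps)
    qed (use \<delta> CA CB CK t in auto)
    moreover have "(CA + 2 * CK * CB / \<delta>) * (t - 0) \<le> CA * T + 2 * CK * CB"
    proof -
      have "CA * t \<le> CA * T" using t \<delta> CA(1) by (intro mult_left_mono) auto
      moreover have "2 * CK * CB / \<delta> * t \<le> 2 * CK * CB / \<delta> * \<delta>"
        using t \<delta> CB(1) CK(1) by (intro mult_left_mono) auto
      ultimately show ?thesis using \<delta> by (simp add: algebra_simps)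
    qed
    then have "norm (x 0) * exp ((CA + 2 * CK * CB / \<delta>) * (t - 0)) \<le> norm (x 0) * exp (CA * T + 2 * CK * CB)"
      by (intro mult_left_mono) simp_all
    ultimately show ?thesis by (simp add: mult.commute)
  qed
  have 2: "norm (x t) \<le> exp (CA * T) * norm (x \<delta>)" if t: "t \<in> {\<delta>..T}" for t
  proof -
    have "norm (x t) \<le> (norm (x \<delta>) + 0 * (t - \<delta>)) * exp (CA * (t - \<delta>))"
      by (rule gronwall_norm[OF _ fb2]) (use CA t \<delta> in auto)
    moreover have "CA * (t - \<delta>) \<le> CA * T"
      using t \<delta> CA(1) by (intro mult_left_mono) auto
    then have "norm (x \<delta>) * exp (CA * (t - \<delta>)) \<le> norm (x \<delta>) * exp (CA * T)"
      by (intro mult_left_mono) simp_all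
    ultimately show ?thesis by (simp add: mult.commute)
  qed
  show ?thesis
  proof (cases "t \<le> \<delta>")
    case True
    then have "norm (x t) \<le> exp (CA * T + 2 * CK * CB) * norm (x 0) * 1" using 1[of t] t by simp
    also have "\<dots> \<le> exp (CA * T + 2 * CK * CB) * norm (x 0) * exp (CA * T)"
      using CA(1) T_pos by (intro mult_left_mono) auto
    finally show ?thesis by (simp add: growth_def mult_ac)
  next
    case False
    then have "norm (x t) \<le> exp (CA * T) * norm (x \<delta>)" using 2[of t] t by simp
    also have "\<dots> \<le> exp (CA * T) * (exp (CA * T + 2 * CK * CB) * norm (x 0))"
      using 1[of \<delta>] \<delta> by (intro mult_left_mono) auto
    finally show ?thesis by (simp add: growth_def mult_ac)
  qed
qed

text \<open>The exact solution \<open>exp (- (\<kappa> t / \<delta>) b\<^sub>0 K^T) x 0\<close> of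
  the pulse equation with the \<open>A\<close> term dropped and \<open>b\<close> frozen at
  \<open>b\<^sub>0\<close>.\<close>

definition pulse_profile :: "real \<Rightarrow> complex^'n" where
  "pulse_profile t = x 0 - (\<kappa> * (of_real (t / \<delta>) * expm1_quot (\<kappa> * of_real (K \<bullet> b\<^sub>0) * of_real (t / \<delta>))) * cdot K (x 0)) *s cvec b\<^sub>0"

lemma cdot_pulse_profile:
  "cdot K (pulse_profile t) = exp (- (\<kappa> * of_real (K \<bullet> b\<^sub>0) * of_real (t / \<delta>))) * cdot K (x 0)"
proof -
  let ?z = "\<kappa> * of_real (K \<bullet> b\<^sub>0) * of_real (t / \<delta>)"
  have "cdot K (pulse_profile t) = (1 - ?z * expm1_quot ?z) * cdot K (x 0)"
    unfolding pulse_profile_def cdot_diff_right cdot_scale_right cdot_cvec by (simp add: algebra_simps)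
  then show ?thesis by (simp add: expm1_quot_mult)
qed

lemma theta_derivative:
  "((\<lambda>t. of_real (t / \<delta>) * expm1_quot (z * of_real (t / \<delta>))) has_vector_derivative
      exp (- (z * of_real (t / \<delta>))) / of_real \<delta>) (at t within S)"
proof -
  have "((\<lambda>t. t / \<delta>) has_vector_derivative 1 / \<delta>) (at t within S)"
    using \<delta> by (auto intro!: derivative_eq_intros simp flip: has_real_derivative_iff_has_vector_derivative)
  from vector_diff_chain_within[OF this expm1_quot_has_vector_derivative]
  show ?thesis using \<delta> by (simp add: o_def scaleR_conv_of_real field_simps)
qed

lemma pulse_profile_derivative:
  "(pulse_profile has_vector_derivative (- (\<kappa> / of_real \<delta>) * cdot K (pulse_profile t)) *s cvec b\<^sub>0) (at t within S)"
proof -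
  let ?z = "\<kappa> * of_real (K \<bullet> b\<^sub>0)"
  have "((\<lambda>t. \<kappa> * (of_real (t / \<delta>) * expm1_quot (?z * of_real (t / \<delta>))) * cdot K (x 0)) has_vector_derivative
     \<kappa> * (exp (- (?z * of_real (t / \<delta>))) / of_real \<delta>) * cdot K (x 0)) (at t within S)"
    by (intro has_vector_derivative_mult_left has_vector_derivative_mult_right theta_derivative)
  from bounded_bilinear.has_vector_derivative[OF bounded_bilinear_scale_cvec this has_vector_derivative_const[of b\<^sub>0]]
  have "((\<lambda>t. (\<kappa> * (of_real (t / \<delta>) * expm1_quot (?z * of_real (t / \<delta>))) * cdot K (x 0)) *s cvec b\<^sub>0) has_vector_derivative
     (\<kappa> * (exp (- (?z * of_real (t / \<delta>))) / of_real \<delta>) * cdot K (x 0)) *s cvec b\<^sub>0) (at t within S)"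
    unfolding cvec_0 vector_smult_rzero add_0_left .
  from has_vector_derivative_diff[OF has_vector_derivative_const[of "x 0"] this]
  show ?thesis
    unfolding pulse_profile_def[abs_def, symmetric] cdot_pulse_profile by (simp add: vec_eq_iff field_simps)
qed

lemma pulse_profile_0: "pulse_profile 0 = x 0"
  by (simp add: pulse_profile_def)

lemma pulse_profile_\<delta>: "pulse_profile \<delta> = x 0 - (\<kappa> * expm1_quot (\<kappa> * of_real (K \<bullet> b\<^sub>0)) * cdot K (x 0)) *s cvec b\<^sub>0"
  using \<delta> by (simp add: pulse_profile_def)

context
  assumes \<tau>: "\<delta> \<le> \<tau>" "\<And>t. t \<in> {0..\<delta>} \<Longrightarrow> norm (b t - b\<^sub>0) \<le> \<tau>" "norm (Y \<delta> - mat 1) \<le> \<tau>"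
begin

text \<open>The error equation has two forcings: the dropped term \<open>A x\<close>, bounded but
  acting only for time \<open>\<delta>\<close>, and \<open>b t - b\<^sub>0\<close> with a gain of
  order \<open>1 / \<delta>\<close>. Both integrate to order \<open>\<tau>\<close>, the common bound
  for the pulse length and for the drift of \<open>b\<close> and \<open>Y\<close> during the
  pulse.\<close>

lemma pulse_profile_close:
  assumes t: "t \<in> {0..\<delta>}"
  shows "norm (x t - pulse_profile t) \<le> closeness * \<tau> * norm (x 0)"
proof -
  let ?e = "\<lambda>t. x t - pulse_profile t"
  let ?m = "(CA * growth + 2 / \<delta> * CK * growth * \<tau>) * norm (x 0)"
  have "norm (?e t) \<le> (norm (?e 0) + ?m * (t - 0)) * exp (2 / \<delta> * CK * CB * (t - 0))"
  proof (rule gronwall_norm[OF _ has_vector_derivative_diff[OF fb1 pulse_profile_derivative]])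
    fix t assume t: "t \<in> {0..\<delta>}"
    then have t': "t \<in> {0..T}" using \<delta> by auto
    note xb = feedback_solution_bound[OF t']
    have eq: "cmv (A t) (x t) + (- (\<kappa> / of_real \<delta>) * cdot K (x t)) *s cvec (b t) - (- (\<kappa> / of_real \<delta>) * cdot K (pulse_profile t)) *s cvec b\<^sub>0
       = cmv (A t) (x t) + ((- (\<kappa> / of_real \<delta>) * cdot K (x t)) *s cvec (b t - b\<^sub>0) + (- (\<kappa> / of_real \<delta>) * cdot K (?e t)) *s cvec b\<^sub>0)"
      unfolding cdot_diff_right right_diff_distrib by (rule diff_scale_cvec)
    have "norm (cmv (A t) (x t)) \<le> CA * (growth * norm (x 0))"
      using CA(2)[OF t', of "x t"] mult_left_mono[OF xb CA(1)] by linarith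
    moreover have "norm ((- (\<kappa> / of_real \<delta>) * cdot K (x t)) *s cvec (b t - b\<^sub>0)) \<le> (2 / \<delta> * (CK * (growth * norm (x 0)))) * \<tau>"
    proof (rule norm_scale_cvec_le)
      have "2 / \<delta> * (CK * norm (x t)) \<le> 2 / \<delta> * (CK * (growth * norm (x 0)))"
        using xb CK(1) \<delta> by (intro mult_left_mono) auto
      then show "cmod (- (\<kappa> / of_real \<delta>) * cdot K (x t)) \<le> 2 / \<delta> * (CK * (growth * norm (x 0)))"
        using norm_gain_le[of "x t"] by linarith
    qed (use \<tau>(2)[OF t] CK(1) \<delta> growth_pos in auto)
    moreover have "norm ((- (\<kappa> / of_real \<delta>) * cdot K (?e t)) *s cvec b\<^sub>0) \<le> (2 / \<delta> * (CK * norm (?e t))) * CB"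
      using norm_gain_le[of "?e t"] CB(2)[of 0] CK(1) \<delta> T_pos by (intro norm_scale_cvec_le) (auto simp: b\<^sub>0_def)
    ultimately show "norm (cmv (A t) (x t) + (- (\<kappa> / of_real \<delta>) * cdot K (x t)) *s cvec (b t) - (- (\<kappa> / of_real \<delta>) * cdot K (pulse_profile t)) *s cvec b\<^sub>0)
       \<le> 2 / \<delta> * CK * CB * norm (?e t) + ?m"
      unfolding eq by (intro norm_triangle_le[OF order_trans[OF add_left_mono[OF norm_triangle_ineq]]]) (simp add: algebra_simps)
  qed (use \<delta> CA CB CK t growth_pos \<tau> in auto)
  also have "\<dots> = ?m * t * exp (2 * CK * CB * (t / \<delta>))"
    by (simp add: pulse_profile_0)
  also have "\<dots> \<le> ((CA * growth + 2 * CK * growth) * \<tau> * norm (x 0)) * exp (2 * CK * CB)"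
  proof (rule mult_mono)
    \<comment> \<open>The factor \<open>\<delta>\<close> cancels the \<open>1 / \<delta>\<close> of
      the second forcing and supplies the smallness of the first.\<close>
    have "?m * t \<le> ?m * \<delta>"
      using t \<delta> \<tau>(1) CA(1) CK(1) growth_pos by (intro mult_left_mono) auto
    also have "\<dots> = (CA * growth * \<delta> + 2 * CK * growth * \<tau>) * norm (x 0)"
      using \<delta> by (simp add: field_simps)
    also have "\<dots> \<le> (CA * growth * \<tau> + 2 * CK * growth * \<tau>) * norm (x 0)"
      using \<tau>(1) CA(1) growth_pos by (intro mult_right_mono add_right_mono mult_left_mono) auto
    finally show "?m * t \<le> (CA * growth + 2 * CK * growth) * \<tau> * norm (x 0)"
      by (simp add: algebra_simps)
    have "2 * CK * CB * (t / \<delta>) \<le> 2 * CK * CB * 1"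
      using t \<delta> CB(1) CK(1) by (intro mult_left_mono) auto
    then show "exp (2 * CK * CB * (t / \<delta>)) \<le> exp (2 * CK * CB)" by simp
  qed (use \<delta> \<tau>(1) CA(1) CK(1) growth_pos in auto)
  finally show ?thesis by (simp add: closeness_def mult_ac)
qed

text \<open>Comparison with \<open>Y t\<close> applied to \<open>x \<delta>\<close> avoids inverting
  \<open>Y \<delta>\<close>: at time \<open>\<delta>\<close> the two curves differ by
  \<open>(Y \<delta> - I) x \<delta>\<close>, of order \<open>\<tau>\<close>, and afterwards both
  follow the free flow.\<close>

lemma feedback_solution_end_close:
  assumes CM: "0 \<le> CM" "\<And>(M :: real^'n^'n) z. norm (cmv M z) \<le> CM * norm M * norm z"
  shows "norm (x T - cmv P\<^sub>0 (pulse_profile \<delta>)) \<le> (CM * growth * exp (CA * T) + CM * norm P\<^sub>0 * closeness) * \<tau> * norm (x 0)"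
proof -
  let ?d = "\<lambda>t. x t - cmv (Y t) (x \<delta>)"
  have \<delta>T: "\<delta> \<in> {0..T}" "\<delta> \<in> {0..\<delta>}" using \<delta> by auto
  have Yd: "((\<lambda>t. cmv (Y t) (x \<delta>)) has_vector_derivative cmv (A t) (cmv (Y t) (x \<delta>))) (at t within {\<delta>..T})"
    if t: "t \<in> {\<delta>..T}" for t
  proof -
    have "(Y has_vector_derivative A t ** Y t) (at t within {\<delta>..T})"
      by (rule has_vector_derivative_within_subset[OF Y_deriv]) (use t \<delta> in auto)
    from bounded_bilinear.has_vector_derivative[OF bounded_bilinear_cmv this has_vector_derivative_const[of "x \<delta>"]]
    show ?thesis by (simp add: cmv_matrix_mult)
  qed
  have "norm (?d T) \<le> (norm (?d \<delta>) + 0 * (T - \<delta>)) * exp (CA * (T - \<delta>))"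
  proof (rule gronwall_norm[OF _ has_vector_derivative_diff[OF fb2 Yd]])
    fix t assume "t \<in> {\<delta>..T}"
    then show "norm (cmv (A t) (x t) - cmv (A t) (cmv (Y t) (x \<delta>))) \<le> CA * norm (?d t) + 0"
      using CA(2)[of t "?d t"] \<delta> by (simp add: bounded_bilinear.diff_right[OF bounded_bilinear_cmv])
  qed (use \<delta> CA in auto)
  also have "norm (?d \<delta>) \<le> CM * \<tau> * (growth * norm (x 0))"
  proof -
    have "?d \<delta> = - cmv (Y \<delta> - mat 1) (x \<delta>)"
      by (simp add: bounded_bilinear.diff_left[OF bounded_bilinear_cmv] cmv_mat_1)
    then have "norm (?d \<delta>) \<le> CM * norm (Y \<delta> - mat 1) * norm (x \<delta>)"
      using CM(2) by (metis norm_minus_cancel)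
    also have "\<dots> \<le> CM * \<tau> * (growth * norm (x 0))"
      using \<tau>(1,3) \<delta> CM(1) feedback_solution_bound[OF \<delta>T(1)] by (intro mult_mono mult_left_mono) auto
    finally show ?thesis .
  qed
  also have "exp (CA * (T - \<delta>)) \<le> exp (CA * T)"
    using \<delta> CA(1) by (simp add: mult_left_mono)
  finally have "norm (?d T) \<le> CM * \<tau> * (growth * norm (x 0)) * exp (CA * T)"
    using CM(1) \<tau>(1) \<delta> growth_pos by (simp add: mult_left_mono)
  moreover have "norm (cmv P\<^sub>0 (x \<delta>) - cmv P\<^sub>0 (pulse_profile \<delta>)) \<le> CM * norm P\<^sub>0 * (closeness * \<tau> * norm (x 0))"
  proof -
    have "norm (cmv P\<^sub>0 (x \<delta> - pulse_profile \<delta>)) \<le> CM * norm P\<^sub>0 * norm (x \<delta> - pulse_profile \<delta>)"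
      by (rule CM(2))
    also have "\<dots> \<le> CM * norm P\<^sub>0 * (closeness * \<tau> * norm (x 0))"
      using pulse_profile_close[OF \<delta>T(2)] CM(1) by (intro mult_left_mono) auto
    finally show ?thesis by (simp add: bounded_bilinear.diff_right[OF bounded_bilinear_cmv])
  qed
  moreover have "norm (x T - cmv P\<^sub>0 (pulse_profile \<delta>)) \<le> norm (?d T) + norm (cmv P\<^sub>0 (x \<delta>) - cmv P\<^sub>0 (pulse_profile \<delta>))"
    using norm_triangle_ineq[of "?d T" "cmv P\<^sub>0 (x \<delta>) - cmv P\<^sub>0 (pulse_profile \<delta>)"] by (simp add: P\<^sub>0_def)
  ultimately show ?thesis by (simp add: algebra_simps)
qed

text \<open>The derivative of the pairing carries the factor \<open>\<kappa> / \<delta>\<close>, so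
  dividing by \<open>\<kappa>\<close> before estimating leaves a bound that does not deteriorate as
  \<open>\<kappa>\<close> tends to 0. On the free piece the pairing is constant, and
  \<open>w T = w 0\<close> expresses its final value through \<open>w 0\<close>.\<close>

lemma feedback_solution_adjoint_close:
  assumes w: "adjoint_solution w" "w T = w 0" and "\<kappa> \<noteq> 0"
    and wb: "\<And>t. t \<in> {0..\<delta>} \<Longrightarrow> \<bar>w t \<bullet> b t - w 0 \<bullet> b\<^sub>0\<bar> \<le> \<tau>"
  shows "cmod ((cdot (w 0) (x T) - cdot (w 0) (x 0)) / \<kappa> + of_real (w 0 \<bullet> b\<^sub>0) * cdot K (x 0) * expm1_quot (\<kappa> * of_real (K \<bullet> b\<^sub>0)))
    \<le> (CK * growth + \<bar>w 0 \<bullet> b\<^sub>0\<bar> * (CK * closeness)) * \<tau> * norm (x 0)"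
proof -
  let ?\<omega> = "w 0 \<bullet> b\<^sub>0" and ?z = "\<kappa> * of_real (K \<bullet> b\<^sub>0)"
  let ?q = "\<lambda>t. cdot (w t) (x t)" and ?\<theta> = "\<lambda>t. of_real (t / \<delta>) * expm1_quot (?z * of_real (t / \<delta>))"
  let ?r = "\<lambda>t. ?q t / \<kappa> + of_real ?\<omega> * cdot K (x 0) * ?\<theta> t"
  let ?m = "(CK * growth + \<bar>?\<omega>\<bar> * (CK * closeness)) * \<tau> * norm (x 0) / \<delta>"
  have "norm (?r \<delta> - ?r 0) \<le> ?m * (\<delta> - 0)"
  proof (rule norm_increment_le)
    fix t assume t: "t \<in> {0..\<delta>}"
    then have t': "t \<in> {0..T}" using \<delta> by auto
    have wd: "(w has_vector_derivative - (transpose (A t) *v w t)) (at t within {0..\<delta>})"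
      by (rule has_vector_derivative_within_subset[of _ _ _ "{0..T}"])
        (use w t \<delta> in \<open>auto simp: adjoint_solution_def simp del: transpose_matrix_vector\<close>)
    show "(?r has_vector_derivative (- (\<kappa> / of_real \<delta>) * cdot K (x t)) * of_real (w t \<bullet> b t) / \<kappa>
        + of_real ?\<omega> * cdot K (x 0) * (exp (- (?z * of_real (t / \<delta>))) / of_real \<delta>)) (at t within {0..\<delta>})"
      by (intro has_vector_derivative_add has_vector_derivative_divide has_vector_derivative_mult_right
          theta_derivative adjoint_pairing[OF wd fb1[OF t]])
    \<comment> \<open>The profile cancels the leading term exactly; what remains is the drift of
      \<open>w t \<bullet> b t\<close> and the distance of \<open>x\<close> from the
      profile.\<close>
    have "(- (\<kappa> / of_real \<delta>) * cdot K (x t)) * of_real (w t \<bullet> b t) / \<kappa>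
        + of_real ?\<omega> * cdot K (x 0) * (exp (- (?z * of_real (t / \<delta>))) / of_real \<delta>)
      = - (cdot K (x t) * of_real (w t \<bullet> b t - ?\<omega>) + of_real ?\<omega> * cdot K (x t - pulse_profile t)) / of_real \<delta>"
      using \<open>\<kappa> \<noteq> 0\<close> \<delta> unfolding cdot_diff_right cdot_pulse_profile by (simp add: field_simps)
    also have "cmod \<dots> \<le> ((CK * (growth * norm (x 0))) * \<tau> + \<bar>?\<omega>\<bar> * (CK * (closeness * \<tau> * norm (x 0)))) / \<delta>"
    proof -
      have "cmod (cdot K (x t) * of_real (w t \<bullet> b t - ?\<omega>)) \<le> (CK * (growth * norm (x 0))) * \<tau>"
        unfolding norm_mult norm_of_real
        using wb[OF t] order_trans[OF CK(2) mult_left_mono[OF feedback_solution_bound[OF t'] CK(1)]] CK(1) growth_pos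
        by (intro mult_mono) auto
      moreover have "cmod (of_real ?\<omega> * cdot K (x t - pulse_profile t)) \<le> \<bar>?\<omega>\<bar> * (CK * (closeness * \<tau> * norm (x 0)))"
        unfolding norm_mult norm_of_real
        using order_trans[OF CK(2) mult_left_mono[OF pulse_profile_close[OF t] CK(1)]]
        by (intro mult_left_mono) auto
      ultimately have "cmod (cdot K (x t) * of_real (w t \<bullet> b t - ?\<omega>) + of_real ?\<omega> * cdot K (x t - pulse_profile t))
         \<le> (CK * (growth * norm (x 0))) * \<tau> + \<bar>?\<omega>\<bar> * (CK * (closeness * \<tau> * norm (x 0)))"
        by (rule norm_triangle_le[OF add_mono])
      then show ?thesis
        using \<delta> unfolding norm_divide norm_minus_cancel by (simp add: divide_right_mono)
    qed
    also have "\<dots> = ?m" by (simp add: algebra_simps)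
    finally show "cmod ((- (\<kappa> / of_real \<delta>) * cdot K (x t)) * of_real (w t \<bullet> b t) / \<kappa>
        + of_real ?\<omega> * cdot K (x 0) * (exp (- (?z * of_real (t / \<delta>))) / of_real \<delta>)) \<le> ?m" .
  qed (use \<delta> in auto)
  also have "?m * (\<delta> - 0) = (CK * growth + \<bar>?\<omega>\<bar> * (CK * closeness)) * \<tau> * norm (x 0)"
    using \<delta> by simp
  also have "?r \<delta> - ?r 0 = (cdot (w 0) (x T) - cdot (w 0) (x 0)) / \<kappa> + of_real ?\<omega> * cdot K (x 0) * expm1_quot ?z"
    using adjoint_pairing_free[OF \<delta> w(1) fb2] \<delta> w(2) by (simp add: diff_divide_distrib)
  finally show ?thesis .
qed

end
end
end
end

section \<open>Compactness argument for unstable multipliers\<close>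

lemma continuous_on_expm1_quot: "continuous_on S expm1_quot"
proof -
  have "isCont expm1_quot z" for z
  proof (cases "z = 0")
    case True
    have "((\<lambda>z. 1 - exp (- z)) has_field_derivative (1 :: complex)) (at 0)"
      by (auto intro!: derivative_eq_intros)
    then have "((\<lambda>z :: complex. (1 - exp (- z)) / z) \<longlongrightarrow> 1) (at 0)"
      by (simp add: has_field_derivative_iff)
    moreover have "\<forall>\<^sub>F z in at 0. (1 - exp (- z)) / z = expm1_quot z"
      by (auto simp: expm1_quot_def eventually_at_filter)
    ultimately have "(expm1_quot \<longlongrightarrow> 1) (at 0)"
      by (rule Lim_transform_eventually)
    then show ?thesis using True by (simp add: isCont_def expm1_quot_def)
  next
    case False
    have "isCont (\<lambda>z. (1 - exp (- z)) / z) z"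
      using False by (intro continuous_intros)
    moreover have "\<forall>\<^sub>F u in nhds z. expm1_quot u = (1 - exp (- u)) / u"
      using t1_space_nhds[OF False] by eventually_elim (simp add: expm1_quot_def)
    ultimately show ?thesis by (simp add: isCont_cong)
  qed
  then show ?thesis by (simp add: continuous_at_imp_continuous_on)
qed

text \<open>The zeros of \<open>expm1_quot\<close> are the nonzero multiples of
  \<open>2 \<pi> i\<close>. As \<open>k\<close> is real, a zero would put \<open>\<kappa>\<close> on
  the imaginary axis away from 0, where its distance from 1 exceeds 1.\<close>

lemma expm1_quot_nonzero:
  assumes "cmod (\<kappa> - 1) \<le> 1"
  shows "expm1_quot (\<kappa> * of_real k) \<noteq> 0"
proof
  assume 0: "expm1_quot (\<kappa> * of_real k) = 0"
  then have nz: "\<kappa> * of_real k \<noteq> 0" by (auto simp: expm1_quot_def)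
  have "exp (- (\<kappa> * of_real k)) = 1" using expm1_quot_mult[of "\<kappa> * of_real k"] 0 by simp
  then have "Re (- (\<kappa> * of_real k)) = 0" by (simp only: exp_eq_1)
  then have "Re \<kappa> = 0" using nz by simp
  then have "(cmod (\<kappa> - 1))\<^sup>2 = 1 + (Im \<kappa>)\<^sup>2" by (simp add: cmod_power2)
  moreover have "(cmod (\<kappa> - 1))\<^sup>2 \<le> 1\<^sup>2" using assms by (intro power_mono) auto
  ultimately have "Im \<kappa> = 0" by simp
  with \<open>Re \<kappa> = 0\<close> nz show False by (simp add: complex_eq_iff)
qed

context controlled_orbit
begin

lemma near_zero:
  assumes w: "adjoint_solution w" and "\<tau> > 0"
  obtains \<delta>\<^sub>0 where "\<delta>\<^sub>0 > 0" "\<And>\<delta>. \<delta> \<in> {0<..<\<delta>\<^sub>0} \<Longrightarrow> \<delta> < T \<Longrightarrow> \<delta> \<le> \<tau> \<and> norm (Y \<delta> - mat 1) \<le> \<tau> \<and>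
     (\<forall>t\<in>{0..\<delta>}. norm (b t - b\<^sub>0) \<le> \<tau> \<and> \<bar>w t \<bullet> b t - w 0 \<bullet> b\<^sub>0\<bar> \<le> \<tau>)"
proof -
  have contY: "continuous_on {0..T} Y" by (rule continuous_on_vector_derivative[OF Y_deriv])
  have contw: "continuous_on {0..T} w"
    using w unfolding adjoint_solution_def by (intro continuous_on_vector_derivative[of _ w]) blast
  have 0: "0 \<in> {0..T}" using T_pos by simp
  have ex: "\<exists>d>0. \<forall>t\<in>{0..T}. dist t 0 < d \<longrightarrow> dist (h t) (h 0) < \<tau>" if "continuous_on {0..T} h"
    for h :: "real \<Rightarrow> 'b::metric_space"
    using that 0 \<open>\<tau> > 0\<close> unfolding continuous_on_iff by blast
  obtain d1 where d1: "d1 > 0" "\<And>t. t \<in> {0..T} \<Longrightarrow> dist t 0 < d1 \<Longrightarrow> dist (Y t) (Y 0) < \<tau>"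
    using ex[OF contY] by blast
  obtain d2 where d2: "d2 > 0" "\<And>t. t \<in> {0..T} \<Longrightarrow> dist t 0 < d2 \<Longrightarrow> dist (b t) (b 0) < \<tau>"
    using ex[OF cont_b] by blast
  obtain d3 where d3: "d3 > 0" "\<And>t. t \<in> {0..T} \<Longrightarrow> dist t 0 < d3 \<Longrightarrow> dist (w t \<bullet> b t) (w 0 \<bullet> b 0) < \<tau>"
    using ex[OF continuous_on_inner[OF contw cont_b]] by blast
  show thesis
  proof (rule that[of "min \<tau> (min d1 (min d2 d3))"])
    fix \<delta> assume \<delta>: "\<delta> \<in> {0<..<min \<tau> (min d1 (min d2 d3))}" "\<delta> < T"
    have "norm (Y \<delta> - mat 1) \<le> \<tau>"
      using d1(2)[of \<delta>] \<delta> by (simp add: dist_norm Y_0)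
    moreover have "norm (b t - b\<^sub>0) \<le> \<tau> \<and> \<bar>w t \<bullet> b t - w 0 \<bullet> b\<^sub>0\<bar> \<le> \<tau>" if "t \<in> {0..\<delta>}" for t
      using d2(2)[of t] d3(2)[of t] \<delta> that by (simp add: dist_norm b\<^sub>0_def)
    ultimately show "\<delta> \<le> \<tau> \<and> norm (Y \<delta> - mat 1) \<le> \<tau> \<and>
     (\<forall>t\<in>{0..\<delta>}. norm (b t - b\<^sub>0) \<le> \<tau> \<and> \<bar>w t \<bullet> b t - w 0 \<bullet> b\<^sub>0\<bar> \<le> \<tau>)" using \<delta> by simp
  qed (use \<open>\<tau> > 0\<close> d1 d2 d3 in auto)
qed

lemma feedback_solution_scale:
  assumes "feedback_solution K \<kappa> \<delta> x"
  shows "feedback_solution K \<kappa> \<delta> (\<lambda>t. c *\<^sub>R x t)"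
proof -
  have eq: "c *\<^sub>R (z + d *s cvec p) = c *\<^sub>R z + (c *\<^sub>R d) *s cvec p" for z :: "complex^'n" and d p
    by (simp add: vec_eq_iff algebra_simps scaleR_conv_of_real[where 'a=complex])
  show ?thesis
    unfolding feedback_solution_def
  proof (intro conjI ballI)
    fix t assume "t \<in> {0..\<delta>}"
    then have "(x has_vector_derivative
         cmv (A t) (x t) + (- (\<kappa> / of_real \<delta>) * cdot K (x t)) *s cvec (b t)) (at t within {0..\<delta>})"
      using assms unfolding feedback_solution_def by blast
    from bounded_linear.has_vector_derivative[OF bounded_linear_scaleR_right[of c] this]
    show "((\<lambda>t. c *\<^sub>R x t) has_vector_derivative
         cmv (A t) (c *\<^sub>R x t) + (- (\<kappa> / of_real \<delta>) * cdot K (c *\<^sub>R x t)) *s cvec (b t)) (at t within {0..\<delta>})"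
      unfolding eq bounded_bilinear.scaleR_right[OF bounded_bilinear_cmv] bounded_bilinear.scaleR_right[OF bounded_bilinear_cdot] mult_scaleR_right .
  next
    fix t assume "t \<in> {\<delta>..T}"
    then have "(x has_vector_derivative cmv (A t) (x t)) (at t within {\<delta>..T})"
      using assms unfolding feedback_solution_def by blast
    from bounded_linear.has_vector_derivative[OF bounded_linear_scaleR_right[of c] this]
    show "((\<lambda>t. c *\<^sub>R x t) has_vector_derivative cmv (A t) (c *\<^sub>R x t)) (at t within {\<delta>..T})"
      unfolding bounded_bilinear.scaleR_right[OF bounded_bilinear_cmv] .
  qed
qed

context
  fixes K :: "real^'n" and w :: "real \<Rightarrow> real^'n"
  assumes K: "stabilising_gain P\<^sub>0 b\<^sub>0 K"
    and w: "adjoint_solution w" "w T = w 0" "w 0 \<bullet> b\<^sub>0 \<noteq> 0"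
begin

text \<open>The sum of the residuals of the limit relations: the eigenvalue equation, the pairing
  divided by \<open>\<kappa>\<close>, the definition of \<open>\<kappa>\<close>, and
  \<open>\<epsilon>\<close> itself. The third is cleared of its denominator and
  \<open>(\<mu> - 1) / \<kappa>\<close> is written as \<open>\<mu> - 1 + \<epsilon>\<close>, so that
  the sum is continuous also at \<open>\<mu> = 1\<close>, \<open>\<epsilon> = 0\<close>.\<close>

definition defect :: "(complex^'n) \<times> complex \<times> complex \<times> real \<Rightarrow> real" where
  "defect = (\<lambda>(v, \<kappa>, \<mu>, \<epsilon>).
     norm (\<mu> *s v - cmv P\<^sub>0 (v - (\<kappa> * expm1_quot (\<kappa> * of_real (K \<bullet> b\<^sub>0)) * cdot K v) *s cvec b\<^sub>0)) +
     cmod ((\<mu> - 1 + of_real \<epsilon>) * cdot (w 0) v + of_real (w 0 \<bullet> b\<^sub>0) * cdot K v * expm1_quot (\<kappa> * of_real (K \<bullet> b\<^sub>0))) +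
     cmod (\<kappa> * (\<mu> - 1 + of_real \<epsilon>) - (\<mu> - 1)) + \<epsilon>)"

lemma continuous_on_defect: "continuous_on S defect"
proof -
  have bil: "continuous_on S (\<lambda>p. u p *s v p)" if "continuous_on S u" "continuous_on S v"
    for u :: "(complex^'n) \<times> complex \<times> complex \<times> real \<Rightarrow> complex" and v :: "_ \<Rightarrow> complex^'n"
    unfolding vector_scalar_mult_def by (intro continuous_intros that)
  show ?thesis
    unfolding defect_def case_prod_beta
    by (intro continuous_intros bil bounded_bilinear.continuous_on[OF bounded_bilinear_cmv]
        bounded_bilinear.continuous_on[OF bounded_bilinear_cdot]
        continuous_on_compose2[OF continuous_on_expm1_quot[of UNIV]]) auto
qed

text \<open>At a zero of the defect \<open>\<epsilon> = 0\<close> and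
  \<open>(\<kappa> - 1) * (\<mu> - 1) = 0\<close>, which splits the limit configurations into the
  two cases.\<close>

lemma defect_pos:
  assumes "v \<noteq> 0" "cmod (\<kappa> - 1) \<le> 1" "cmod \<mu> \<ge> 1" "\<epsilon> \<ge> 0"
  shows "defect (v, \<kappa>, \<mu>, \<epsilon>) > 0"
proof (rule ccontr)
  assume "\<not> defect (v, \<kappa>, \<mu>, \<epsilon>) > 0"
  then have le: "norm (\<mu> *s v - cmv P\<^sub>0 (v - (\<kappa> * expm1_quot (\<kappa> * of_real (K \<bullet> b\<^sub>0)) * cdot K v) *s cvec b\<^sub>0)) +
     cmod ((\<mu> - 1 + of_real \<epsilon>) * cdot (w 0) v + of_real (w 0 \<bullet> b\<^sub>0) * cdot K v * expm1_quot (\<kappa> * of_real (K \<bullet> b\<^sub>0))) +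
     cmod (\<kappa> * (\<mu> - 1 + of_real \<epsilon>) - (\<mu> - 1)) + \<epsilon> \<le> 0"
    unfolding defect_def by simp
  have nn: "a = 0 \<and> b = 0 \<and> c = 0 \<and> d = 0"
    if "a + b + c + d \<le> 0" "a \<ge> 0" "b \<ge> 0" "c \<ge> 0" "d \<ge> 0" for a b c d :: real
    using that by linarith
  have *: "norm (\<mu> *s v - cmv P\<^sub>0 (v - (\<kappa> * expm1_quot (\<kappa> * of_real (K \<bullet> b\<^sub>0)) * cdot K v) *s cvec b\<^sub>0)) = 0 \<and>
     cmod ((\<mu> - 1 + of_real \<epsilon>) * cdot (w 0) v + of_real (w 0 \<bullet> b\<^sub>0) * cdot K v * expm1_quot (\<kappa> * of_real (K \<bullet> b\<^sub>0))) = 0 \<and>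
     cmod (\<kappa> * (\<mu> - 1 + of_real \<epsilon>) - (\<mu> - 1)) = 0 \<and> \<epsilon> = 0"
    by (rule nn[OF le norm_ge_zero norm_ge_zero norm_ge_zero assms(4)])
  then have e: "\<epsilon> = 0" by blast
  from * have 1: "\<mu> *s v = cmv P\<^sub>0 (v - (\<kappa> * expm1_quot (\<kappa> * of_real (K \<bullet> b\<^sub>0)) * cdot K v) *s cvec b\<^sub>0)"
    by simp
  from * have 2: "(\<mu> - 1) * cdot (w 0) v + of_real (w 0 \<bullet> b\<^sub>0) * cdot K v * expm1_quot (\<kappa> * of_real (K \<bullet> b\<^sub>0)) = 0"
    unfolding e by simp
  from * have 3: "\<kappa> * (\<mu> - 1) - (\<mu> - 1) = 0"
    unfolding e by (simp only: of_real_0 add_0_right norm_eq_zero)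
  have "cmv P\<^sub>0 (v - (expm1_quot (of_real (K \<bullet> b\<^sub>0)) * cdot K v) *s cvec b\<^sub>0) = \<mu> *s v"
  proof (cases "\<mu> = 1")
    case True
    then have "cdot K v = 0" using 2 w(3) expm1_quot_nonzero[OF assms(2)] by simp
    then show ?thesis using 1 by simp
  next
    case False
    moreover have "(\<kappa> - 1) * (\<mu> - 1) = 0" using 3 by (simp add: algebra_simps)
    ultimately have "\<kappa> = 1" by simp
    then show ?thesis using 1 by simp
  qed
  then have "cmod \<mu> < 1" by (rule stabilising_gainD[OF K assms(1)])
  with assms(3) show False by simp
qed

text \<open>Unit vectors, the closed disc for \<open>\<kappa>\<close>, a closed annulus for
  \<open>\<mu>\<close> and the closed unit interval for \<open>\<epsilon>\<close> form a compact
  set. Including \<open>\<epsilon> = 0\<close> makes the bound uniform for small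
  \<open>\<epsilon>\<close>.\<close>

lemma defect_lower_bound:
  obtains m where "m > 0"
    "\<And>v \<kappa> \<mu> \<epsilon>. norm v = 1 \<Longrightarrow> cmod (\<kappa> - 1) \<le> 1 \<Longrightarrow> 1 \<le> cmod \<mu> \<Longrightarrow> cmod \<mu> \<le> R \<Longrightarrow> \<epsilon> \<in> {0..1} \<Longrightarrow> m \<le> defect (v, \<kappa>, \<mu>, \<epsilon>)"
proof -
  let ?S = "sphere (0 :: complex^'n) 1 \<times> cball (1 :: complex) 1 \<times> (cball (0 :: complex) R - ball 0 1) \<times> {0..1 :: real}"
  have comp: "compact ?S" by (intro compact_Times compact_diff) simp_all
  have mem: "(v, \<kappa>, \<mu>, \<epsilon>) \<in> ?S" if "norm v = 1" "cmod (\<kappa> - 1) \<le> 1" "1 \<le> cmod \<mu>" "cmod \<mu> \<le> R" "\<epsilon> \<in> {0..1}" for v \<kappa> \<mu> \<epsilon>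
    using that by (simp add: dist_norm norm_minus_commute)
  show thesis
  \<comment> \<open>The annulus is empty for \<open>R < 1\<close>; any positive constant serves in
    the empty case.\<close>
  proof (cases "?S = {}")
    case True
    show thesis
    proof (rule that[of 1])
      show "1 \<le> defect (v, \<kappa>, \<mu>, \<epsilon>)"
        if "norm v = 1" "cmod (\<kappa> - 1) \<le> 1" "1 \<le> cmod \<mu>" "cmod \<mu> \<le> R" "\<epsilon> \<in> {0..1}" for v \<kappa> \<mu> \<epsilon>
        using mem[OF that] unfolding True by simp
    qed simp
  next
    case False
    obtain p where p: "p \<in> ?S" "\<And>q. q \<in> ?S \<Longrightarrow> defect p \<le> defect q"
      using continuous_attains_inf[OF comp False continuous_on_defect] by blast
    obtain v \<kappa> \<mu> \<epsilon> where pe: "p = (v, \<kappa>, \<mu>, \<epsilon>)" by (cases p)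
    have "norm v = 1 \<and> cmod (\<kappa> - 1) \<le> 1 \<and> cmod \<mu> \<ge> 1 \<and> \<epsilon> \<ge> 0"
      using p(1) unfolding pe by (simp add: dist_norm norm_minus_commute[of 1])
    then have "v \<noteq> 0" "cmod (\<kappa> - 1) \<le> 1" "cmod \<mu> \<ge> 1" "\<epsilon> \<ge> 0" by auto
    then have "defect p > 0" unfolding pe by (rule defect_pos)
    then show thesis by (rule that) (rule p(2)[OF mem])
  qed
qed

lemma defect_upper_bound:
  obtains C R where "C \<ge> 0"
    "\<And>\<tau> \<epsilon> \<delta> \<mu>. \<lbrakk>0 < \<delta>; \<delta> < T; \<delta> \<le> \<tau>; norm (Y \<delta> - mat 1) \<le> \<tau>;
       \<forall>t\<in>{0..\<delta>}. norm (b t - b\<^sub>0) \<le> \<tau> \<and> \<bar>w t \<bullet> b t - w 0 \<bullet> b\<^sub>0\<bar> \<le> \<tau>;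
       0 < \<epsilon>; \<epsilon> < 1; \<epsilon> \<le> \<tau>; \<mu> \<in> floquet_multipliers f xs T \<epsilon> \<delta> K; \<mu> \<noteq> 1; cmod \<mu> \<ge> 1\<rbrakk> \<Longrightarrow>
       \<exists>v \<kappa>. norm v = 1 \<and> cmod (\<kappa> - 1) \<le> 1 \<and> cmod \<mu> \<le> R \<and> defect (v, \<kappa>, \<mu>, \<epsilon>) \<le> C * \<tau>"
proof -
  obtain CA where CA: "CA > 0" "\<And>t x :: complex^'n. t \<in> {0..T} \<Longrightarrow> norm (cmv (A t) x) \<le> CA * norm x"
    using bounded_bilinear_uniform_bound[OF bounded_bilinear_cmv compact_Icc cont_A] by metis
  obtain CB where CB: "CB > 0" "\<And>t. t \<in> {0..T} \<Longrightarrow> norm (b t) \<le> CB"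
    using compact_imp_bounded[OF compact_continuous_image[OF cont_b compact_Icc[of 0 T]]]
    unfolding bounded_pos by blast
  obtain CK where CK: "CK \<ge> 0" "\<And>x. cmod (cdot K x) \<le> CK * norm x"
    using cdot_bound[of K] by blast
  obtain CM where "0 \<le> CM" and CM': "\<And>(M :: real^'n^'n) z. norm (cmv M z) \<le> norm M * norm z * CM"
    using bounded_bilinear.nonneg_bounded[OF bounded_bilinear_cmv] by blast
  have CM: "0 \<le> CM" "norm (cmv M z) \<le> CM * norm M * norm z" for M :: "real^'n^'n" and z
    using \<open>0 \<le> CM\<close> CM'[of M z] by (simp_all add: mult_ac)
  note bnds = less_imp_le[OF CA(1)] CA(2) less_imp_le[OF CB(1)] CB(2) CK
  let ?g = "growth CA CB CK" and ?c = "closeness CA CB CK"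
  note gpos = growth_pos[OF bnds] closeness_nonneg[OF bnds]
  define C1 where "C1 = CM * ?g * exp (CA * T) + CM * norm P\<^sub>0 * ?c"
  define C2 where "C2 = CK * ?g + \<bar>w 0 \<bullet> b\<^sub>0\<bar> * (CK * ?c)"
  have "C1 \<ge> 0" "C2 \<ge> 0"
    using gpos CM(1) CK(1) by (auto simp: C1_def C2_def intro!: add_nonneg_nonneg mult_nonneg_nonneg)
  \<comment> \<open>The first two residuals are bounded by \<open>C1 * \<tau>\<close> and
    \<open>C2 * \<tau>\<close>, the third is 0, and the summand 1 accounts for
    \<open>\<epsilon> \<le> \<tau>\<close>. The bound for \<open>cmod \<mu>\<close> is the growth
    over one period of a solution with \<open>norm (x 0) = 1\<close>.\<close>
  show thesis
  proof (rule that[of "C1 + C2 + 1" ?g])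
    show "C1 + C2 + 1 \<ge> 0" using \<open>C1 \<ge> 0\<close> \<open>C2 \<ge> 0\<close> by simp
    fix \<tau> \<epsilon> \<delta> :: real and \<mu> :: complex
    assume \<delta>: "0 < \<delta>" "\<delta> < T" and \<tau>: "\<delta> \<le> \<tau>" "norm (Y \<delta> - mat 1) \<le> \<tau>"
      "\<forall>t\<in>{0..\<delta>}. norm (b t - b\<^sub>0) \<le> \<tau> \<and> \<bar>w t \<bullet> b t - w 0 \<bullet> b\<^sub>0\<bar> \<le> \<tau>"
      and \<epsilon>: "0 < \<epsilon>" "\<epsilon> < 1" "\<epsilon> \<le> \<tau>"
      and \<mu>: "\<mu> \<in> floquet_multipliers f xs T \<epsilon> \<delta> K" "\<mu> \<noteq> 1" "cmod \<mu> \<ge> 1"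
    define d where "d = \<mu> - 1 + of_real \<epsilon>"
    \<comment> \<open>Outside the open unit disc \<mu> keeps distance at least \<epsilon> from
      \<open>1 - \<epsilon>\<close>; since \<open>\<kappa> - 1 = - \<epsilon> / d\<close>, this
      confines \<open>\<kappa>\<close> to its disc.\<close>
    have d_ge: "cmod d \<ge> \<epsilon>"
    proof -
      have "cmod \<mu> \<le> cmod d + cmod (of_real (1 - \<epsilon>))"
        using norm_triangle_ineq[of d "of_real (1 - \<epsilon>)"] by (simp add: d_def)
      moreover have "cmod (of_real (1 - \<epsilon>)) = 1 - \<epsilon>" using \<epsilon> by (simp only: norm_of_real)
      ultimately show ?thesis using \<mu>(3) by linarith
    qed
    then have "d \<noteq> 0" using \<epsilon>(1) by auto
    define \<kappa> where "\<kappa> = (\<mu> - 1) / d"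
    have "\<kappa> - 1 = - of_real \<epsilon> / d"
      using \<open>d \<noteq> 0\<close> by (simp add: \<kappa>_def d_def divide_simps)
    then have "cmod (\<kappa> - 1) = \<epsilon> / cmod d" using \<epsilon>(1) by (simp add: norm_divide)
    then have \<kappa>1: "cmod (\<kappa> - 1) \<le> 1" using d_ge \<epsilon>(1) by (simp add: divide_le_eq)
    have \<kappa>2: "cmod \<kappa> \<le> 2" using \<kappa>1 norm_triangle_ineq[of "\<kappa> - 1" 1] by simp
    have "\<kappa> \<noteq> 0" using \<mu>(2) \<open>d \<noteq> 0\<close> by (simp add: \<kappa>_def)
    obtain x' where x': "feedback_solution K \<kappa> \<delta> x'" "x' 0 \<noteq> 0" "x' T = \<mu> *s x' 0"
      using floquet_multiplier_feedback_solution[OF \<delta> \<mu>(1)] \<open>d \<noteq> 0\<close> unfolding \<kappa>_def d_def by blast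
    define x where "x t = (1 / norm (x' 0)) *\<^sub>R x' t" for t
    have fb: "feedback_solution K \<kappa> \<delta> x"
      unfolding x_def[abs_def] by (rule feedback_solution_scale[OF x'(1)])
    have x0: "norm (x 0) = 1" using x'(2) by (simp add: x_def)
    have xT: "x T = \<mu> *s x 0" by (simp add: x_def x'(3) vec_eq_iff)
    have \<tau>1: "norm (b t - b\<^sub>0) \<le> \<tau>" and \<tau>2: "\<bar>w t \<bullet> b t - w 0 \<bullet> b\<^sub>0\<bar> \<le> \<tau>" if "t \<in> {0..\<delta>}" for t
      using \<tau>(3) that by auto
    have "cmod \<mu> \<le> ?g"
      using feedback_solution_bound[OF bnds fb \<delta> \<kappa>2, of T] T_pos x0 by (simp add: xT norm_scale_vec)
    moreover have "norm (\<mu> *s x 0 - cmv P\<^sub>0 (x 0 - (\<kappa> * expm1_quot (\<kappa> * of_real (K \<bullet> b\<^sub>0)) * cdot K (x 0)) *s cvec b\<^sub>0)) \<le> C1 * \<tau>"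
    proof -
      have "norm (x T - cmv P\<^sub>0 (pulse_profile K \<kappa> \<delta> x \<delta>)) \<le> C1 * \<tau> * norm (x 0)"
        unfolding C1_def by (rule feedback_solution_end_close[OF bnds fb \<delta> \<kappa>2 \<tau>(1) \<tau>1 \<tau>(2) CM])
      moreover have "pulse_profile K \<kappa> \<delta> x \<delta> = x 0 - (\<kappa> * expm1_quot (\<kappa> * of_real (K \<bullet> b\<^sub>0)) * cdot K (x 0)) *s cvec b\<^sub>0"
        by (rule pulse_profile_\<delta>[OF bnds fb \<delta> \<kappa>2])
      ultimately show ?thesis unfolding xT x0 by simp
    qed
    moreover have "cmod (d * cdot (w 0) (x 0) + of_real (w 0 \<bullet> b\<^sub>0) * cdot K (x 0) * expm1_quot (\<kappa> * of_real (K \<bullet> b\<^sub>0))) \<le> C2 * \<tau>"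
    proof -
      have "(cdot (w 0) (x T) - cdot (w 0) (x 0)) / \<kappa> = d * cdot (w 0) (x 0)"
        using \<open>d \<noteq> 0\<close> \<mu>(2) by (simp add: xT cdot_scale_right \<kappa>_def field_simps)
      then show ?thesis
        using feedback_solution_adjoint_close[OF bnds fb \<delta> \<kappa>2 \<tau>(1) \<tau>1 \<tau>(2) w(1,2) \<open>\<kappa> \<noteq> 0\<close> \<tau>2] x0 by (simp add: C2_def)
    qed
    moreover have "\<kappa> * d - (\<mu> - 1) = 0" using \<open>d \<noteq> 0\<close> by (simp add: \<kappa>_def)
    ultimately show "\<exists>v \<kappa>. norm v = 1 \<and> cmod (\<kappa> - 1) \<le> 1 \<and> cmod \<mu> \<le> ?g \<and> defect (v, \<kappa>, \<mu>, \<epsilon>) \<le> (C1 + C2 + 1) * \<tau>"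
      using x0 \<kappa>1 \<epsilon>(3) unfolding d_def by (intro exI[of _ "x 0"] exI[of _ \<kappa>]) (simp add: defect_def algebra_simps)
  qed
qed

lemma unstable_multiplier_eq_1:
  obtains \<epsilon>\<^sub>0 \<delta>\<^sub>0 where "\<epsilon>\<^sub>0 > 0" "\<delta>\<^sub>0 > 0"
    "\<And>\<epsilon> \<delta> \<mu>. \<lbrakk>\<epsilon> \<in> {0<..<\<epsilon>\<^sub>0}; \<delta> \<in> {0<..<\<delta>\<^sub>0}; \<delta> < T; \<mu> \<in> floquet_multipliers f xs T \<epsilon> \<delta> K; \<mu> \<noteq> 1\<rbrakk> \<Longrightarrow> cmod \<mu> < 1"
proof -
  obtain C R where "C \<ge> 0" and upper: "\<And>\<tau> \<epsilon> \<delta> \<mu>. \<lbrakk>0 < \<delta>; \<delta> < T; \<delta> \<le> \<tau>; norm (Y \<delta> - mat 1) \<le> \<tau>;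
       \<forall>t\<in>{0..\<delta>}. norm (b t - b\<^sub>0) \<le> \<tau> \<and> \<bar>w t \<bullet> b t - w 0 \<bullet> b\<^sub>0\<bar> \<le> \<tau>;
       0 < \<epsilon>; \<epsilon> < 1; \<epsilon> \<le> \<tau>; \<mu> \<in> floquet_multipliers f xs T \<epsilon> \<delta> K; \<mu> \<noteq> 1; cmod \<mu> \<ge> 1\<rbrakk> \<Longrightarrow>
       \<exists>v \<kappa>. norm v = 1 \<and> cmod (\<kappa> - 1) \<le> 1 \<and> cmod \<mu> \<le> R \<and> defect (v, \<kappa>, \<mu>, \<epsilon>) \<le> C * \<tau>"
    using defect_upper_bound by blast
  obtain m where "m > 0" and lower: "\<And>v \<kappa> \<mu> \<epsilon>. norm v = 1 \<Longrightarrow> cmod (\<kappa> - 1) \<le> 1 \<Longrightarrow> 1 \<le> cmod \<mu> \<Longrightarrow> cmod \<mu> \<le> R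
      \<Longrightarrow> \<epsilon> \<in> {0..1} \<Longrightarrow> m \<le> defect (v, \<kappa>, \<mu>, \<epsilon>)"
    using defect_lower_bound[of R] by blast
  \<comment> \<open>Chosen so that the upper bound \<open>C * \<tau>\<close> stays below the lower
    bound \<open>m\<close>; \<open>C\<close> may be 0, hence \<open>C + 1\<close>.\<close>
  define \<tau> where "\<tau> = m / (2 * (C + 1))"
  have "\<tau> > 0" using \<open>m > 0\<close> \<open>C \<ge> 0\<close> by (simp add: \<tau>_def)
  have "C * \<tau> < (C + 1) * \<tau>" using \<open>\<tau> > 0\<close> by simp
  also have "\<dots> = m / 2" using \<open>C \<ge> 0\<close> by (simp add: \<tau>_def field_simps)
  finally have "C * \<tau> < m" using \<open>m > 0\<close> by simp
  obtain \<delta>\<^sub>0 where "\<delta>\<^sub>0 > 0" and \<delta>\<^sub>0: "\<And>\<delta>. \<delta> \<in> {0<..<\<delta>\<^sub>0} \<Longrightarrow> \<delta> < T \<Longrightarrow> \<delta> \<le> \<tau> \<and> norm (Y \<delta> - mat 1) \<le> \<tau> \<and>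
     (\<forall>t\<in>{0..\<delta>}. norm (b t - b\<^sub>0) \<le> \<tau> \<and> \<bar>w t \<bullet> b t - w 0 \<bullet> b\<^sub>0\<bar> \<le> \<tau>)"
    using near_zero[OF w(1) \<open>\<tau> > 0\<close>] by blast
  show thesis
  proof (rule that[of "min 1 \<tau>" \<delta>\<^sub>0])
    fix \<epsilon> \<delta> \<mu>
    assume \<epsilon>: "\<epsilon> \<in> {0<..<min 1 \<tau>}" and \<delta>: "\<delta> \<in> {0<..<\<delta>\<^sub>0}" "\<delta> < T"
      and \<mu>: "\<mu> \<in> floquet_multipliers f xs T \<epsilon> \<delta> K" "\<mu> \<noteq> 1"
    show "cmod \<mu> < 1"
    proof (rule ccontr)
      assume "\<not> cmod \<mu> < 1"
      then have \<mu>1: "cmod \<mu> \<ge> 1" by simp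
      obtain v \<kappa> where "norm v = 1" "cmod (\<kappa> - 1) \<le> 1" "cmod \<mu> \<le> R" "defect (v, \<kappa>, \<mu>, \<epsilon>) \<le> C * \<tau>"
        using upper[of \<delta> \<tau> \<epsilon> \<mu>] \<delta> \<delta>\<^sub>0[OF \<delta>] \<epsilon> \<mu> \<mu>1 by auto
      with lower[of v \<kappa> \<mu> \<epsilon>] \<mu>1 \<epsilon> \<open>C * \<tau> < m\<close> show False by auto
    qed
  qed (use \<open>\<tau> > 0\<close> \<open>\<delta>\<^sub>0 > 0\<close> in auto)
qed

end
end

section \<open>The trivial multiplier\<close>

lemma hscale_1: "hscale 1 \<phi> = \<phi>"
  by (simp add: hscale_def)

context controlled_orbit
begin

text \<open>The eigenfunction for the multiplier 1: both components coincide, so the feedback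
  vanishes on it.\<close>

definition velocity_history :: "'n history" where
  "velocity_history t = (if t \<in> {-T..0} then (cvec (velocity t), cvec (velocity t)) else 0)"

lemma velocity_plus_T: "velocity (t + T) = velocity t"
  using velocity_periodic[of t 1] by simp

lemma cvec_velocity_deriv:
  "((\<lambda>t. c *s cvec (velocity t)) has_vector_derivative cmv (A t) (c *s cvec (velocity t))) (at t within S)"
proof -
  have "((\<lambda>t. c *s cvec (velocity t)) has_vector_derivative c *s cvec (A t *v velocity t)) (at t within S)"
    using bounded_bilinear.has_vector_derivative[OF bounded_bilinear_scale_cvec has_vector_derivative_const[of c] velocity_deriv]
    by simp
  moreover have "cmv (A t) (c *s cvec (velocity t)) = c *s cvec (A t *v velocity t)"
    by (simp add: vector_scalar_commute flip: cmv_cvec)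
  ultimately show ?thesis by simp
qed

lemma continuous_on_cvec_velocity: "continuous_on S (\<lambda>t. c *s cvec (velocity t))"
  by (rule continuous_on_vector_derivative[OF cvec_velocity_deriv])

lemma velocity_history_phase_space: "hscale c velocity_history \<in> phase_space T \<epsilon>"
proof -
  have "continuous_on {-T..0} (\<lambda>t. (c *s cvec (velocity t), c *s cvec (velocity t)))"
    by (intro continuous_intros continuous_on_cvec_velocity)
  then have "continuous_on {-T..0} (hscale c velocity_history)"
    by (rule continuous_on_eq) (simp add: hscale_def velocity_history_def)
  moreover have "velocity (-T) = velocity 0"
    using velocity_plus_T[of "-T"] by simp
  ultimately show ?thesis
    using T_pos by (auto simp: phase_space_def hscale_def velocity_history_def algebra_simps zero_prod_def)
qed

lemma velocity_history_nonzero: "velocity_history \<noteq> 0"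
proof
  assume "velocity_history = 0"
  then have "velocity_history 0 = 0" by simp
  then have "cvec (velocity 0) = 0" using T_pos by (simp add: velocity_history_def zero_prod_def)
  then have "velocity 0 = 0" by (simp add: vec_eq_iff cvec_def)
  with velocity_nonzero show False ..
qed

context
  fixes \<epsilon> \<delta> :: real and K :: "real^'n"
  assumes \<delta>: "0 < \<delta>" "\<delta> < T"
begin

text \<open>Treating all multiples at once dispenses with a proof that the time-\<open>T\<close> map
  is linear; the case \<open>c = 0\<close> gives its value at 0.\<close>

lemma time_T_map_velocity_history:
  "time_T_map f xs T \<epsilon> \<delta> K (hscale c velocity_history) = hscale c velocity_history"
proof -
  let ?x = "\<lambda>t. c *s cvec (velocity t)"
  have \<phi>: "hscale c velocity_history \<in> phase_space T \<epsilon>" by (rule velocity_history_phase_space)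
  have "is_solution \<epsilon> \<delta> K ?x ?x"
    unfolding is_solution_def using cvec_velocity_deriv by (simp add: cdot_sum)
  then have "linearised_solution f xs T \<epsilon> \<delta> K (hscale c velocity_history) ?x ?x"
  proof (rule linearised_solutionI[OF \<delta> \<phi>])
    show "(?x t, ?x t) = hscale c velocity_history t" if "t \<in> {-T..0}" for t
      using that by (simp add: hscale_def velocity_history_def)
    show "?x t = delayed \<epsilon> (hscale c velocity_history) t" if "t \<in> {0..T}" for t
      using that velocity_plus_T[of "t - T"] unfolding delayed_def[OF \<delta> \<phi>]
      by (simp add: hscale_def velocity_history_def algebra_simps)
  qed
  from time_T_map_eq[OF \<delta> \<phi> this] show ?thesis
    by (auto simp: fun_eq_iff shift_back_def hscale_def velocity_history_def velocity_plus_T zero_prod_def)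
qed

context
  assumes \<epsilon>: "\<epsilon> > 0"
    and K: "stabilising_gain P\<^sub>0 b\<^sub>0 K"
begin

text \<open>On the kernel of \<open>K^T\<close> the feedback has no effect, so a nonzero
  \<open>v\<close> would be an eigenvector of the stabilised matrix for the eigenvalue 1.\<close>

lemma uncontrolled_kernel:
  assumes "cmv P\<^sub>0 v = v" "cdot K v = 0" shows "v = 0"
proof (rule ccontr)
  assume "v \<noteq> 0"
  then have "cmod 1 < 1" by (rule stabilising_gainD[OF K]) (simp add: assms)
  then show False by simp
qed

lemma K_velocity_nonzero: "K \<bullet> velocity 0 \<noteq> 0"
proof
  assume "K \<bullet> velocity 0 = 0"
  then have "cvec (velocity 0) = 0"
    by (intro uncontrolled_kernel) (simp_all only: cmv_cvec P\<^sub>0_velocity cdot_cvec of_real_0)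
  then have "velocity 0 = 0" by (simp add: vec_eq_iff cvec_def)
  with velocity_nonzero show False ..
qed

text \<open>A fixed history has \<open>xt = x\<close> because \<open>\<epsilon> > 0\<close>, so the
  feedback vanishes and \<open>x\<close> follows the free flow with \<open>x T = x 0\<close>.
  Removing a suitable multiple of the velocity puts the initial value into the kernel of
  \<open>K^T\<close>, where \<open>P\<^sub>0\<close> fixes only 0.\<close>

lemma fixed_point_velocity_history:
  assumes \<phi>: "\<phi> \<in> phase_space T \<epsilon>" and fix1: "time_T_map f xs T \<epsilon> \<delta> K \<phi> = \<phi>"
  obtains c where "\<phi> = hscale c velocity_history"
proof -
  obtain x xt where sol: "linearised_solution f xs T \<epsilon> \<delta> K \<phi> x xt"
    and U: "time_T_map f xs T \<epsilon> \<delta> K \<phi> = shift_back T x xt"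
    using time_T_map_obtain[OF \<delta> \<phi>] by blast
  have shift: "x t = fst (\<phi> (t - T))" "xt t = snd (\<phi> (t - T))" if "t \<in> {0..T}" for t
    using fun_cong[OF trans[OF U[symmetric] fix1], of "t - T"] that by (auto simp: shift_back_def prod_eq_iff)
  have xt: "xt t = x t" if t: "t \<in> {0..T}" for t
  proof -
    have "\<epsilon> *\<^sub>R xt t = \<epsilon> *\<^sub>R x t"
      using linearised_solution_delayed[OF \<delta> \<phi> sol t] shift[OF t]
      by (simp add: delayed_def[OF \<delta> \<phi>] algebra_simps)
    then show ?thesis using \<epsilon> by simp
  qed
  define c where "c = cdot K (x 0) / of_real (K \<bullet> velocity 0)"
  define z where "z t = x t - c *s cvec (velocity t)" for t
  have z1: "(z has_vector_derivative rhs 0 0 (\<lambda>_. 0) t (z t)) (at t within {0..\<delta>})" if t: "t \<in> {0..\<delta>}" for t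
  proof -
    have "(x has_vector_derivative cmv (A t) (x t) + (of_real (1 / \<delta>) * cdot K (xt t - x t)) *s cvec (b t)) (at t within {0..\<delta>})"
      using linearised_solution_is_solution[OF \<delta> \<phi> sol] t unfolding is_solution_def by blast
    moreover have "xt t = x t" using t \<delta> by (intro xt) auto
    ultimately have "(x has_vector_derivative cmv (A t) (x t)) (at t within {0..\<delta>})"
      by (simp add: cdot_sum)
    from has_vector_derivative_diff[OF this cvec_velocity_deriv]
    show ?thesis unfolding z_def[abs_def] rhs_def
      by (simp add: cdot_sum bounded_bilinear.diff_right[OF bounded_bilinear_cmv])
  qed
  have z2: "(z has_vector_derivative rhs 0 0 (\<lambda>_. 0) t (z t)) (at t within {\<delta>..T})" if t: "t \<in> {\<delta>..T}" for t
  proof -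
    have "(x has_vector_derivative cmv (A t) (x t)) (at t within {\<delta>..T})"
      using linearised_solution_is_solution[OF \<delta> \<phi> sol] t unfolding is_solution_def by blast
    from has_vector_derivative_diff[OF this cvec_velocity_deriv]
    show ?thesis unfolding z_def[abs_def] rhs_def
      by (simp add: cdot_sum bounded_bilinear.diff_right[OF bounded_bilinear_cmv])
  qed
  have Yz: "((\<lambda>t. cmv (Y t) v) has_vector_derivative rhs 0 0 (\<lambda>_. 0) t (cmv (Y t) v)) (at t within S)"
    if "t \<in> S" "S \<subseteq> {0..T}" for t S v
  proof -
    have "(Y has_vector_derivative A t ** Y t) (at t within S)"
      by (rule has_vector_derivative_within_subset[OF Y_deriv]) (use that in auto)
    from bounded_bilinear.has_vector_derivative[OF bounded_bilinear_cmv this has_vector_derivative_const[of v]]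
    show ?thesis by (simp add: cmv_matrix_mult rhs_def)
  qed
  have zY1: "z t = cmv (Y t) (z 0)" if "t \<in> {0..\<delta>}" for t
    by (rule rhs_unique[OF less_imp_le[OF \<delta>(1)] z1 Yz _ that]) (use \<delta> in \<open>auto simp: Y_0 cmv_mat_1\<close>)
  have zY2: "z t = cmv (Y t) (z 0)" if "t \<in> {\<delta>..T}" for t
    by (rule rhs_unique[OF less_imp_le[OF \<delta>(2)] z2 Yz _ that]) (use \<delta> zY1[of \<delta>] in auto)
  have "x T = x 0"
    using shift(1)[of T] T_pos linearised_solution_initial[OF \<delta> \<phi> sol] by simp
  then have "z T = z 0" using velocity_plus_T[of 0] by (simp add: z_def)
  then have "cmv P\<^sub>0 (z 0) = z 0" using zY2[of T] \<delta> by (simp add: P\<^sub>0_def)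
  moreover have "cdot K (z 0) = 0"
    unfolding z_def cdot_diff_right cdot_scale_right cdot_cvec using K_velocity_nonzero by (simp add: c_def)
  ultimately have z0: "z 0 = 0" by (rule uncontrolled_kernel)
  have "x t = c *s cvec (velocity t)" if "t \<in> {0..T}" for t
  proof -
    have "z t = 0" using zY1[of t] zY2[of t] that z0 by (cases "t \<le> \<delta>") auto
    then show ?thesis by (simp add: z_def)
  qed
  then have \<phi>x: "\<phi> (t - T) = (c *s cvec (velocity t), c *s cvec (velocity t))" if "t \<in> {0..T}" for t
    using shift[OF that] xt[OF that] that by (simp add: prod_eq_iff)
  have "\<phi> t = hscale c velocity_history t" for t
  proof (cases "t \<in> {-T..0}")
    case True
    then show ?thesis
      using \<phi>x[of "t + T"] by (simp add: hscale_def velocity_history_def velocity_plus_T)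
  next
    case False
    then show ?thesis using \<phi> by (auto simp: phase_space_def hscale_def velocity_history_def zero_prod_def)
  qed
  then show thesis by (rule that[OF ext])
qed

text \<open>A generalised eigenvector would have to compensate, by a feedback of size \<open>1 / \<epsilon>\<close>, a drift of
  bounded size along the left eigenvector.\<close>

lemma no_generalised_eigenvector:
  fixes w
  defines "g \<equiv> \<lambda>t. (w t \<bullet> b t) * (K \<bullet> velocity t)"
  assumes \<phi>: "\<phi> \<in> phase_space T \<epsilon>"
    and gen: "time_T_map f xs T \<epsilon> \<delta> K \<phi> - \<phi> = hscale c velocity_history"
    and w: "adjoint_solution w" "w T = w 0"
    and small: "\<And>t. t \<in> {0..\<delta>} \<Longrightarrow> \<bar>g t - g 0\<bar> \<le> \<bar>g 0\<bar> / 2" "\<epsilon> * \<bar>w 0 \<bullet> velocity 0\<bar> < \<bar>g 0\<bar> / 2"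
  shows "c = 0"
proof (rule ccontr)
  assume "c \<noteq> 0"
  obtain x xt where sol: "linearised_solution f xs T \<epsilon> \<delta> K \<phi> x xt"
    and U: "time_T_map f xs T \<epsilon> \<delta> K \<phi> = shift_back T x xt"
    using time_T_map_obtain[OF \<delta> \<phi>] by blast
  have shift: "x t = fst (\<phi> (t - T)) + c *s cvec (velocity t)" "xt t = snd (\<phi> (t - T)) + c *s cvec (velocity t)"
    if "t \<in> {0..T}" for t
  proof -
    have "shift_back T x xt (t - T) = \<phi> (t - T) + hscale c velocity_history (t - T)"
      using fun_cong[OF gen, of "t - T"] by (simp add: U algebra_simps)
    then show "x t = fst (\<phi> (t - T)) + c *s cvec (velocity t)" "xt t = snd (\<phi> (t - T)) + c *s cvec (velocity t)"
      using that velocity_plus_T[of "t - T"] by (auto simp: shift_back_def hscale_def velocity_history_def prod_eq_iff)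
  qed
  \<comment> \<open>The recursion turns the inhomogeneity into the explicit feedback
    \<open>- (c / \<epsilon>) K^T velocity\<close>, which no longer involves
    \<open>x\<close>.\<close>
  have diff: "xt t - x t = (- (c / of_real \<epsilon>)) *s cvec (velocity t)" if t: "t \<in> {0..T}" for t
  proof -
    have "snd (\<phi> (t - T)) + c *s cvec (velocity t) = (1 - \<epsilon>) *\<^sub>R snd (\<phi> (t - T)) + \<epsilon> *\<^sub>R fst (\<phi> (t - T))"
      using linearised_solution_delayed[OF \<delta> \<phi> sol t] shift(2)[OF t] by (simp add: delayed_def[OF \<delta> \<phi>])
    then have "of_real \<epsilon> *s (snd (\<phi> (t - T)) - fst (\<phi> (t - T))) = - (c *s cvec (velocity t))"
      by (simp add: vec_eq_iff algebra_simps scaleR_conv_of_real[where 'a=complex])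
    then have "snd (\<phi> (t - T)) - fst (\<phi> (t - T)) = (- (c / of_real \<epsilon>)) *s cvec (velocity t)"
      using \<epsilon> by (simp add: vec_eq_iff field_simps)
    then show ?thesis using shift[OF t] by simp
  qed
  let ?q = "\<lambda>t. cdot (w t) (x t)" and ?a = "c / of_real (\<epsilon> * \<delta>)"
  \<comment> \<open>Over the pulse the pairing changes by about
    \<open>- c * g 0 / \<epsilon>\<close>. The added linear term compensates this for
    \<open>g\<close> frozen at 0; the variation of \<open>g\<close> costs at most half of
    it.\<close>
  have "norm ((?q \<delta> + ?a * of_real (g 0) * of_real \<delta>) - (?q 0 + ?a * of_real (g 0) * of_real 0)) \<le> cmod ?a * (\<bar>g 0\<bar> / 2) * (\<delta> - 0)"
  proof (rule norm_increment_le)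
    fix t assume t: "t \<in> {0..\<delta>}"
    then have t': "t \<in> {0..T}" using \<delta> by auto
    have wd: "(w has_vector_derivative - (transpose (A t) *v w t)) (at t within {0..\<delta>})"
      by (rule has_vector_derivative_within_subset[of _ _ _ "{0..T}"])
        (use w t \<delta> in \<open>auto simp: adjoint_solution_def simp del: transpose_matrix_vector\<close>)
    have "(x has_vector_derivative cmv (A t) (x t) + (of_real (1 / \<delta>) * cdot K (xt t - x t)) *s cvec (b t)) (at t within {0..\<delta>})"
      using linearised_solution_is_solution[OF \<delta> \<phi> sol] t unfolding is_solution_def by blast
    from adjoint_pairing[OF wd this]
    have "(?q has_vector_derivative of_real (1 / \<delta>) * (- (c / of_real \<epsilon>) * of_real (K \<bullet> velocity t)) * of_real (w t \<bullet> b t)) (at t within {0..\<delta>})"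
      unfolding diff[OF t'] cdot_scale_right cdot_cvec .
    moreover have "of_real (1 / \<delta>) * (- (c / of_real \<epsilon>) * of_real (K \<bullet> velocity t)) * of_real (w t \<bullet> b t) = - ?a * of_real (g t)"
      by (simp add: g_def mult_ac)
    ultimately have "(?q has_vector_derivative - ?a * of_real (g t)) (at t within {0..\<delta>})" by simp
    from has_vector_derivative_add[OF this has_vector_derivative_mult_right[OF has_vector_derivative_of_real[OF DERIV_ident], where a="?a * of_real (g 0)"]]
    show "((\<lambda>t. ?q t + ?a * of_real (g 0) * of_real t) has_vector_derivative - ?a * of_real (g t - g 0)) (at t within {0..\<delta>})"
      by (simp add: algebra_simps diff_divide_distrib)
    show "norm (- ?a * of_real (g t - g 0)) \<le> cmod ?a * (\<bar>g 0\<bar> / 2)"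
      unfolding norm_mult norm_minus_cancel norm_of_real by (rule mult_left_mono[OF small(1)[OF t]]) simp
  qed (use \<delta> in auto)
  also have "cmod ?a * (\<bar>g 0\<bar> / 2) * (\<delta> - 0) = cmod c * (\<bar>g 0\<bar> / 2) / \<epsilon>"
    using \<epsilon> \<delta> by (simp add: norm_divide norm_mult)
  \<comment> \<open>The free piece leaves the pairing unchanged, so its change over the pulse is
    also the drift \<open>c * (w 0 \<bullet> velocity 0)\<close>, too small to match
    \<open>c * g 0 / \<epsilon>\<close>.\<close>
  also have "(?q \<delta> + ?a * of_real (g 0) * of_real \<delta>) - (?q 0 + ?a * of_real (g 0) * of_real 0) = c * of_real (w 0 \<bullet> velocity 0 + g 0 / \<epsilon>)"
  proof -
    have "?q \<delta> = cdot (w T) (x T)"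
      by (rule adjoint_pairing_free[symmetric, OF \<delta> w(1)])
        (use linearised_solution_is_solution[OF \<delta> \<phi> sol] in \<open>auto simp: is_solution_def\<close>)
    also have "x T = x 0 + c *s cvec (velocity 0)"
      using shift(1)[of T] T_pos linearised_solution_initial[OF \<delta> \<phi> sol] velocity_plus_T[of 0] by simp
    finally have "?q \<delta> = ?q 0 + c * of_real (w 0 \<bullet> velocity 0)"
      unfolding w(2) cdot_add_right cdot_scale_right cdot_cvec .
    then show ?thesis using \<delta> by (simp add: field_simps)
  qed
  finally have "cmod c * \<bar>w 0 \<bullet> velocity 0 + g 0 / \<epsilon>\<bar> \<le> cmod c * (\<bar>g 0\<bar> / 2 / \<epsilon>)"
    unfolding norm_mult norm_of_real by simp
  then have "\<bar>w 0 \<bullet> velocity 0 + g 0 / \<epsilon>\<bar> \<le> \<bar>g 0\<bar> / 2 / \<epsilon>"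
    by (rule mult_left_le_imp_le) (simp add: \<open>c \<noteq> 0\<close>)
  then have "\<bar>g 0\<bar> / \<epsilon> \<le> \<bar>w 0 \<bullet> velocity 0\<bar> + \<bar>g 0\<bar> / 2 / \<epsilon>"
    using \<epsilon> by (simp add: abs_if split: if_splits)
  then have "\<bar>g 0\<bar> \<le> \<epsilon> * \<bar>w 0 \<bullet> velocity 0\<bar> + \<bar>g 0\<bar> / 2"
    using \<epsilon> by (simp add: field_simps)
  with small(2) show False by linarith
qed

end
end
end

section \<open>Simplicity of the multiplier 1 and choice of the constants\<close>

lemma phase_space_diff:
  assumes "\<phi> \<in> phase_space T \<epsilon>" "\<psi> \<in> phase_space T \<epsilon>"
  shows "\<phi> - \<psi> \<in> phase_space T \<epsilon>"
proof -
  have "continuous_on {-T..0} (\<lambda>t. \<phi> t - \<psi> t)"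
    using assms by (intro continuous_intros) (auto simp: phase_space_def)
  then show ?thesis
    using assms by (auto simp: phase_space_def fun_diff_def algebra_simps)
qed

context controlled_orbit
begin

text \<open>For \<open>N = U - 1\<close> the absence of generalised eigenvectors means that
  \<open>N\<close> and its square have the same kernel. As \<open>N\<close> preserves the phase
  space, induction extends this to all powers, so the generalised eigenspace is the line spanned by
  \<open>velocity_history\<close>.\<close>

lemma simple_multiplier_1:
  assumes \<delta>: "0 < \<delta>" "\<delta> < T" and \<epsilon>: "\<epsilon> > 0"
    and K: "stabilising_gain P\<^sub>0 b\<^sub>0 K"
    and w: "adjoint_solution w" "w T = w 0"
    and small: "\<And>t. t \<in> {0..\<delta>} \<Longrightarrow>
        \<bar>(w t \<bullet> b t) * (K \<bullet> velocity t) - (w 0 \<bullet> b 0) * (K \<bullet> velocity 0)\<bar> \<le> \<bar>(w 0 \<bullet> b 0) * (K \<bullet> velocity 0)\<bar> / 2"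
      "\<epsilon> * \<bar>w 0 \<bullet> velocity 0\<bar> < \<bar>(w 0 \<bullet> b 0) * (K \<bullet> velocity 0)\<bar> / 2"
  shows "simple_floquet_multiplier f xs T \<epsilon> \<delta> K 1"
proof -
  interpret vs: vector_space "hscale :: complex \<Rightarrow> 'n history \<Rightarrow> 'n history"
    by (rule vector_space_hscale)
  let ?U = "time_T_map f xs T \<epsilon> \<delta> K" and ?V = "phase_space T \<epsilon> :: 'n history set"
  let ?N = "\<lambda>\<psi>. ?U \<psi> - hscale 1 \<psi>" and ?E = "generalized_eigenspace f xs T \<epsilon> \<delta> K 1"
  have U_eig: "?U (hscale c velocity_history) = hscale c velocity_history" for c
    by (rule time_T_map_velocity_history[OF \<delta>])
  have NV: "?N \<psi> \<in> ?V" if "\<psi> \<in> ?V" for \<psi>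
    unfolding hscale_1 by (rule phase_space_diff[OF time_T_map_phase_space[OF \<delta> that] that])
  \<comment> \<open>Covers the exponent 0 in the generalised eigenspace, which contributes the zero
    history.\<close>
  have N0: "?N 0 = 0"
    using U_eig[of 0] by (simp add: hscale_1)
  have NN: "?N \<psi> = 0" if \<psi>: "\<psi> \<in> ?V" "?N (?N \<psi>) = 0" for \<psi>
  proof -
    have "?U (?N \<psi>) = ?N \<psi>" using \<psi>(2) by (simp add: hscale_1)
    then obtain c where c: "?N \<psi> = hscale c velocity_history"
      using fixed_point_velocity_history[OF \<delta> \<epsilon> K NV[OF \<psi>(1)]] by blast
    then have "?U \<psi> - \<psi> = hscale c velocity_history" by (simp add: hscale_1)
    then have "c = 0"
      by (rule no_generalised_eigenvector[OF \<delta> \<epsilon> K \<psi>(1) _ w small])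
    with c show ?thesis by simp
  qed
  have NSuc: "?N \<psi> = 0" if "\<psi> \<in> ?V" "(?N ^^ Suc k) \<psi> = 0" for k \<psi>
    using that
  proof (induction k arbitrary: \<psi>)
    case (Suc k)
    have "(?N ^^ Suc k) (?N \<psi>) = 0" using Suc.prems(2) by (simp only: funpow_Suc_right o_apply)
    then have "?N (?N \<psi>) = 0" by (rule Suc.IH[OF NV[OF Suc.prems(1)]])
    then show ?case by (rule NN[OF Suc.prems(1)])
  qed simp
  have E: "?E = range (\<lambda>c. hscale c velocity_history)"
  proof (intro equalityI subsetI)
    fix \<psi> assume "\<psi> \<in> ?E"
    then obtain k where \<psi>: "\<psi> \<in> ?V" and k: "(?N ^^ k) \<psi> = 0"
      unfolding generalized_eigenspace_def by blast
    have "?N \<psi> = 0"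
    proof (cases k)
      case 0
      then show ?thesis using k N0 by simp
    next
      case (Suc k')
      then show ?thesis using NSuc[OF \<psi>] k by blast
    qed
    then have "?U \<psi> = \<psi>" by (simp add: hscale_1)
    then obtain c where "\<psi> = hscale c velocity_history"
      by (rule fixed_point_velocity_history[OF \<delta> \<epsilon> K \<psi>])
    then show "\<psi> \<in> range (\<lambda>c. hscale c velocity_history)" by (rule range_eqI)
  next
    fix \<psi> assume "\<psi> \<in> range (\<lambda>c. hscale c velocity_history :: 'n history)"
    then obtain c where c: "\<psi> = hscale c velocity_history" by blast
    have "(?N ^^ 1) \<psi> = 0" by (simp add: hscale_1 c U_eig)
    moreover have "\<psi> \<in> ?V" unfolding c by (rule velocity_history_phase_space)
    ultimately show "\<psi> \<in> ?E" unfolding generalized_eigenspace_def by blast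
  qed
  have "vs.dim ?E = card {velocity_history :: 'n history}"
  proof (rule vs.dim_unique)
    have "velocity_history \<in> range (\<lambda>c. hscale c velocity_history)"
      by (rule range_eqI[of _ _ 1]) (rule hscale_1[symmetric])
    then show "{velocity_history} \<subseteq> ?E" unfolding E by (rule insert_subset[THEN iffD2, OF conjI]) (rule empty_subsetI)
    show "?E \<subseteq> vs.span {velocity_history}" unfolding E vs.span_singleton by (rule order_refl)
    show "vs.independent {velocity_history}" using velocity_history_nonzero by simp
  qed simp
  then have "algebraic_multiplicity f xs T \<epsilon> \<delta> K 1 = 1"
    by (simp add: algebraic_multiplicity_def)
  moreover have "1 \<in> floquet_multipliers f xs T \<epsilon> \<delta> K"
    unfolding floquet_multipliers_def
    using U_eig[of 1] velocity_history_phase_space[of 1] velocity_history_nonzero by (auto simp: hscale_1)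
  ultimately show ?thesis by (simp add: simple_floquet_multiplier_def)
qed

lemma orbit_controlled_solution: "controlled_solution f T \<epsilon> \<delta> K xs xs"
  unfolding controlled_solution_def
proof (intro conjI allI)
  fix l u
  have "continuous_on {l..u} velocity"
    by (rule continuous_on_vector_derivative[OF velocity_deriv])
  then obtain M where "M-lipschitz_on {l..u} xs"
    using has_vector_derivative_bounded_imp_lipschitz[of l u xs velocity] orbit
    by (metis has_vector_derivative_at_within velocity_def)
  then show "abs_continuous_on l u xs" by (rule lipschitz_imp_abs_continuous_on)
next
  show "AE t in lborel. (xs has_vector_derivative f (xs t, pulse T \<delta> t * (K \<bullet> (xs t - xs t)))) (at t)"
    using orbit by simp
  show "xs t = (1 - \<epsilon>) *\<^sub>R xs (t - T) + \<epsilon> *\<^sub>R xs (t - T)" for t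
    using periodic[of "t - T"] by (simp add: algebra_simps)
qed

lemma stabilisable:
  "\<exists>K. \<exists>\<epsilon>\<^sub>0>0. \<exists>\<delta>\<^sub>0>0. \<forall>\<epsilon>\<in>{0<..<\<epsilon>\<^sub>0}. \<forall>\<delta>\<in>{0<..<\<delta>\<^sub>0}. \<delta> < T \<longrightarrow>
     controlled_solution f T \<epsilon> \<delta> K xs xs \<and> simple_floquet_multiplier f xs T \<epsilon> \<delta> K 1 \<and>
     (\<forall>\<mu>\<in>floquet_multipliers f xs T \<epsilon> \<delta> K. \<mu> \<noteq> 1 \<longrightarrow> cmod \<mu> < 1)"
proof -
  obtain K where K: "stabilising_gain P\<^sub>0 b\<^sub>0 K"
    using stabilising_gain_exists[OF ctrl det_P\<^sub>0_pos] by blast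
  obtain w where w: "adjoint_solution w" "w T = w 0" "w 0 \<bullet> b\<^sub>0 \<noteq> 0"
    by (rule periodic_adjoint_solution)
  obtain \<epsilon>1 \<delta>1 where pos: "\<epsilon>1 > 0" "\<delta>1 > 0" and stable:
    "\<And>\<epsilon> \<delta> \<mu>. \<lbrakk>\<epsilon> \<in> {0<..<\<epsilon>1}; \<delta> \<in> {0<..<\<delta>1}; \<delta> < T; \<mu> \<in> floquet_multipliers f xs T \<epsilon> \<delta> K; \<mu> \<noteq> 1\<rbrakk> \<Longrightarrow> cmod \<mu> < 1"
    using unstable_multiplier_eq_1[OF K w] by blast
  define g where "g t = (w t \<bullet> b t) * (K \<bullet> velocity t)" for t
  \<comment> \<open>The lemma lives in a context fixing \<delta> and \<epsilon>, which its
    conclusion does not mention; \<open>T / 2\<close> and 1 are arbitrary admissible values.\<close>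
  have "K \<bullet> velocity 0 \<noteq> 0"
    by (rule K_velocity_nonzero[of "T / 2" 1, OF _ _ _ K]) (use T_pos in auto)
  then have g0: "g 0 \<noteq> 0" using w(3) by (simp add: g_def b\<^sub>0_def)
  have "continuous_on {0..T} w"
    using w(1) unfolding adjoint_solution_def by (intro continuous_on_vector_derivative[of _ w]) blast
  moreover have "continuous_on {0..T} velocity"
    by (rule continuous_on_vector_derivative[OF velocity_deriv])
  ultimately have "continuous_on {0..T} g"
    unfolding g_def by (intro continuous_intros cont_b)
  moreover have "\<bar>g 0\<bar> / 2 > 0" "0 \<in> {0..T}" using g0 T_pos by auto
  ultimately obtain \<delta>2 where "\<delta>2 > 0" and \<delta>2: "\<And>t. t \<in> {0..T} \<Longrightarrow> dist t 0 < \<delta>2 \<Longrightarrow> dist (g t) (g 0) < \<bar>g 0\<bar> / 2"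
    unfolding continuous_on_iff by blast
  \<comment> \<open>The summand 1 avoids a division by 0 when
    \<open>w 0 \<bullet> velocity 0\<close> vanishes.\<close>
  define \<epsilon>2 where "\<epsilon>2 = \<bar>g 0\<bar> / 2 / (\<bar>w 0 \<bullet> velocity 0\<bar> + 1)"
  have "\<epsilon>2 > 0" using g0 by (simp add: \<epsilon>2_def)
  have \<epsilon>2: "\<epsilon> * \<bar>w 0 \<bullet> velocity 0\<bar> < \<bar>g 0\<bar> / 2" if "0 < \<epsilon>" "\<epsilon> < \<epsilon>2" for \<epsilon>
  proof -
    have "\<epsilon> * \<bar>w 0 \<bullet> velocity 0\<bar> < \<epsilon> * (\<bar>w 0 \<bullet> velocity 0\<bar> + 1)" using that by simp
    also have "\<dots> < \<epsilon>2 * (\<bar>w 0 \<bullet> velocity 0\<bar> + 1)" using that by (intro mult_strict_right_mono) auto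
    also have "\<dots> = \<bar>g 0\<bar> / 2"
      unfolding \<epsilon>2_def by (rule nonzero_eq_divide_eq[THEN iffD1, OF _ refl]) linarith
    finally show ?thesis .
  qed
  have "simple_floquet_multiplier f xs T \<epsilon> \<delta> K 1"
    if "\<epsilon> \<in> {0<..<min \<epsilon>1 \<epsilon>2}" "\<delta> \<in> {0<..<min \<delta>1 \<delta>2}" "\<delta> < T" for \<epsilon> \<delta>
  proof (rule simple_multiplier_1[OF _ that(3) _ K w(1,2)])
    fix t assume "t \<in> {0..\<delta>}"
    then show "\<bar>(w t \<bullet> b t) * (K \<bullet> velocity t) - (w 0 \<bullet> b 0) * (K \<bullet> velocity 0)\<bar> \<le> \<bar>(w 0 \<bullet> b 0) * (K \<bullet> velocity 0)\<bar> / 2"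
      using \<delta>2[of t] that unfolding g_def[symmetric] by (simp add: dist_real_def)
  next
    show "\<epsilon> * \<bar>w 0 \<bullet> velocity 0\<bar> < \<bar>(w 0 \<bullet> b 0) * (K \<bullet> velocity 0)\<bar> / 2"
      using \<epsilon>2[of \<epsilon>] that unfolding g_def[symmetric] by simp
  qed (use that in auto)
  then show ?thesis
    using stable orbit_controlled_solution pos \<open>\<epsilon>2 > 0\<close> \<open>\<delta>2 > 0\<close>
    by (intro exI[of _ K] exI[of _ "min \<epsilon>1 \<epsilon>2"] exI[of _ "min \<delta>1 \<delta>2"] conjI ballI impI) auto
qed

end

theorem theorem1p1:
  fixes f :: "(real^'n) \<times> real \<Rightarrow> real^'n"
    and xs :: "real \<Rightarrow> real^'n"
    and Y :: "real \<Rightarrow> real^'n^'n"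
    and P\<^sub>0 :: "real^'n^'n"
    and b\<^sub>0 :: "real^'n"
    and T :: real
  assumes "smooth f"
    and "T > 0"
    and "\<And>t. (xs has_vector_derivative f (xs t, 0)) (at t)"
    and "\<And>t. xs (t + T) = xs t"
    and "\<not> (\<exists>c. \<forall>t. xs t = c)"
    and "Y 0 = mat 1"
    and "\<And>t. t \<in> {0..T} \<Longrightarrow>
           (Y has_vector_derivative (orbit_A f xs t ** Y t)) (at t within {0..T})"
    and "P\<^sub>0 = Y T"
    and "b\<^sub>0 = orbit_b f xs 0"
    and "controllable P\<^sub>0 b\<^sub>0"
  shows "\<exists>K\<^sub>0 :: real^'n. \<exists>\<epsilon>\<^sub>0>0. \<exists>\<delta>\<^sub>0>0.
           \<forall>\<epsilon>\<in>{0<..<\<epsilon>\<^sub>0}. \<forall>\<delta>\<in>{0<..<\<delta>\<^sub>0}. \<delta> < T \<longrightarrow>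
             controlled_solution f T \<epsilon> \<delta> K\<^sub>0 xs xs \<and>
             simple_floquet_multiplier f xs T \<epsilon> \<delta> K\<^sub>0 1 \<and>
             (\<forall>\<mu>\<in>floquet_multipliers f xs T \<epsilon> \<delta> K\<^sub>0. \<mu> \<noteq> 1 \<longrightarrow> cmod \<mu> < 1)"
proof -
  interpret controlled_orbit f xs Y P\<^sub>0 b\<^sub>0 T
    by unfold_locales (fact assms)+
  show ?thesis by (rule stabilisable)
qed

end
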